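(* Let $n\ge1$, $p>0$, let $X\subset\mathbb{R}^n$ be compact, and let $v:X\to\mathbb{R}$ be Lipschitz, convex, and of class $C^2_+$ in $\operatorname{int}(X)$. Let $\omega:\mathbb{R}^{n+1}\to\mathbb{R}$ be continuous and positive. Then there exists a constant $\delta_{p,n}$, depending only on $n$ and $p$, such that \[ \lim_{m\to+\infty} m^{\frac{2p}{n}}\,\triangle_p(v,P^c_{(m)},\omega)=\frac{\delta_{p,n}}{2^p}\left(\int_X(\det D^2v(x))^{\frac{p}{n+2p}}\,\omega(x,v(x))^{\frac{n}{n+2p}}\,\mathrm{d}x\right)^{\frac{n+2p}{n}}. \]
   Context: $C^2_+$ means twice continuously differentiable with positive definite Hessian $D^2v$. $P^c_{(m)}=P^c_{(m)}(v)$ is the class of functions $l_m(x)=\max_{1\le j\le m}\psi_j(x)$ for at most $m$ affine functions $\psi_j:\mathbb{R}^n\to\mathbb{R}$ with $l_m(x)\le v(x)$ for all $x\in X$, and for sufficiently large $m$, \[ \triangle_p(v,P^c_{(m)},\omega)=\inf\Big\{\int_X(v(x)-l_m(x))^p\,\omega(x,v(x))\,\mathrm{d}x:\ l_m\in P^c_{(m)}\Big\}. \] (The constant $\delta_{p,n}$ is the one arising from Zador's quantization theorem: for every Jordan measurable compact $J\subset\mathbb{R}^n$ of positive volume, $\lim_{m\to\infty}m^{2p/n}\inf_{S\subset J,\#S=m}\int_J\min_{s\in S}\|x-s\|^{2p}\,\mathrm{d}x=\delta_{p,n}V_n(J)^{(n+2p)/n}$.) *)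

theory Defs
  imports "HOL-Analysis.Analysis"
begin

definition partial_deriv :: "(real^'n \<Rightarrow> real) \<Rightarrow> 'n \<Rightarrow> real^'n \<Rightarrow> real" where
  "partial_deriv f i x = deriv (\<lambda>t. f (x + t *\<^sub>R axis i 1)) 0"

definition hessian :: "(real^'n \<Rightarrow> real) \<Rightarrow> real^'n \<Rightarrow> real^'n^'n" where
  "hessian f x = (\<chi> i j. partial_deriv (\<lambda>y. partial_deriv f j y) i x)"

definition C2_plus_on :: "(real^'n) set \<Rightarrow> (real^'n \<Rightarrow> real) \<Rightarrow> bool" where
  "C2_plus_on U f \<longleftrightarrow>
     (\<exists>g H. (\<forall>x\<in>U. (f has_derivative (\<lambda>h. g x \<bullet> h)) (at x)
                  \<and> (g has_derivative (\<lambda>h. H x *v h)) (at x)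
                  \<and> (\<forall>h. h \<noteq> 0 \<longrightarrow> h \<bullet> (H x *v h) > 0))
            \<and> continuous_on U H)"

definition affine_fun :: "(real^'n) \<times> real \<Rightarrow> real^'n \<Rightarrow> real" where
  "affine_fun ab x = fst ab \<bullet> x + snd ab"

definition Pc :: "nat \<Rightarrow> (real^'n) set \<Rightarrow> (real^'n \<Rightarrow> real) \<Rightarrow> (real^'n \<Rightarrow> real) set" where
  "Pc m X v = {l. \<exists>A. finite A \<and> A \<noteq> {} \<and> card A \<le> m
                     \<and> l = (\<lambda>x. Max ((\<lambda>ab. affine_fun ab x) ` A))
                     \<and> (\<forall>x\<in>X. l x \<le> v x)}"

text \<open>The error functional triangle_p(v, P^c_(m), omega); omega is a function on
  R^n x R = R^(n+1), written in curried form.\<close>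
definition approx_error ::
  "real \<Rightarrow> (real^'n) set \<Rightarrow> (real^'n \<Rightarrow> real) \<Rightarrow> (real^'n \<Rightarrow> real \<Rightarrow> real) \<Rightarrow> nat \<Rightarrow> real" where
  "approx_error p X v \<omega> m =
     (INF l\<in>Pc m X v. integral X (\<lambda>x. (v x - l x) powr p * \<omega> x (v x)))"

definition jordan_measurable :: "(real^'n) set \<Rightarrow> bool" where
  "jordan_measurable J \<longleftrightarrow> bounded J \<and> negligible (frontier J)"

definition zador_constant :: "real \<Rightarrow> 'n::finite itself \<Rightarrow> real \<Rightarrow> bool" where
  "zador_constant p (_ :: 'n itself) \<delta> \<longleftrightarrow>
     (\<forall>J :: (real^'n) set. compact J \<and> jordan_measurable J \<and> measure lebesgue J > 0 \<longrightarrow>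
        ((\<lambda>m. real m powr (2 * p / real CARD('n)) *
              (INF S\<in>{S. S \<subseteq> J \<and> finite S \<and> card S = m}.
                 integral J (\<lambda>x. Min ((\<lambda>s. norm (x - s) powr (2 * p)) ` S))))
          \<longlonglongrightarrow> \<delta> * measure lebesgue J powr ((real CARD('n) + 2 * p) / real CARD('n))))"

end

theory Submission
  imports Defs "HOL-Real_Asymp.Real_Asymp"
begin

text \<open>
  Write \<open>n\<close> for the dimension, \<open>\<theta> = 2 p / n\<close>, and let \<open>E(J,k)\<close> be the infimum of
  \<open>\<integral>\<^sub>J min\<^sub>s |x - s|\<^sup>2\<^sup>p\<close> over quantizers with at most \<open>k\<close> points. Tiling the unit cube \<open>Q\<close> by \<open>j\<^sup>n\<close>
  copies of itself gives \<open>E(Q, j\<^sup>n k) \<le> j\<^sup>-\<^sup>2\<^sup>p E(Q,k)\<close>, so \<open>k\<^sup>\<theta> E(Q,k)\<close> converges to its infimum \<open>\<delta>\<close>.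

  Two principles pass from cells to a whole domain. Upper bounds: distribute most of the points over
  the cells \<open>K\<close> in proportion to weights \<open>c K\<close>, and spend a small fraction of them on a uniformly good
  approximation of the rest, which has small measure. Lower bounds: if the cells receive \<open>k K\<close> points
  each, convexity of \<open>t\<^sup>-\<^sup>\<theta>\<close> bounds the sum of the cell errors in terms of the total number of points; on
  shrunk cells only points inside the original cell, and boundedly many extra ones, matter.

  With cubes as cells this gives Zador's theorem for Jordan measurable sets. For a convex function,
  the error of a tangent plane at \<open>s\<close> is about \<open>(x - s) \<bullet> H (x - s) / 2 = |B (x - s)|\<^sup>2 / 2\<close> with
  \<open>H = B\<^sup>T B\<close>, so on a small cell the problem becomes the quantization problem for the linear image of
  the cell under \<open>B\<close>. The rest is handled by Dudley's uniform \<open>O(k\<^sup>-\<^sup>2\<^sup>/\<^sup>n)\<close> approximation, which only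
  needs \<open>v\<close> to be Lipschitz. For lower bounds, an affine minorant matters on a shrunk cell only if its
  slope is the gradient of \<open>v\<close> at an interior point of the cell; since the gradient is injective, every
  minorant is charged to at most one cell. Finally \<open>det H\<close> is integrable because its integral is the
  volume of the bounded image of the gradient.
\<close>

section \<open>Change of variables for arbitrary finite index types\<close>

text \<open>Near the boundary of \<open>X\<close> the second derivatives may be unbounded, so
  neither a uniform modulus of continuity of \<open>H\<close> nor a bound on \<open>det H\<close> is
  available. Hence cells are chosen pointwise, with variable sizes, and only finitely many are used;
  what they miss is small both in volume and in the integral of the limiting density.

  The exponents come from an allocation problem. A cell of volume V, weight w and matrix B costs
  about \<delta> / 2^p w |det B|^\<theta> V^(1+\<theta>) k^(-\<theta>) with k pieces: quantizing the
  image, of volume |det B| V, contributes |det B|^(1+\<theta>), and pulling the integral back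
  divides by |det B|. Write this as D c^(1+\<theta>) k^(-\<theta>). The optimal k is proportional to
  c, the total is D (sum c)^(1+\<theta>) m^(-\<theta>), and c = w^(1/(1+\<theta>)) |det
  B|^(\<theta>/(1+\<theta>)) V. As det H = (det B)^2, sum c is a Riemann sum for the integral in the
  theorem; 2^p stems from the 1/2 in Taylor's formula.

  Zador's theorem for cubes alone would not suffice, since their images under B are
  parallelepipeds.\<close>

text \<open>The library proves its change of variables theorems for well-ordered index types only;
  the copy of the index type with some well-ordering transfers them to arbitrary finite ones.\<close>

typedef 'n wo = "UNIV :: 'n set" by simp

instance wo :: (finite) finite
proof
  have "finite (Abs_wo ` (UNIV :: 'a set))" by simp
  moreover have "Abs_wo ` (UNIV :: 'a set) = UNIV"
    by (metis Rep_wo_inverse surjI)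
  ultimately show "finite (UNIV :: 'a wo set)" by simp
qed

text \<open>Any injection into the naturals pulls back a well-ordering; an arbitrary one is
  chosen.\<close>

definition wo_rank :: "'n::finite wo \<Rightarrow> nat" where
  "wo_rank = (SOME f. inj f)"

lemma inj_wo_rank: "inj (wo_rank :: 'n::finite wo \<Rightarrow> nat)"
proof -
  have "\<exists>f :: 'n wo \<Rightarrow> nat. inj f"
    using finite_imp_inj_to_nat_seg[of "UNIV :: 'n wo set"] by auto
  then show ?thesis
    unfolding wo_rank_def by (rule someI_ex)
qed

instantiation wo :: (finite) wellorder
begin

definition less_eq_wo :: "'a wo \<Rightarrow> 'a wo \<Rightarrow> bool" where
  "less_eq_wo a b \<longleftrightarrow> wo_rank a \<le> wo_rank b"

definition less_wo :: "'a wo \<Rightarrow> 'a wo \<Rightarrow> bool" where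
  "less_wo a b \<longleftrightarrow> wo_rank a < wo_rank b"

instance
proof
  fix x y z :: "'a wo"
  show "(x < y) = (x \<le> y \<and> \<not> y \<le> x)"
    by (auto simp: less_eq_wo_def less_wo_def)
  show "x \<le> x" by (simp add: less_eq_wo_def)
  show "x \<le> y \<Longrightarrow> y \<le> z \<Longrightarrow> x \<le> z" by (simp add: less_eq_wo_def)
  show "x \<le> y \<Longrightarrow> y \<le> x \<Longrightarrow> x = y"
    using inj_wo_rank by (auto simp: less_eq_wo_def inj_def)
  show "x \<le> y \<or> y \<le> x" by (auto simp: less_eq_wo_def)
next
  fix P :: "'a wo \<Rightarrow> bool" and a
  assume step: "\<And>x. (\<And>y. y < x \<Longrightarrow> P y) \<Longrightarrow> P x"
  show "P a"
  proof (induction "wo_rank a" arbitrary: a rule: less_induct)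
    case less
    show ?case by (rule step) (rule less, simp add: less_wo_def)
  qed
qed

end

section \<open>Relabelling coordinates and its effect on boxes and integrals\<close>

lemma bij_Rep_wo: "bij (Rep_wo :: 'n wo \<Rightarrow> 'n)"
  by (metis Abs_wo_inverse Rep_wo_inverse UNIV_I bijI')

lemma bij_Abs_wo: "bij (Abs_wo :: 'n \<Rightarrow> 'n wo)"
  by (metis Abs_wo_inverse Rep_wo_inverse UNIV_I bijI')

lemma Abs_wo_inv [simp]: "Rep_wo (Abs_wo x) = x"
  by (simp add: Abs_wo_inverse)

definition vwo :: "real^'n \<Rightarrow> real^('n wo)" where
  "vwo x = (\<chi> i. x $ Rep_wo i)"

definition vun :: "real^('n wo) \<Rightarrow> real^'n" where
  "vun x = (\<chi> i. x $ Abs_wo i)"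

lemma vun_vwo [simp]: "vun (vwo x) = x" and vwo_vun [simp]: "vwo (vun y) = y"
  by (simp_all add: vun_def vwo_def vec_eq_iff Rep_wo_inverse)

lemma vwo_image_eq_vimage: "vwo ` S = vun -` S"
  by (force simp: image_iff)

lemma inj_vwo: "inj vwo"
  by (metis injI vun_vwo)

lemma linear_vwo: "linear (vwo :: real^'n::finite \<Rightarrow> _)"
  by (rule linearI) (simp_all add: vwo_def vec_eq_iff)

lemma linear_vun: "linear (vun :: real^'n::finite wo \<Rightarrow> _)"
  by (rule linearI) (simp_all add: vun_def vec_eq_iff)

lemma isCont_vwo: "isCont (vwo :: real^'n::finite \<Rightarrow> _) x"
  using linear_vwo by (intro bounded_linear.isCont[OF _ continuous_ident]) (simp add: linear_conv_bounded_linear)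

lemma isCont_vun: "isCont (vun :: real^'n::finite wo \<Rightarrow> _) x"
  using linear_vun by (intro bounded_linear.isCont[OF _ continuous_ident]) (simp add: linear_conv_bounded_linear)

lemma norm_vwo [simp]: "norm (vwo (x :: real^'n::finite)) = norm x"
proof -
  have "(\<Sum>i\<in>UNIV. (x $ Rep_wo i)\<^sup>2) = (\<Sum>i\<in>UNIV. (x $ i)\<^sup>2)"
    by (rule sum.reindex_bij_betw) (use bij_Rep_wo in blast)
  then show ?thesis
    by (simp add: norm_vec_def L2_set_def vwo_def)
qed

lemma norm_vun [simp]: "norm (vun (x :: real^'n::finite wo)) = norm x"
  by (metis norm_vwo vwo_vun)

lemma vwo_cbox: "vwo ` cbox a b = cbox (vwo a) (vwo (b :: real^'n::finite))"
proof -
  have "vun y \<in> cbox a b \<longleftrightarrow> y \<in> cbox (vwo a) (vwo b)" for y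
    unfolding mem_box_cart vun_def vwo_def by simp (metis Rep_wo_inverse Abs_wo_inv)
  then show ?thesis by (auto simp: vwo_image_eq_vimage)
qed

lemma vun_cbox: "vun ` cbox a b = cbox (vun a) (vun (b :: real^'n::finite wo))"
  by (metis (no_types, lifting) image_comp image_cong o_apply vun_vwo vwo_cbox vwo_vun image_ident)

lemma content_vwo_cbox: "measure lborel (cbox (vwo a) (vwo b)) = measure lborel (cbox a (b :: real^'n::finite))"
proof -
  have ne: "cbox (vwo a) (vwo b) = {} \<longleftrightarrow> cbox a b = {}"
    by (metis image_is_empty vwo_cbox)
  have "(\<Prod>i\<in>UNIV. b $ Rep_wo i - a $ Rep_wo i) = (\<Prod>i\<in>UNIV. b $ i - a $ i)"
    by (rule prod.reindex_bij_betw) (use bij_Rep_wo in blast)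
  then show ?thesis
    by (simp add: content_cbox_if_cart ne) (simp add: vwo_def)
qed

text \<open>\<open>has_integral_twiddle\<close> applies to maps that send boxes to boxes and scale
  contents by a fixed factor. Relabelling coordinates does so with factor 1.\<close>

lemma has_integral_vwo_cbox:
  fixes f :: "real^'n::finite \<Rightarrow> real"
  assumes "(f has_integral i) (cbox a b)"
  shows "((\<lambda>x. f (vun x)) has_integral i) (cbox (vwo a) (vwo b))"
proof -
  have "((\<lambda>x. f (vun x)) has_integral (1 / 1) *\<^sub>R i) (vwo ` cbox a b)"
  proof (rule has_integral_twiddle)
    show "isCont vun x" for x :: "real^'n wo"
      by (rule isCont_vun)
    show "measure lborel (vun ` cbox u v) = 1 * measure lborel (cbox u v)" for u v :: "real^'n wo"
      by (metis content_vwo_cbox mult_1 vun_cbox vwo_vun)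
    show "\<exists>w z. vun ` cbox u v = cbox w z" for u v :: "real^'n wo"
      using vun_cbox by blast
    show "\<exists>w z. vwo ` cbox u v = cbox w z" for u v :: "real^'n"
      using vwo_cbox by blast
  qed (use assms in auto)
  then show ?thesis by (simp add: vwo_cbox)
qed

lemma has_integral_vun_cbox:
  fixes f :: "real^'n::finite wo \<Rightarrow> real"
  assumes "(f has_integral i) (cbox a b)"
  shows "((\<lambda>x. f (vwo x)) has_integral i) (cbox (vun a) (vun b))"
proof -
  have "((\<lambda>x. f (vwo x)) has_integral (1 / 1) *\<^sub>R i) (vun ` cbox a b)"
  proof (rule has_integral_twiddle)
    show "isCont vwo x" for x :: "real^'n"
      by (rule isCont_vwo)
    show "measure lborel (vwo ` cbox u v) = 1 * measure lborel (cbox u v)" for u v :: "real^'n"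
      by (metis content_vwo_cbox mult_1 vwo_cbox)
    show "\<exists>w z. vun ` cbox u v = cbox w z" for u v :: "real^'n wo"
      using vun_cbox by blast
    show "\<exists>w z. vwo ` cbox u v = cbox w z" for u v :: "real^'n"
      using vwo_cbox by blast
  qed (use assms in auto)
  then show ?thesis by (simp add: vun_cbox)
qed

lemma ball_subset_vwo: "ball 0 B \<subseteq> cbox (vwo a) (vwo b) \<longleftrightarrow> ball 0 B \<subseteq> cbox a (b :: real^'n::finite)"
proof -
  have "vwo ` ball 0 B = ball 0 B"
    by (auto simp: vwo_image_eq_vimage)
  then show ?thesis
    by (metis vwo_cbox inj_vwo inj_image_subset_iff)
qed

text \<open>An integral over an arbitrary set is a limit over boxes that contain a large ball around
  0 (\<open>has_integral_alt'\<close>). Relabelling matches boxes with boxes and these balls with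
  balls, so both limits are the same condition. The equivalence also transfers non-integrability, so
  \<open>integral_vwo\<close> holds for every \<open>f\<close>.\<close>

lemma has_integral_vwo_iff:
  fixes f :: "real^'n::finite \<Rightarrow> real"
  shows "((\<lambda>x. f (vun x)) has_integral i) (vwo ` S) \<longleftrightarrow> (f has_integral i) S"
proof -
  let ?f = "\<lambda>x. if x \<in> S then f x else 0"
  let ?g = "\<lambda>x. if x \<in> vwo ` S then f (vun x) else 0"
  have g: "?g x = ?f (vun x)" for x by (simp add: vwo_image_eq_vimage)
  have fg: "?f x = ?g (vwo x)" for x by (simp add: vwo_image_eq_vimage)
  have cb: "(?g has_integral j) (cbox (vwo a) (vwo b)) \<longleftrightarrow> (?f has_integral j) (cbox a b)" for a b j
  proof
    assume "(?g has_integral j) (cbox (vwo a) (vwo b))"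
    from has_integral_vun_cbox[OF this] show "(?f has_integral j) (cbox a b)"
      by (simp only: vun_vwo fg)
  next
    assume "(?f has_integral j) (cbox a b)"
    from has_integral_vwo_cbox[OF this] show "(?g has_integral j) (cbox (vwo a) (vwo b))"
      by (simp only: g)
  qed
  have all: "(\<forall>a b. P a b) \<longleftrightarrow> (\<forall>a b. P (vwo a) (vwo b))"
    for P :: "real^'n wo \<Rightarrow> real^'n wo \<Rightarrow> bool"
    by (metis vwo_vun)
  have ig: "?g integrable_on cbox (vwo a) (vwo b) \<longleftrightarrow> ?f integrable_on cbox a b"
    "integral (cbox (vwo a) (vwo b)) ?g = integral (cbox a b) ?f" for a b
    unfolding integrable_on_def integral_def cb by simp_all
  show ?thesis
    unfolding has_integral_alt'[of _ _ "vwo ` S"] has_integral_alt'[of _ _ S]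
      all[where P = "\<lambda>a b. ?g integrable_on cbox a b"]
      all[where P = "\<lambda>a b. ball 0 _ \<subseteq> cbox a b \<longrightarrow> norm (integral (cbox a b) ?g - i) < _"]
      ig ball_subset_vwo ..
qed

lemma absolutely_integrable_vwo_iff:
  fixes f :: "real^'n::finite \<Rightarrow> real"
  shows "(\<lambda>x. f (vun x)) absolutely_integrable_on (vwo ` S) \<longleftrightarrow> f absolutely_integrable_on S"
  unfolding absolutely_integrable_on_def integrable_on_def
  using has_integral_vwo_iff[of f _ S] has_integral_vwo_iff[of "\<lambda>x. norm (f x)" _ S] by simp

lemma vwo_eq_iff [simp]: "vwo x = vwo y \<longleftrightarrow> x = y"
  using inj_vwo by (auto dest: injD)

lemma integral_vwo:
  fixes f :: "real^'n::finite \<Rightarrow> real"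
  shows "integral (vwo ` S) (\<lambda>x. f (vun x)) = integral S f"
  unfolding integral_def integrable_on_def has_integral_vwo_iff ..

section \<open>Signs and determinants under relabelling\<close>

lemma swapidseq_wo:
  fixes p :: "'n \<Rightarrow> 'n"
  shows "swapidseq n p \<Longrightarrow> swapidseq n (Abs_wo \<circ> p \<circ> Rep_wo)"
proof (induction rule: swapidseq.induct)
  case id
  have "Abs_wo \<circ> (id :: 'n \<Rightarrow> 'n) \<circ> Rep_wo = id" by (rule ext) (simp add: Rep_wo_inverse)
  then show ?case using swapidseq.id by (simp only:)
next
  case (comp_Suc n p a b)
  have "Abs_wo \<circ> (Transposition.transpose a b \<circ> p) \<circ> Rep_wo =
      Transposition.transpose (Abs_wo a) (Abs_wo b) \<circ> (Abs_wo \<circ> p \<circ> Rep_wo)"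
    by (rule ext) (auto simp: Transposition.transpose_def Abs_wo_inject)
  moreover have "Abs_wo a \<noteq> Abs_wo b"
    using comp_Suc by (simp add: Abs_wo_inject)
  ultimately show ?case
    using swapidseq.comp_Suc comp_Suc by metis
qed

text \<open>Conjugation by the relabelling turns a product of \<open>n\<close> transpositions into a
  product of \<open>n\<close> transpositions, so the parity is kept.\<close>

lemma sign_wo:
  assumes "p permutes (UNIV :: 'n::finite set)"
  shows "sign (Abs_wo \<circ> p \<circ> Rep_wo) = sign p"
proof -
  obtain n where n: "swapidseq n p"
    using assms permutation_permutes[of p] unfolding permutation_def by auto
  show ?thesis
    unfolding sign_def evenperm_unique[OF n refl] evenperm_unique[OF swapidseq_wo[OF n] refl] ..
qed

text \<open>Conjugation is a bijection between the permutations of the two index types, so the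
  Leibniz sums agree term by term.\<close>

lemma det_wo:
  fixes A :: "real^'n^'n::finite"
  shows "det (\<chi> i j. A $ Rep_wo i $ Rep_wo j) = det A"
proof -
  let ?c = "\<lambda>p. Abs_wo \<circ> p \<circ> Rep_wo" and ?d = "\<lambda>q. Rep_wo \<circ> q \<circ> Abs_wo"
  let ?B = "(\<chi> i j. A $ Rep_wo i $ Rep_wo j) :: real^'n wo^'n wo"
  have pu: "p permutes UNIV \<longleftrightarrow> bij p" for p :: "'b \<Rightarrow> 'b"
    using bij_imp_permutes permutes_bij by blast
  have "det A = (\<Sum>p | p permutes UNIV. of_int (sign p) * (\<Prod>i\<in>UNIV. A $ i $ p i))"
    by (simp add: det_def)
  also have "\<dots> = (\<Sum>q | q permutes UNIV. of_int (sign q) * (\<Prod>i\<in>UNIV. ?B $ i $ q i))"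
  proof (rule sum.reindex_bij_witness[where i = ?d and j = ?c])
    fix p :: "'n \<Rightarrow> 'n" assume p: "p \<in> {p. p permutes UNIV}"
    show "?d (?c p) = p" by auto
    show "?c p \<in> {q. q permutes UNIV}"
      using p bij_Abs_wo bij_Rep_wo by (auto simp: pu intro!: bij_comp)
    have "(\<Prod>i\<in>UNIV. A $ Rep_wo i $ p (Rep_wo i)) = (\<Prod>i\<in>UNIV. A $ i $ p i)"
      by (rule prod.reindex_bij_betw) (use bij_Rep_wo in blast)
    with p show "of_int (sign (?c p)) * (\<Prod>i\<in>UNIV. ?B $ i $ ?c p i) = of_int (sign p) * (\<Prod>i\<in>UNIV. A $ i $ p i)"
      by (simp add: sign_wo)
  next
    fix q :: "'n wo \<Rightarrow> 'n wo" assume q: "q \<in> {q. q permutes UNIV}"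
    show "?c (?d q) = q" by (auto simp: Rep_wo_inverse)
    show "?d q \<in> {p. p permutes UNIV}"
      using q bij_Abs_wo bij_Rep_wo by (auto simp: pu intro!: bij_comp)
  qed
  also have "\<dots> = det ?B" by (simp add: det_def)
  finally show ?thesis ..
qed

lemma det_matrix_wo:
  fixes g :: "real^'n::finite \<Rightarrow> real^'n"
  shows "det (matrix (vwo \<circ> g \<circ> vun)) = det (matrix g)"
proof -
  have ax: "vun (axis j 1) = axis (Rep_wo j) 1" for j :: "'n wo"
    by (auto simp: vun_def axis_def vec_eq_iff Rep_wo_inverse)
  have "matrix (vwo \<circ> g \<circ> vun) = (\<chi> i j. matrix g $ Rep_wo i $ Rep_wo j)"
    by (simp add: matrix_def vwo_def ax)
  then show ?thesis by (simp add: det_wo)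
qed

section \<open>Linear and injective changes of variables\<close>

lemma integral_linear_image:
  fixes f :: "real^'n::finite \<Rightarrow> real" and g :: "real^'n \<Rightarrow> real^'n"
  assumes "linear g" and "(f \<circ> g) absolutely_integrable_on S"
  shows "integral (g ` S) f = \<bar>det (matrix g)\<bar> * integral S (f \<circ> g)"
proof -
  \<comment> \<open>\<open>f\<close> is wrapped into a function with values in
    \<open>real^1\<close>, the form to which the change of variables theorem is applied.\<close>
  let ?g = "vwo \<circ> g \<circ> vun" and ?f = "\<lambda>x. vec (f (vun x)) :: real^1"
  have lin: "linear ?g"
    using assms linear_vwo linear_vun by (intro linear_compose)
  have im: "?g ` vwo ` S = vwo ` g ` S"
    by (simp add: image_image)
  have v1: "integral T ?f = vec (integral T (\<lambda>x. f (vun x)))" for T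
    by (simp add: integral_on_1_eq vec_eq_iff o_def)
  have "(\<lambda>x. f (g (vun x))) absolutely_integrable_on vwo ` S"
    using assms absolutely_integrable_vwo_iff[where f = "f \<circ> g" and S = S] by (simp add: o_def)
  then have "(?f \<circ> ?g) absolutely_integrable_on vwo ` S"
    by (simp add: absolutely_integrable_on_1_iff o_def)
  then have "integral (?g ` vwo ` S) ?f = \<bar>det (matrix ?g)\<bar> *\<^sub>R integral (vwo ` S) (?f \<circ> ?g)"
    by (intro integral_change_of_variables_linear lin disjI2)
  then have "integral (vwo ` g ` S) ?f $ 1 = \<bar>det (matrix g)\<bar> * integral (vwo ` S) (?f \<circ> ?g) $ 1"
    unfolding im det_matrix_wo by simp
  moreover have "integral (vwo ` S) (?f \<circ> ?g) $ 1 = integral (vwo ` S) (\<lambda>x. (f \<circ> g) (vun x))"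
    by (simp add: integral_on_1_eq o_def)
  moreover have "integral (vwo ` g ` S) ?f $ 1 = integral (vwo ` g ` S) (\<lambda>x. f (vun x))"
    unfolding v1 by simp
  ultimately show ?thesis
    using integral_vwo[of "g ` S" f] integral_vwo[of S "f \<circ> g"] by simp
qed

text \<open>The integral of |det g'| is the volume of the image of \<open>g\<close>, which is finite
  once the image is bounded; by invariance of domain the image is open, hence measurable.\<close>

lemma abs_det_integrable_inj:
  fixes g :: "real^'n::finite \<Rightarrow> real^'n"
  assumes "open U" and der: "\<And>x. x \<in> U \<Longrightarrow> (g has_derivative g' x) (at x)"
    and inj: "inj_on g U" and bdd: "bounded (g ` U)"
  shows "(\<lambda>x. \<bar>det (matrix (g' x))\<bar>) absolutely_integrable_on U"
proof -
  let ?g = "vwo \<circ> g \<circ> vun" and ?g' = "\<lambda>x. vwo \<circ> g' (vun x) \<circ> vun"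
  have op: "open (vwo ` U)"
    unfolding vwo_image_eq_vimage using \<open>open U\<close>
    by (intro continuous_open_vimage isCont_vun)
  have d: "(?g has_derivative ?g' x) (at x within vwo ` U)" if "x \<in> vwo ` U" for x
  proof -
    have "vun x \<in> U" using that by auto
    from der[OF this] have g1: "(g has_derivative g' (vun x)) (at (vun x))" .
    have bl: "bounded_linear vwo" "bounded_linear vun"
      using linear_vwo linear_vun linear_conv_bounded_linear by blast+
    have "(vun has_derivative vun) (at x)"
      using bl by (rule_tac bounded_linear_imp_has_derivative)
    from diff_chain_at[OF this g1]
    have "(g \<circ> vun has_derivative g' (vun x) \<circ> vun) (at x)" .
    from diff_chain_at[OF this bounded_linear_imp_has_derivative[OF bl(1)]]
    show ?thesis by (simp add: o_assoc has_derivative_at_withinI)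
  qed
  have i: "inj_on ?g (vwo ` U)"
    using inj by (simp add: inj_on_def)
  have cont: "continuous_on (vwo ` U) ?g"
    by (rule has_derivative_continuous_on) (rule d)
  have "open (?g ` vwo ` U)"
    by (rule invariance_of_domain[OF cont op i])
  moreover have "bounded (?g ` vwo ` U)"
  proof -
    have "bounded (vwo ` g ` U)"
      by (rule bounded_linear_image[OF bdd]) (use linear_vwo linear_conv_bounded_linear in blast)
    moreover have "?g ` vwo ` U = vwo ` g ` U" by (simp add: image_image)
    ultimately show ?thesis by simp
  qed
  ultimately have "?g ` vwo ` U \<in> lmeasurable"
    by (simp add: lmeasurable_open)
  moreover have "vwo ` U \<in> sets lebesgue"
    using op by (simp add: borel_open)
  ultimately have "(\<lambda>x. \<bar>det (matrix (?g' x))\<bar>) absolutely_integrable_on vwo ` U"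
    using measurable_differentiable_image_alt[OF _ d i] by blast
  then show ?thesis
    unfolding det_matrix_wo by (rule absolutely_integrable_vwo_iff[THEN iffD1])
qed

section \<open>From cells to domains\<close>

text \<open>Overlaps and parts of cells outside \<open>X\<close> only increase the right-hand side,
  because \<open>f\<close> is nonnegative on every cell.\<close>

lemma integral_le_sum_cover:
  fixes f :: "'a::euclidean_space \<Rightarrow> real"
  assumes "finite I" and cover: "X \<subseteq> (\<Union>i\<in>I. K i)" and "f integrable_on X"
    and int: "\<And>i. i \<in> I \<Longrightarrow> f integrable_on K i"
    and nonneg: "\<And>i x. i \<in> I \<Longrightarrow> x \<in> K i \<Longrightarrow> 0 \<le> f x"
  shows "integral X f \<le> (\<Sum>i\<in>I. integral (K i) f)"
proof -
  let ?g = "\<lambda>i x. if x \<in> K i then f x else 0"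
  have gi: "?g i integrable_on UNIV" if "i \<in> I" for i
    using int[OF that] by (simp add: integrable_restrict_UNIV)
  have "integral X f = integral UNIV (\<lambda>x. if x \<in> X then f x else 0)"
    by (simp add: integral_restrict_UNIV)
  also have "\<dots> \<le> integral UNIV (\<lambda>x. \<Sum>i\<in>I. ?g i x)"
  proof (rule integral_le)
    show "(\<lambda>x. if x \<in> X then f x else 0) integrable_on UNIV"
      using assms by (simp add: integrable_restrict_UNIV)
    show "(\<lambda>x. \<Sum>i\<in>I. ?g i x) integrable_on UNIV"
      using \<open>finite I\<close> gi by (rule integrable_sum)
    fix x
    show "(if x \<in> X then f x else 0) \<le> (\<Sum>i\<in>I. ?g i x)"
    proof (cases "x \<in> X")
      case True
      then obtain i where i: "i \<in> I" "x \<in> K i" using cover by blast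
      have "?g i x \<le> (\<Sum>i\<in>I. ?g i x)"
        using i nonneg \<open>finite I\<close> by (intro member_le_sum) auto
      with i True show ?thesis by simp
    qed (use nonneg in \<open>auto intro: sum_nonneg\<close>)
  qed
  also have "\<dots> = (\<Sum>i\<in>I. integral UNIV (?g i))"
    using \<open>finite I\<close> gi by (rule integral_sum)
  finally show ?thesis by (simp add: integral_restrict_UNIV)
qed

lemma sum_integral_disjoint_le:
  fixes f :: "'a::euclidean_space \<Rightarrow> real"
  assumes "finite I" and sub: "\<And>i. i \<in> I \<Longrightarrow> K i \<subseteq> X"
    and disj: "\<And>i j. i \<in> I \<Longrightarrow> j \<in> I \<Longrightarrow> i \<noteq> j \<Longrightarrow> K i \<inter> K j = {}"
    and "f integrable_on X" and int: "\<And>i. i \<in> I \<Longrightarrow> f integrable_on K i"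
    and nonneg: "\<And>x. x \<in> X \<Longrightarrow> 0 \<le> f x"
  shows "(\<Sum>i\<in>I. integral (K i) f) \<le> integral X f"
proof -
  let ?g = "\<lambda>i x. if x \<in> K i then f x else 0"
  have gi: "?g i integrable_on UNIV" if "i \<in> I" for i
    using int[OF that] by (simp add: integrable_restrict_UNIV)
  have "(\<Sum>i\<in>I. integral (K i) f) = (\<Sum>i\<in>I. integral UNIV (?g i))"
    by (simp add: integral_restrict_UNIV)
  also have "\<dots> = integral UNIV (\<lambda>x. \<Sum>i\<in>I. ?g i x)"
    using \<open>finite I\<close> gi by (rule integral_sum[symmetric])
  also have "\<dots> \<le> integral UNIV (\<lambda>x. if x \<in> X then f x else 0)"
  proof (rule integral_le)
    show "(\<lambda>x. if x \<in> X then f x else 0) integrable_on UNIV"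
      using assms by (simp add: integrable_restrict_UNIV)
    show "(\<lambda>x. \<Sum>i\<in>I. ?g i x) integrable_on UNIV"
      using \<open>finite I\<close> gi by (rule integrable_sum)
    fix x
    show "(\<Sum>i\<in>I. ?g i x) \<le> (if x \<in> X then f x else 0)"
    proof (cases "\<exists>j\<in>I. x \<in> K j")
      case True
      then obtain j where j: "j \<in> I" "x \<in> K j" by blast
      have "(\<Sum>i\<in>I. ?g i x) = (\<Sum>i\<in>{j}. ?g i x)"
        using j disj \<open>finite I\<close> by (intro sum.mono_neutral_right) auto
      with j sub show ?thesis by auto
    next
      case False
      then have "(\<Sum>i\<in>I. ?g i x) = 0" by (intro sum.neutral) auto
      with nonneg show ?thesis by simp
    qed
  qed
  finally show ?thesis by (simp add: integral_restrict_UNIV)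
qed

lemma integral_le_const_measure:
  fixes f :: "'a::euclidean_space \<Rightarrow> real"
  assumes "S \<in> lmeasurable" "f integrable_on S" "\<And>x. x \<in> S \<Longrightarrow> f x \<le> c"
  shows "integral S f \<le> c * measure lebesgue S"
proof -
  have "integral S f \<le> integral S (\<lambda>x. c * 1)"
    using assms by (intro integral_le) (auto simp: integrable_on_const)
  also have "\<dots> = c * integral S (\<lambda>x. 1)"
    using assms by (intro integral_mult_right)
  finally show ?thesis using assms by (simp add: lmeasure_integral)
qed

text \<open>Sum the tangent-line inequality \<open>t powr (- \<theta>) \<ge> 1 - \<theta> * (t - 1)\<close> with weights \<open>c\<close> at
  \<open>t = (k i / c i) / (sum k I / sum c I)\<close>: the first-order part vanishes.\<close>

lemma sum_powr_allocation_ge: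
  fixes c k :: "'i \<Rightarrow> real"
  assumes "finite I" "I \<noteq> {}" and c: "\<And>i. i \<in> I \<Longrightarrow> c i > 0" and k: "\<And>i. i \<in> I \<Longrightarrow> k i > 0"
    and "\<theta> > 0"
  shows "sum c I powr (1 + \<theta>) * sum k I powr (- \<theta>) \<le> (\<Sum>i\<in>I. c i powr (1 + \<theta>) * k i powr (- \<theta>))"
proof -
  define C where "C = sum c I"
  define S where "S = sum k I"
  have C: "C > 0" and S: "S > 0"
    unfolding C_def S_def using assms by (auto intro!: sum_pos)
  define t where "t = (\<lambda>i. (k i / c i) / (S / C))"
  have t: "t i > 0" if "i \<in> I" for i
    using c[OF that] k[OF that] C S by (simp add: t_def)
  have tangent: "1 - \<theta> * (s - 1) \<le> s powr (- \<theta>)" if "s > 0" for s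
  proof -
    have "\<theta> * ln s \<le> \<theta> * (s - 1)"
      using ln_le_minus_one[OF that] \<open>\<theta> > 0\<close> by simp
    moreover have "1 + - \<theta> * ln s \<le> exp (- \<theta> * ln s)" by (rule exp_ge_add_one_self)
    ultimately show ?thesis using that by (simp add: powr_def)
  qed
  have eq: "c i powr (1 + \<theta>) * k i powr (- \<theta>) = (S / C) powr (- \<theta>) * (c i * t i powr (- \<theta>))" if "i \<in> I" for i
  proof -
    have "k i = (S / C) * (c i * t i)"
      using c[OF that] C S by (simp add: t_def)
    then have "k i powr (- \<theta>) = (S / C) powr (- \<theta>) * (c i powr (- \<theta>) * t i powr (- \<theta>))"
      by (simp only: powr_mult)
    moreover have "c i powr (1 + \<theta>) * c i powr (- \<theta>) = c i"
      using c[OF that] by (simp flip: powr_add)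
    ultimately show ?thesis by (simp add: mult_ac)
  qed
  have "C = (\<Sum>i\<in>I. c i * (1 - \<theta> * (t i - 1)))"
  proof -
    have "(\<Sum>i\<in>I. c i * t i) = (\<Sum>i\<in>I. k i * (C / S))"
      using c by (intro sum.cong refl) (simp add: t_def less_imp_neq[THEN not_sym])
    also have "\<dots> = S * (C / S)" unfolding S_def sum_distrib_right ..
    also have "\<dots> = C" using S by simp
    finally have "(\<Sum>i\<in>I. c i * t i) = C" .
    moreover have "(\<Sum>i\<in>I. c i * (1 - \<theta> * (t i - 1))) = (1 + \<theta>) * C - \<theta> * (\<Sum>i\<in>I. c i * t i)"
      unfolding C_def sum_distrib_left by (simp add: algebra_simps sum.distrib sum_subtractf)
    ultimately show ?thesis by (simp add: algebra_simps)
  qed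
  also have "\<dots> \<le> (\<Sum>i\<in>I. c i * t i powr (- \<theta>))"
    using c tangent t by (intro sum_mono mult_left_mono) (auto intro: less_imp_le)
  finally have "(S / C) powr (- \<theta>) * C \<le> (S / C) powr (- \<theta>) * (\<Sum>i\<in>I. c i * t i powr (- \<theta>))"
    by (intro mult_left_mono) auto
  also have "\<dots> = (\<Sum>i\<in>I. c i powr (1 + \<theta>) * k i powr (- \<theta>))"
    unfolding sum_distrib_left by (intro sum.cong refl) (simp add: eq)
  also have "(S / C) powr (- \<theta>) * C = C powr (1 + \<theta>) * S powr (- \<theta>)"
    using C S by (simp add: powr_divide powr_minus powr_add field_simps)
  finally show ?thesis by (simp add: C_def S_def)
qed

section \<open>Asymptotic bounds from cells\<close>

lemma scaled_floor_limit:
  fixes e :: "nat \<Rightarrow> real"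
  assumes lim: "(\<lambda>k. real k powr \<theta> * e k) \<longlonglongrightarrow> L" and "a > 0"
  shows "(\<lambda>m. real m powr \<theta> * e (nat \<lfloor>a * real m\<rfloor>)) \<longlonglongrightarrow> L * a powr (- \<theta>)"
proof -
  let ?j = "\<lambda>m. nat \<lfloor>a * real m\<rfloor>"
  have j: "filterlim ?j at_top at_top"
    using \<open>a > 0\<close> by real_asymp
  have r: "(\<lambda>m. real (?j m) / real m) \<longlonglongrightarrow> a"
    using \<open>a > 0\<close> by real_asymp
  have "(\<lambda>m. (real (?j m) powr \<theta> * e (?j m)) * (real (?j m) / real m) powr (- \<theta>)) \<longlonglongrightarrow> L * a powr (- \<theta>)"
    using \<open>a > 0\<close> by (intro tendsto_mult filterlim_compose[OF lim j] tendsto_powr r tendsto_const) auto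
  moreover have "\<forall>\<^sub>F m in sequentially. ?j m \<ge> 1 \<and> m \<ge> 1"
    using j by (intro eventually_conj eventually_ge_at_top) (auto simp: filterlim_at_top)
  then have "\<forall>\<^sub>F m in sequentially. (real (?j m) powr \<theta> * e (?j m)) * (real (?j m) / real m) powr (- \<theta>)
      = real m powr \<theta> * e (?j m)"
  proof eventually_elim
    case (elim m)
    define j where "j = ?j m"
    have "j \<ge> 1" "m \<ge> 1" using elim unfolding j_def by blast+
    then have "real j > 0" "real m > 0" by auto
    then show ?case
      unfolding j_def[symmetric] by (simp add: powr_divide powr_minus)
  qed
  ultimately show ?thesis by (rule Lim_transform_eventually)
qed

lemma eventually_at_right_0_obtain:
  assumes "\<forall>\<^sub>F x in at_right (0::real). P x" and "b > 0"
  obtains x where "0 < x" "x < b" "P x"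
proof -
  have "\<forall>\<^sub>F x in at_right 0. x \<in> {0<..<b} \<and> P x"
    using eventually_at_right_real[OF \<open>b > 0\<close>] assms(1) by (rule eventually_conj)
  from eventually_happens'[OF trivial_limit_at_right_real this] that show ?thesis by auto
qed

text \<open>\<open>F k\<close> holds the error functions reachable with budget \<open>k\<close>:
  powers of distances for quantizers, weighted gaps for convex functions. \<open>comb\<close> joins
  two configurations, which adds the budgets and does at least as well as the pointwise minimum;
  \<open>rem\<close> is the uniform approximation. The weight \<open>c K\<close> is normalized so
  that the limit on \<open>K\<close> is \<open>D * c K powr (1 + \<theta>)\<close>; with budgets
  proportional to \<open>c K\<close> the errors add up to \<open>D * C powr (1 + \<theta>)\<close>.
  The bounds \<open>e K k\<close> leave room above an infimum that need not be attained.\<close>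

lemma asymptotic_upper_bound:
  fixes F :: "nat \<Rightarrow> ('a::euclidean_space \<Rightarrow> real) set"
  assumes \<theta>: "\<theta> > 0" and X: "X \<in> lmeasurable"
    and int: "\<And>k f. f \<in> F k \<Longrightarrow> f absolutely_integrable_on X"
    and nonneg: "\<And>k f x. f \<in> F k \<Longrightarrow> x \<in> X \<Longrightarrow> 0 \<le> f x"
    and mono: "\<And>a b. a \<le> b \<Longrightarrow> F a \<subseteq> F b"
    and comb: "\<And>a b f g. f \<in> F a \<Longrightarrow> g \<in> F b \<Longrightarrow> \<exists>h\<in>F (a + b). \<forall>x\<in>X. h x \<le> f x \<and> h x \<le> g x"
    and rem: "\<And>k. k \<ge> 1 \<Longrightarrow> \<exists>f\<in>F k. \<forall>x\<in>X. f x \<le> B * real k powr (- \<theta>)"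
    and cells: "\<And>\<epsilon>. \<epsilon> > 0 \<Longrightarrow> \<exists>I c e. finite I \<and>
        (\<forall>K\<in>I. K \<subseteq> X \<and> K \<in> lmeasurable \<and> c K > 0 \<and>
           (\<lambda>k. real k powr \<theta> * e K k) \<longlonglongrightarrow> D * c K powr (1 + \<theta>) \<and>
           (\<forall>k\<ge>1. \<exists>f\<in>F k. integral K f \<le> e K k)) \<and>
        sum c I \<le> C + \<epsilon> \<and> measure lebesgue (X - \<Union>I) \<le> \<epsilon>"
    and "B \<ge> 0" "C \<ge> 0" "D \<ge> 0" "\<epsilon> > 0"
  shows "\<forall>\<^sub>F m in sequentially. \<exists>f\<in>F m. real m powr \<theta> * integral X f \<le> D * C powr (1 + \<theta>) + \<epsilon>"
proof -
  \<comment> \<open>\<open>l\<close> is the fraction of the budget spent on the uniform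
    approximation. It is fixed before \<eta>, the measure left uncovered, because the uncovered part
    costs \<open>\<eta> * B * l powr (- \<theta>)\<close>, which becomes small only if \<eta> is
    chosen in terms of \<open>l\<close>.\<close>
  have "((\<lambda>l. D * (1 - l) powr (- \<theta>) * C powr (1 + \<theta>)) \<longlongrightarrow> D * (1 - 0) powr (- \<theta>) * C powr (1 + \<theta>)) (at_right 0)"
    by (intro tendsto_intros) auto
  then have "\<forall>\<^sub>F l in at_right 0. D * (1 - l) powr (- \<theta>) * C powr (1 + \<theta>) < D * C powr (1 + \<theta>) + \<epsilon>"
    using \<open>\<epsilon> > 0\<close> by (intro order_tendstoD) auto
  then obtain l where l: "0 < l" "l < 1"
    and lb: "D * (1 - l) powr (- \<theta>) * C powr (1 + \<theta>) < D * C powr (1 + \<theta>) + \<epsilon>"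
    by (rule eventually_at_right_0_obtain[of _ 1]) auto
  have "((\<lambda>\<eta>. D * (1 - l) powr (- \<theta>) * (C + \<eta>) powr (1 + \<theta>) + \<eta> * B * l powr (- \<theta>)) \<longlongrightarrow>
      D * (1 - l) powr (- \<theta>) * (C + 0) powr (1 + \<theta>) + 0 * B * l powr (- \<theta>)) (at_right 0)"
    using \<theta> \<open>C \<ge> 0\<close>
    by (intro tendsto_intros tendsto_powr2) (auto simp: eventually_at_right_less intro: eventually_mono[OF eventually_at_right_less[of 0]])
  then have "\<forall>\<^sub>F \<eta> in at_right 0. D * (1 - l) powr (- \<theta>) * (C + \<eta>) powr (1 + \<theta>) + \<eta> * B * l powr (- \<theta>) < D * C powr (1 + \<theta>) + \<epsilon>"
    using lb by (intro order_tendstoD) auto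
  then obtain \<eta> where \<eta>: "\<eta> > 0"
    and eb: "D * (1 - l) powr (- \<theta>) * (C + \<eta>) powr (1 + \<theta>) + \<eta> * B * l powr (- \<theta>) < D * C powr (1 + \<theta>) + \<epsilon>"
    by (rule eventually_at_right_0_obtain[of _ 1]) auto
  obtain I c e where "finite I" and cell: "\<forall>K\<in>I. K \<subseteq> X \<and> K \<in> lmeasurable \<and> c K > 0 \<and>
      (\<lambda>k. real k powr \<theta> * e K k) \<longlonglongrightarrow> D * c K powr (1 + \<theta>) \<and> (\<forall>k\<ge>1. \<exists>f\<in>F k. integral K f \<le> e K k)"
    and sumc: "sum c I \<le> C + \<eta>" and small: "measure lebesgue (X - \<Union>I) \<le> \<eta>"
    using cells[OF \<eta>] by (elim exE conjE) (rule that; assumption)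
  from cell have sub: "\<And>K. K \<in> I \<Longrightarrow> K \<subseteq> X" and meas: "\<And>K. K \<in> I \<Longrightarrow> K \<in> lmeasurable"
    and c: "\<And>K. K \<in> I \<Longrightarrow> c K > 0"
    and lim: "\<And>K. K \<in> I \<Longrightarrow> (\<lambda>k. real k powr \<theta> * e K k) \<longlonglongrightarrow> D * c K powr (1 + \<theta>)"
    and e: "\<And>K k. K \<in> I \<Longrightarrow> k \<ge> 1 \<Longrightarrow> \<exists>f\<in>F k. integral K f \<le> e K k"
    by blast+
  define S where "S = sum c I"
  have S0: "S > 0" if "K \<in> I" for K
    unfolding S_def using that c \<open>finite I\<close> by (intro sum_pos) auto
  have Snn: "S \<ge> 0" unfolding S_def using c by (intro sum_nonneg) (auto intro: less_imp_le)
  define a where "a = (\<lambda>K. (1 - l) * c K / S)"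
  have a: "a K > 0" if "K \<in> I" for K
    using c[OF that] S0[OF that] l by (simp add: a_def)
  have suma: "sum a I \<le> 1 - l"
  proof (cases "I = {}")
    case True
    then show ?thesis using l by simp
  next
    case False
    have "sum a I = (\<Sum>K\<in>I. (1 - l) / S * c K)"
      unfolding a_def by simp
    also have "\<dots> = (1 - l) / S * S"
      unfolding S_def by (rule sum_distrib_left[symmetric])
    finally show ?thesis using l by (cases "S = 0") auto
  qed
  let ?j = "\<lambda>a m. nat \<lfloor>a * real m\<rfloor>"
  have comb': "\<exists>h\<in>F (k0 + sum k I'). \<forall>x\<in>X. h x \<le> f0 x \<and> (\<forall>K\<in>I'. h x \<le> f K x)"
    if "finite I'" "\<And>K. K \<in> I' \<Longrightarrow> f K \<in> F (k K)" "f0 \<in> F k0" for f0 k0 f and k :: "'a set \<Rightarrow> nat" and I'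
    using that
  proof (induction I' rule: finite_induct)
    case empty
    then show ?case by auto
  next
    case (insert K I')
    then obtain h where h: "h \<in> F (k0 + sum k I')" "\<forall>x\<in>X. h x \<le> f0 x \<and> (\<forall>K\<in>I'. h x \<le> f K x)"
      by auto
    from comb[OF h(1) insert.prems(1)[OF insertI1]] obtain g where
      g: "g \<in> F (k0 + sum k I' + k K)" "\<forall>x\<in>X. g x \<le> h x \<and> g x \<le> f K x" by blast
    then show ?case using insert h
      by (intro bexI[of _ g]) (fastforce, simp add: add_ac)
  qed
  \<comment> \<open>\<open>G m\<close> bounds the scaled error: \<open>K\<close> gets the fraction
    \<open>a K\<close> of \<open>m\<close>, rounded down, and the last summand is the uniform error
    on the uncovered part.\<close>
  define G where "G = (\<lambda>m. (\<Sum>K\<in>I. real m powr \<theta> * e K (?j (a K) m)) +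
      real m powr \<theta> * (\<eta> * B * real (?j l m) powr (- \<theta>)))"
  have "G \<longlonglongrightarrow> (\<Sum>K\<in>I. D * c K powr (1 + \<theta>) * a K powr (- \<theta>)) + \<eta> * B * l powr (- \<theta>)"
    unfolding G_def
  proof (intro tendsto_add tendsto_sum)
    show "(\<lambda>m. real m powr \<theta> * e K (?j (a K) m)) \<longlonglongrightarrow> D * c K powr (1 + \<theta>) * a K powr (- \<theta>)" if "K \<in> I" for K
      using lim[OF that] a[OF that] by (rule scaled_floor_limit)
    show "(\<lambda>m. real m powr \<theta> * (\<eta> * B * real (?j l m) powr (- \<theta>))) \<longlonglongrightarrow> \<eta> * B * l powr (- \<theta>)"
    proof (rule scaled_floor_limit[where e = "\<lambda>k. \<eta> * B * real k powr (- \<theta>)"])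
      have "\<forall>\<^sub>F k in sequentially. \<eta> * B = real k powr \<theta> * (\<eta> * B * real k powr (- \<theta>))"
        using eventually_gt_at_top[of 0] by eventually_elim (simp add: powr_minus field_simps)
      then show "(\<lambda>k. real k powr \<theta> * (\<eta> * B * real k powr (- \<theta>))) \<longlonglongrightarrow> \<eta> * B"
        by (rule Lim_transform_eventually[OF tendsto_const])
    qed (rule l)
  qed
  moreover have "(\<Sum>K\<in>I. D * c K powr (1 + \<theta>) * a K powr (- \<theta>)) = D * (1 - l) powr (- \<theta>) * S powr (1 + \<theta>)"
  proof -
    have "D * c K powr (1 + \<theta>) * a K powr (- \<theta>) = D * (1 - l) powr (- \<theta>) * S powr \<theta> * c K" if "K \<in> I" for K
    proof -
      have "a K powr (- \<theta>) = (1 - l) powr (- \<theta>) * c K powr (- \<theta>) / S powr (- \<theta>)"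
        unfolding a_def powr_divide powr_mult ..
      then show ?thesis
        using c[OF that] by (simp add: powr_minus powr_add divide_inverse mult_ac)
    qed
    then have "(\<Sum>K\<in>I. D * c K powr (1 + \<theta>) * a K powr (- \<theta>)) = (\<Sum>K\<in>I. D * (1 - l) powr (- \<theta>) * S powr \<theta> * c K)"
      by (rule sum.cong[OF refl])
    also have "\<dots> = D * (1 - l) powr (- \<theta>) * S powr \<theta> * S"
      unfolding S_def by (rule sum_distrib_left[symmetric])
    also have "\<dots> = D * (1 - l) powr (- \<theta>) * S powr (1 + \<theta>)"
      using Snn by (simp add: powr_add mult_ac)
    finally show ?thesis .
  qed
  moreover have "D * (1 - l) powr (- \<theta>) * S powr (1 + \<theta>) \<le> D * (1 - l) powr (- \<theta>) * (C + \<eta>) powr (1 + \<theta>)"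
    using sumc Snn \<theta> \<open>D \<ge> 0\<close> by (intro mult_left_mono powr_mono2) (auto simp: S_def)
  ultimately have "\<forall>\<^sub>F m in sequentially. G m < D * C powr (1 + \<theta>) + \<epsilon>"
    using eb by (elim order_tendstoD) simp
  moreover have "\<forall>\<^sub>F m in sequentially. ?j b m \<ge> 1" if "b > 0" for b
  proof -
    have "filterlim (?j b) at_top at_top" using \<open>b > 0\<close> by real_asymp
    then show ?thesis by (simp add: filterlim_at_top)
  qed
  then have "\<forall>\<^sub>F m in sequentially. \<forall>K\<in>I. ?j (a K) m \<ge> 1" "\<forall>\<^sub>F m in sequentially. ?j l m \<ge> 1"
    using a l \<open>finite I\<close> by (auto intro!: eventually_ball_finite)
  ultimately show ?thesis
  proof eventually_elim
    case (elim m)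
    then have "\<forall>K\<in>I. \<exists>f\<in>F (?j (a K) m). integral K f \<le> e K (?j (a K) m)" using e by blast
    then obtain f where f: "\<And>K. K \<in> I \<Longrightarrow> f K \<in> F (?j (a K) m)" "\<And>K. K \<in> I \<Longrightarrow> integral K (f K) \<le> e K (?j (a K) m)"
      by metis
    obtain f0 where f0: "f0 \<in> F (?j l m)" "\<And>x. x \<in> X \<Longrightarrow> f0 x \<le> B * real (?j l m) powr (- \<theta>)"
      using rem elim by blast
    obtain h where h: "h \<in> F (?j l m + (\<Sum>K\<in>I. ?j (a K) m))"
      and h0: "\<And>x. x \<in> X \<Longrightarrow> h x \<le> f0 x" and hK: "\<And>x K. x \<in> X \<Longrightarrow> K \<in> I \<Longrightarrow> h x \<le> f K x"
      using comb'[of I f "\<lambda>K. ?j (a K) m" f0 "?j l m", OF \<open>finite I\<close> f(1) f0(1)] by blast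
    have "real (?j l m + (\<Sum>K\<in>I. ?j (a K) m)) \<le> l * real m + (\<Sum>K\<in>I. a K * real m)"
      using l a by (auto intro!: add_mono sum_mono simp: less_imp_le)
    also have "\<dots> = (l + sum a I) * real m" by (simp add: sum_distrib_right distrib_right)
    also have "\<dots> \<le> 1 * real m" using suma by (intro mult_right_mono) auto
    finally have "?j l m + (\<Sum>K\<in>I. ?j (a K) m) \<le> m" by (simp only: mult_1 of_nat_le_iff)
    then have hm: "h \<in> F m" using mono h by blast
    define R where "R = X - \<Union>I"
    have Rm: "R \<in> lmeasurable"
      unfolding R_def using X meas \<open>finite I\<close> by (intro fmeasurable.Diff fmeasurable.finite_Union) auto
    have sub_int: "g integrable_on T" if "g \<in> F k" "T \<subseteq> X" "T \<in> lmeasurable" for g k T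
      using set_integrable_subset[OF int[OF that(1)] _ that(2)] that(3) absolutely_integrable_on_def by blast
    have "integral X h \<le> (\<Sum>T\<in>insert R I. integral T h)"
    proof (rule integral_le_sum_cover)
      show "X \<subseteq> (\<Union>T\<in>insert R I. T)" by (auto simp: R_def)
      show "h integrable_on X" using hm X by (auto intro: sub_int)
      show "h integrable_on T" if "T \<in> insert R I" for T
        using that hm Rm sub meas by (auto intro!: sub_int[OF hm] simp: R_def)
      show "0 \<le> h x" if "T \<in> insert R I" "x \<in> T" for T x
        using that nonneg[OF hm] sub by (auto simp: R_def)
    qed (use \<open>finite I\<close> in simp)
    \<comment> \<open>\<open>R\<close> avoids all cells, so it is one of them only if it is empty;
      then \<open>insert\<close> adds nothing, and the bound still holds because the integral over
      \<open>R\<close> is nonnegative.\<close>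
    also have "\<dots> \<le> integral R h + (\<Sum>T\<in>I. integral T h)"
    proof (cases "R \<in> I")
      case True
      then have "insert R I = I" by blast
      moreover have "0 \<le> integral R h"
        by (intro integral_nonneg sub_int[OF hm] Rm) (auto simp: R_def nonneg[OF hm])
      ultimately show ?thesis by simp
    qed (use \<open>finite I\<close> in simp)
    also have "(\<Sum>T\<in>I. integral T h) \<le> (\<Sum>K\<in>I. e K (?j (a K) m))"
    proof (rule sum_mono)
      fix K assume K: "K \<in> I"
      have "integral K h \<le> integral K (f K)"
        using sub[OF K] meas[OF K] hK[OF _ K]
        by (intro integral_le sub_int[OF hm] sub_int[OF f(1)[OF K]]) (auto dest: subsetD)
      with f(2)[OF K] show "integral K h \<le> e K (?j (a K) m)" by simp
    qed
    also have "integral R h \<le> B * real (?j l m) powr (- \<theta>) * measure lebesgue R"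
      using h0 f0(2) by (intro integral_le_const_measure sub_int[OF hm] Rm) (force simp: R_def)+
    also have "\<dots> \<le> B * real (?j l m) powr (- \<theta>) * \<eta>"
      using small \<open>B \<ge> 0\<close> unfolding R_def by (intro mult_left_mono) auto
    finally have "real m powr \<theta> * integral X h \<le>
        real m powr \<theta> * (B * real (?j l m) powr (- \<theta>) * \<eta> + (\<Sum>K\<in>I. e K (?j (a K) m)))"
      by (intro mult_left_mono) auto
    also have "\<dots> = G m" by (simp add: G_def distrib_left sum_distrib_left mult_ac)
    also have "\<dots> \<le> D * C powr (1 + \<theta>) + \<epsilon>" using elim by simp
    finally show ?case using hm by blast
  qed
qed

text \<open>A configuration \<open>f\<close> with budget \<open>m\<close> yields effective numbers
  \<open>k K\<close> of points per cell, whose total exceeds \<open>m\<close> by at most the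
  constant \<open>N\<close>; this excess disappears in the limit since m / (m + N) tends to 1.
  \<open>sum_powr_allocation_ge\<close> then bounds the sum, however the points are distributed. A
  loss is allowed in \<open>D\<close> as well as in \<open>C\<close>, because on general cells the
  local bound is only asymptotic.\<close>

lemma asymptotic_lower_bound:
  fixes F :: "nat \<Rightarrow> 'b set" and J :: "'b \<Rightarrow> real"
  assumes \<theta>: "\<theta> > 0" and nonneg: "\<And>k f. f \<in> F k \<Longrightarrow> 0 \<le> J f"
    and cells: "\<And>\<epsilon>. \<epsilon> > 0 \<Longrightarrow> \<epsilon> < D \<Longrightarrow> \<exists>(I :: 'i set) c N. finite I \<and> (\<forall>K\<in>I. c K > 0) \<and> C - \<epsilon> \<le> sum c I \<and>
        (\<forall>m\<ge>1. \<forall>f\<in>F m. \<exists>k :: 'i \<Rightarrow> nat. (\<forall>K\<in>I. k K \<ge> 1) \<and> sum k I \<le> m + N \<and>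
           (D - \<epsilon>) * (\<Sum>K\<in>I. c K powr (1 + \<theta>) * real (k K) powr (- \<theta>)) \<le> J f)"
    and "C \<ge> 0" "D \<ge> 0" "\<epsilon> > 0"
  shows "\<forall>\<^sub>F m in sequentially. \<forall>f\<in>F m. D * C powr (1 + \<theta>) - \<epsilon> \<le> real m powr \<theta> * J f"
\<comment> \<open>In the degenerate case the claimed bound is negative, and nonnegativity of
  \<open>J\<close> is enough. Otherwise \<eta> can be chosen below both \<open>C\<close> and
  \<open>D\<close>, which keeps the factors positive.\<close>
proof (cases "C = 0 \<or> D = 0")
  case True
  then have "D * C powr (1 + \<theta>) - \<epsilon> \<le> 0" using \<open>\<epsilon> > 0\<close> by auto
  moreover have "0 \<le> real m powr \<theta> * J f" if "f \<in> F m" for m f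
    using nonneg[OF that] by simp
  ultimately show ?thesis
    by (intro always_eventually allI ballI) (meson order_trans)
next
  case False
  then have CD: "C > 0" "D > 0" using assms by auto
  have "((\<lambda>\<eta>. (D - \<eta>) * (C - \<eta>) powr (1 + \<theta>)) \<longlongrightarrow> (D - 0) * (C - 0) powr (1 + \<theta>)) (at_right 0)"
    using CD by (intro tendsto_intros) auto
  then have "\<forall>\<^sub>F \<eta> in at_right 0. D * C powr (1 + \<theta>) - \<epsilon> < (D - \<eta>) * (C - \<eta>) powr (1 + \<theta>)"
    using \<open>\<epsilon> > 0\<close> by (intro order_tendstoD) auto
  then obtain \<eta> where \<eta>: "\<eta> > 0" "\<eta> < C" "\<eta> < D"
    and eb: "D * C powr (1 + \<theta>) - \<epsilon> < (D - \<eta>) * (C - \<eta>) powr (1 + \<theta>)"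
    using CD by (elim eventually_at_right_0_obtain[of _ "min C D"]) auto
  obtain I :: "'i set" and c N where "finite I" and c: "\<forall>K\<in>I. c K > 0" and sumc: "C - \<eta> \<le> sum c I"
    and low: "\<forall>m\<ge>1. \<forall>f\<in>F m. \<exists>k :: 'i \<Rightarrow> nat. (\<forall>K\<in>I. k K \<ge> 1) \<and> sum k I \<le> m + N \<and>
           (D - \<eta>) * (\<Sum>K\<in>I. c K powr (1 + \<theta>) * real (k K) powr (- \<theta>)) \<le> J f"
    using cells[OF \<eta>(1,3)] by (elim exE conjE) (rule that; assumption)
  have "I \<noteq> {}" using sumc \<eta> by auto
  have "(\<lambda>m. (real m / (real m + real N)) powr \<theta>) \<longlonglongrightarrow> 1 powr \<theta>"
    by (intro tendsto_powr tendsto_const) (real_asymp, simp)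
  from tendsto_mult[OF tendsto_const this]
  have "(\<lambda>m. (D - \<eta>) * (C - \<eta>) powr (1 + \<theta>) * (real m / (real m + real N)) powr \<theta>) \<longlonglongrightarrow> (D - \<eta>) * (C - \<eta>) powr (1 + \<theta>) * 1 powr \<theta>" .
  then have "\<forall>\<^sub>F m in sequentially. D * C powr (1 + \<theta>) - \<epsilon> < (D - \<eta>) * (C - \<eta>) powr (1 + \<theta>) * (real m / (real m + real N)) powr \<theta>"
    using eb by (intro order_tendstoD) auto
  then show ?thesis
    using eventually_ge_at_top[of 1]
  proof eventually_elim
    case (elim m)
    show ?case
    proof
      fix f assume "f \<in> F m"
      with low elim(2) obtain k :: "'i \<Rightarrow> nat" where k: "\<And>K. K \<in> I \<Longrightarrow> k K \<ge> 1" "sum k I \<le> m + N"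
        and J: "(D - \<eta>) * (\<Sum>K\<in>I. c K powr (1 + \<theta>) * real (k K) powr (- \<theta>)) \<le> J f" by blast
      have sk: "sum k I > 0" using k \<open>finite I\<close> \<open>I \<noteq> {}\<close> by (intro sum_pos) (auto simp: Suc_le_eq)
      have "(C - \<eta>) powr (1 + \<theta>) * (real m + real N) powr (- \<theta>) \<le> sum c I powr (1 + \<theta>) * (\<Sum>K\<in>I. real (k K)) powr (- \<theta>)"
      proof (rule mult_mono)
        show "(C - \<eta>) powr (1 + \<theta>) \<le> sum c I powr (1 + \<theta>)"
          using \<theta> \<eta> sumc by (intro powr_mono2) auto
        have "(\<Sum>K\<in>I. real (k K)) \<le> real m + real N"
          using k(2) by (metis of_nat_add of_nat_mono of_nat_sum)
        moreover have "0 < (\<Sum>K\<in>I. real (k K))"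
          using sk by (metis of_nat_0_less_iff of_nat_sum)
        ultimately show "(real m + real N) powr (- \<theta>) \<le> (\<Sum>K\<in>I. real (k K)) powr (- \<theta>)"
          using \<theta> by (intro powr_mono2') auto
      qed auto
      also have "\<dots> \<le> (\<Sum>K\<in>I. c K powr (1 + \<theta>) * real (k K) powr (- \<theta>))"
        using k c \<theta> \<open>finite I\<close> \<open>I \<noteq> {}\<close> by (intro sum_powr_allocation_ge) (auto simp: Suc_le_eq)
      finally have "(D - \<eta>) * ((C - \<eta>) powr (1 + \<theta>) * (real m + real N) powr (- \<theta>)) \<le> J f"
        using \<eta> J by (meson diff_gt_0_iff_gt less_imp_le mult_left_mono order_trans)
      then have "real m powr \<theta> * ((D - \<eta>) * ((C - \<eta>) powr (1 + \<theta>) * (real m + real N) powr (- \<theta>))) \<le> real m powr \<theta> * J f"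
        by (intro mult_left_mono) auto
      moreover have "(real m / (real m + real N)) powr \<theta> = real m powr \<theta> * (real m + real N) powr (- \<theta>)"
        by (simp add: powr_divide powr_minus field_simps)
      ultimately show "D * C powr (1 + \<theta>) - \<epsilon> \<le> real m powr \<theta> * J f"
        using elim(1) by (simp add: mult_ac)
    qed
  qed
qed

text \<open>The estimates concern members of \<open>F m\<close> rather than its infimum. The upper
  one also supplies a member for all large \<open>m\<close>, and \<open>nonneg\<close> bounds the
  infimum from below.\<close>

lemma tendsto_scaled_INF:
  fixes J :: "'b \<Rightarrow> real"
  assumes up: "\<And>\<epsilon>. \<epsilon> > 0 \<Longrightarrow> \<forall>\<^sub>F m in sequentially. \<exists>f\<in>F m. real m powr \<theta> * J f \<le> L + \<epsilon>"
    and low: "\<And>\<epsilon>. \<epsilon> > 0 \<Longrightarrow> \<forall>\<^sub>F m in sequentially. \<forall>f\<in>F m. L - \<epsilon> \<le> real m powr \<theta> * J f"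
    and nonneg: "\<And>k f. f \<in> F k \<Longrightarrow> 0 \<le> J f"
  shows "(\<lambda>m. real m powr \<theta> * (INF f\<in>F m. J f)) \<longlonglongrightarrow> L"
proof (rule LIMSEQ_I)
  fix r :: real assume "r > 0"
  then have "r / 2 > 0" by simp
  from up[OF this] low[OF this] eventually_gt_at_top[of 0]
  have "\<forall>\<^sub>F m in sequentially. norm (real m powr \<theta> * (INF f\<in>F m. J f) - L) < r"
  proof eventually_elim
    case (elim m)
    then obtain f where f: "f \<in> F m" "real m powr \<theta> * J f \<le> L + r / 2" by blast
    have bdd: "bdd_below (J ` F m)" using nonneg by (auto intro!: bdd_belowI[of _ 0])
    have mp: "real m powr \<theta> > 0" using elim by simp
    have "real m powr \<theta> * (INF f\<in>F m. J f) \<le> real m powr \<theta> * J f"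
      using cINF_lower[OF bdd f(1)] by (intro mult_left_mono) auto
    moreover have "(L - r / 2) / real m powr \<theta> \<le> (INF f\<in>F m. J f)"
      using f elim mp by (intro cINF_greatest) (auto simp: pos_divide_le_eq mult.commute)
    then have "L - r / 2 \<le> real m powr \<theta> * (INF f\<in>F m. J f)"
      using mp by (simp add: pos_divide_le_eq mult.commute)
    ultimately show ?case using f(2) \<open>r > 0\<close> by (simp add: abs_less_iff)
  qed
  then show "\<exists>no. \<forall>n\<ge>no. norm (real n powr \<theta> * (INF f\<in>F n. J f) - L) < r"
    by (simp add: eventually_sequentially)
qed

section \<open>Quantization of the unit cube\<close>

lemma continuous_imp_absolutely_integrable_on:
  fixes f :: "'a::euclidean_space \<Rightarrow> real"
  assumes "compact X" "continuous_on X f" "S \<subseteq> X" "S \<in> sets lebesgue"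
  shows "f absolutely_integrable_on S"
proof -
  have "bounded (f ` X)"
    using assms by (simp add: compact_continuous_image compact_imp_bounded)
  then obtain b where b: "\<And>x. x \<in> X \<Longrightarrow> norm (f x) \<le> b"
    unfolding bounded_iff by blast
  have "f absolutely_integrable_on X"
  proof (rule measurable_bounded_by_integrable_imp_absolutely_integrable)
    show "X \<in> sets lebesgue"
      using assms lmeasurable_compact by blast
    then show "f \<in> borel_measurable (lebesgue_on X)"
      using assms by (intro continuous_imp_measurable_on_sets_lebesgue)
    show "(\<lambda>x. b) integrable_on X"
      using assms by (intro integrable_on_const lmeasurable_compact)
  qed (rule b)
  then show ?thesis
    using assms(4,3) by (rule set_integrable_subset)
qed

lemma continuous_on_infdist_powr:
  assumes "q > 0"
  shows "continuous_on A (\<lambda>x. infdist x S powr q)"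
  using assms by (intro continuous_on_powr' continuous_intros) (auto simp: infdist_nonneg)

lemma infdist_powr_integrable:
  fixes J :: "'a::euclidean_space set"
  assumes "q > 0" "bounded J" "J \<in> sets lebesgue"
  shows "(\<lambda>x. infdist x S powr q) absolutely_integrable_on J"
proof -
  have "compact (closure J)" using assms by (simp add: compact_closure)
  then show ?thesis
    by (rule continuous_imp_absolutely_integrable_on)
       (use assms continuous_on_infdist_powr closure_subset[of J] in auto)
qed

lemma infdist_powr_integrable_on:
  fixes J :: "'a::euclidean_space set"
  assumes "q > 0" "bounded J" "J \<in> sets lebesgue"
  shows "(\<lambda>x. infdist x S powr q) integrable_on J"
  using infdist_powr_integrable[OF assms] absolutely_integrable_on_def by blast

lemma infdist_finite_attained:
  fixes x :: "'a::heine_borel"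
  assumes "finite S" "S \<noteq> {}"
  obtains s where "s \<in> S" "infdist x S = dist x s"
  using assms infdist_attains_inf[of S x] by (auto simp: finite_imp_closed)

lemma Min_norm_powr_eq_infdist:
  fixes x :: "'a::euclidean_space"
  assumes "finite S" "S \<noteq> {}" "q > 0"
  shows "Min ((\<lambda>s. norm (x - s) powr q) ` S) = infdist x S powr q"
proof (rule Min_eqI)
  fix y assume "y \<in> (\<lambda>s. norm (x - s) powr q) ` S"
  then obtain s where s: "s \<in> S" "y = norm (x - s) powr q" by blast
  show "infdist x S powr q \<le> y"
    using s infdist_le[of s S x] \<open>q > 0\<close>
    by (auto simp: dist_norm infdist_nonneg intro!: powr_mono2)
next
  obtain s where "s \<in> S" "infdist x S = dist x s"
    using assms by (rule_tac infdist_finite_attained)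
  then show "infdist x S powr q \<in> (\<lambda>s. norm (x - s) powr q) ` S"
    by (auto simp: dist_norm)
qed (use assms in simp)

text \<open>Pigeonhole on a grid of M^n boxes, with \<open>M\<close> the integer part of k^(1/n):
  one point of \<open>Z\<close> is kept per occupied box, so the net lies in \<open>Z\<close>
  itself. This matters when \<open>Z\<close> is the image of a map along which the net is pulled
  back.\<close>

lemma bounded_net:
  fixes Z :: "(real^'n::finite) set"
  assumes "bounded Z" "Z \<noteq> {}"
  shows "\<exists>R>0. \<forall>k\<ge>1. \<exists>T. T \<subseteq> Z \<and> finite T \<and> T \<noteq> {} \<and> card T \<le> k \<and>
    (\<forall>z\<in>Z. \<exists>t\<in>T. dist z t \<le> R * real k powr (- 1 / real CARD('n)))"
proof -
  define n where "n = CARD('n)"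
  have n: "n > 0" by (simp add: n_def)
  obtain b where b: "b > 0" "\<And>z. z \<in> Z \<Longrightarrow> norm z \<le> b"
    using bounded_pos assms(1) by metis
  have comp: "\<bar>z $ i\<bar> \<le> b" if "z \<in> Z" for z i
    using component_le_norm_cart[of z i] b(2)[OF that] by linarith
  show ?thesis
  \<comment> \<open>The mesh is 4 b / M per coordinate, 1 / M \<le> 2 k^(-1/n) costs the factor 2,
    and \<open>real n\<close> passes from coordinates to the norm.\<close>
  proof (intro exI[of _ "8 * b * real n"] conjI allI impI)
    show "0 < 8 * b * real n" using b n by simp
    fix k :: nat assume k: "k \<ge> 1"
    define M where "M = nat \<lfloor>real k powr (1 / real n)\<rfloor>"
    have k1: "real k powr (1 / real n) \<ge> 1" using k by (simp add: ge_one_powr_ge_zero)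
    then have "real M = of_int \<lfloor>real k powr (1 / real n)\<rfloor>" unfolding M_def by simp
    then have Mle: "real M \<le> real k powr (1 / real n)" and Mgt: "real k powr (1 / real n) < real M + 1"
      by linarith+
    have M1: "real M \<ge> 1" using k1 unfolding M_def by simp
    have Mhalf: "real k powr (1 / real n) \<le> 2 * real M" using Mgt M1 by linarith
    have Mk: "M ^ n \<le> k"
    proof -
      have "real M ^ n \<le> (real k powr (1 / real n)) ^ n"
        using Mle by (intro power_mono) auto
      also have "\<dots> = real k" using k n by (simp add: powr_power)
      finally show ?thesis by (metis of_nat_le_iff of_nat_power)
    qed
    \<comment> \<open>Coordinates shifted by \<open>b\<close> lie in [0, 2 b]; dividing by 4 b
      rather than 2 b keeps the index strictly below \<open>M\<close>, also for the coordinate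
      \<open>b\<close>.\<close>
    define q where "q = (\<lambda>z :: real^'n. \<lambda>i. nat \<lfloor>(z $ i + b) * real M / (4 * b)\<rfloor>)"
    have fl: "0 \<le> (z $ i + b) * real M / (4 * b)" "(z $ i + b) * real M / (4 * b) < real M" if "z \<in> Z" for z i
    proof -
      have "0 \<le> z $ i + b" "z $ i + b < 4 * b" using comp[OF that, of i] b by linarith+
      moreover from this have "(z $ i + b) * real M < 4 * b * real M"
        using M1 by (intro mult_strict_right_mono) auto
      ultimately show "0 \<le> (z $ i + b) * real M / (4 * b)" "(z $ i + b) * real M / (4 * b) < real M"
        using b(1) by (auto intro!: divide_nonneg_pos mult_nonneg_nonneg simp: pos_divide_less_eq mult_ac)
    qed
    have qsub: "q ` Z \<subseteq> PiE UNIV (\<lambda>_. {..<M})"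
    proof (clarsimp simp: PiE_def q_def)
      fix z i assume "z \<in> Z"
      from fl[OF this, of i] show "nat \<lfloor>(z $ i + b) * real M / (4 * b)\<rfloor> < M"
        by linarith
    qed
    have finP: "finite (PiE (UNIV :: 'n set) (\<lambda>_. {..<M}))"
      by (intro finite_PiE) auto
    have cardP: "card (PiE (UNIV :: 'n set) (\<lambda>_. {..<M})) = M ^ n"
      by (simp add: card_PiE n_def)
    have fin: "finite (q ` Z)" by (rule finite_subset[OF qsub finP])
    have cardq: "card (q ` Z) \<le> M ^ n"
      using card_mono[OF finP qsub] cardP by simp
    define T where "T = inv_into Z q ` q ` Z"
    show "\<exists>T. T \<subseteq> Z \<and> finite T \<and> T \<noteq> {} \<and> card T \<le> k \<and>
      (\<forall>z\<in>Z. \<exists>t\<in>T. dist z t \<le> 8 * b * real n * real k powr (- 1 / real CARD('n)))"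
    proof (intro exI[of _ T] conjI ballI)
      show "T \<subseteq> Z" unfolding T_def by (auto intro: inv_into_into)
      show "finite T" "T \<noteq> {}" unfolding T_def using fin assms by auto
      show "card T \<le> k"
        unfolding T_def using card_image_le[OF fin, of "inv_into Z q"] cardq Mk by linarith
      fix z assume z: "z \<in> Z"
      define t where "t = inv_into Z q (q z)"
      have t: "t \<in> Z" "q t = q z" unfolding t_def using z by (auto intro: inv_into_into f_inv_into_f)
      have "\<bar>(z - t) $ i\<bar> \<le> 4 * b / real M" for i
      proof -
        have "\<lfloor>(z $ i + b) * real M / (4 * b)\<rfloor> = \<lfloor>(t $ i + b) * real M / (4 * b)\<rfloor>"
          using fun_cong[OF t(2), of i] fl(1)[OF z, of i] fl(1)[OF t(1), of i] unfolding q_def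
          by (metis eq_nat_nat_iff zero_le_floor)
        then have "\<bar>(z $ i + b) * real M / (4 * b) - (t $ i + b) * real M / (4 * b)\<bar> \<le> 1"
          by linarith
        also have "(z $ i + b) * real M / (4 * b) - (t $ i + b) * real M / (4 * b) = (z $ i - t $ i) * (real M / (4 * b))"
          using b by (simp add: field_simps)
        finally have "\<bar>z $ i - t $ i\<bar> * (real M / (4 * b)) \<le> 1"
          using b M1 by (simp add: abs_mult)
        then show ?thesis using b M1 by (simp add: field_simps)
      qed
      then have "(\<Sum>i\<in>UNIV. \<bar>(z - t) $ i\<bar>) \<le> (\<Sum>i\<in>(UNIV :: 'n set). 4 * b / real M)"
        by (intro sum_mono)
      then have "dist z t \<le> real n * (4 * b / real M)"
        using norm_le_l1_cart[of "z - t"] by (simp add: dist_norm n_def)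
      also have "1 / real M \<le> 2 * real k powr (- 1 / real n)"
        using Mhalf M1 k by (simp add: powr_minus_divide field_simps)
      then have "real n * (4 * b / real M) \<le> real n * (4 * b) * (2 * real k powr (- 1 / real n))"
        using b mult_left_mono[of "1 / real M" "2 * real k powr (- 1 / real n)" "real n * (4 * b)"] by simp
      finally have "dist z t \<le> 8 * b * real n * real k powr (- 1 / real CARD('n))"
        by (simp add: n_def mult_ac)
      moreover have "t \<in> T" unfolding T_def t_def using z by blast
      ultimately show "\<exists>t\<in>T. dist z t \<le> 8 * b * real n * real k powr (- 1 / real CARD('n))" by blast
    qed
  qed
qed

lemma compact_finite_net:
  fixes K :: "'a::metric_space set"
  assumes "compact K" "e > 0"
  shows "\<exists>T. finite T \<and> T \<subseteq> K \<and> (\<forall>x\<in>K. \<exists>t\<in>T. dist x t < e)"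
proof -
  obtain T where "finite T" "T \<subseteq> K" "K \<subseteq> (\<Union>x\<in>T. ball x e)"
  proof (rule compactE_image[OF \<open>compact K\<close>, of K "\<lambda>x. ball x e"])
    show "K \<subseteq> (\<Union>x\<in>K. ball x e)" using \<open>e > 0\<close> by auto
  qed (use that in auto)
  then show ?thesis by (force simp: dist_commute)
qed

section \<open>Exhausting an open set by cubes\<close>

definition is_cube :: "(real^'n::finite) set \<Rightarrow> bool" where
  "is_cube K \<longleftrightarrow> (\<exists>a r. r > 0 \<and> K = cbox a (a + vec r))"

text \<open>\<open>covering_lemma\<close> gives countably many nonoverlapping dyadic cubes
  subordinate to the neighbourhoods \<open>g x\<close>. By dominated convergence finitely many of
  them leave only a small part of the integral of \<psi>, which may be unbounded near the boundary
  of \<open>U\<close>.\<close>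

lemma cube_cells:
  fixes U :: "(real^'n::finite) set"
  assumes "open U" "bounded U" and g: "\<And>x. x \<in> U \<Longrightarrow> open (g x) \<and> x \<in> g x"
    and \<psi>: "\<psi> absolutely_integrable_on U" "\<And>x. x \<in> U \<Longrightarrow> 0 \<le> \<psi> x" and "\<epsilon> > (0::real)"
  shows "\<exists>I. finite I \<and> (\<forall>K\<in>I. K \<subseteq> U \<and> is_cube K \<and> (\<exists>x\<in>K. K \<subseteq> g x)) \<and>
    pairwise (\<lambda>A B. interior A \<inter> interior B = {}) I \<and> integral (U - \<Union>I) \<psi> \<le> \<epsilon>"
proof (cases "U = {}")
  case True
  then show ?thesis using \<open>\<epsilon> > 0\<close> by (intro exI[of _ "{}"]) simp
next
  case False
  obtain b where b: "b > 0" "\<And>x. x \<in> U \<Longrightarrow> norm x \<le> b"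
    using bounded_pos \<open>bounded U\<close> by metis
  have Ub: "U \<subseteq> cbox (vec (- b)) (vec b)"
  proof
    fix x assume "x \<in> U"
    then have "\<bar>x $ i\<bar> \<le> b" for i
      using component_le_norm_cart[of x i] b(2) by (meson order_trans)
    then show "x \<in> cbox (vec (- b)) (vec b)"
      by (auto simp: mem_box_cart abs_le_iff minus_le_iff)
  qed
  have ne: "box (vec (- b)) (vec b :: real^'n) \<noteq> {}"
    using b(1) by (simp add: interval_ne_empty_cart)
  \<comment> \<open>Intersecting with \<open>U\<close> forces the cells into \<open>U\<close>. The
    value outside \<open>U\<close> only makes \<open>G\<close> a gauge, as every cell is subordinate
    to a point of \<open>U\<close>.\<close>
  define G where "G = (\<lambda>x. if x \<in> U then g x \<inter> U else UNIV)"
  have "gauge G"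
    unfolding gauge_def G_def using g \<open>open U\<close> by auto
  show ?thesis
  proof (rule covering_lemma[OF Ub ne \<open>gauge G\<close>])
  fix \<D> assume
    cnt: "countable \<D>" and "\<Union>\<D> \<subseteq> cbox (vec (- b)) (vec b)" and int: "\<And>K. K \<in> \<D> \<Longrightarrow> interior K \<noteq> {} \<and> (\<exists>c d. K = cbox c d)"
    and pw: "pairwise (\<lambda>A B. interior A \<inter> interior B = {}) \<D>"
    and sub: "\<And>K. K \<in> \<D> \<Longrightarrow> \<exists>x\<in>U \<inter> K. K \<subseteq> G x"
    and side: "\<And>u v. cbox u v \<in> \<D> \<Longrightarrow> \<exists>n. \<forall>i\<in>Basis. v \<bullet> i - u \<bullet> i = (vec b \<bullet> i - vec (- b) \<bullet> i) / 2 ^ n"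
    and cover: "U \<subseteq> \<Union>\<D>"
  have "\<D> \<noteq> {}" using cover False by blast
  \<comment> \<open>\<open>from_nat_into\<close> repeats members if \<D> is finite, which does not
    affect the unions of initial segments formed below.\<close>
  define e where "e = from_nat_into \<D>"
  have e: "e i \<in> \<D>" for i unfolding e_def using \<open>\<D> \<noteq> {}\<close> by (rule from_nat_into)
  have esurj: "\<exists>i. K = e i" if "K \<in> \<D>" for K
    unfolding e_def using from_nat_into_surj[OF cnt that] by metis
  have cell: "K \<subseteq> U \<and> is_cube K \<and> (\<exists>x\<in>K. K \<subseteq> g x)" if "K \<in> \<D>" for K
  proof -
    obtain x where x: "x \<in> U" "x \<in> K" "K \<subseteq> G x" using sub[OF \<open>K \<in> \<D>\<close>] by blast
    obtain u v where K: "K = cbox u v" using int[OF \<open>K \<in> \<D>\<close>] by blast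
    obtain n where n: "\<And>i. i \<in> Basis \<Longrightarrow> v \<bullet> i - u \<bullet> i = (vec b \<bullet> i - vec (- b) \<bullet> i) / 2 ^ n"
      using side \<open>K \<in> \<D>\<close> K by blast
    \<comment> \<open>The exponent \<open>n\<close> is the same for all directions: every side of
      the initial cube has been halved equally often, so the cell is a cube.\<close>
    have "v = u + vec (2 * b / 2 ^ n)"
    proof (subst vec_eq_iff, rule allI)
      fix i :: 'n
      show "v $ i = (u + vec (2 * b / 2 ^ n)) $ i"
        using n[of "axis i 1"] by (simp add: inner_axis axis_in_Basis_iff field_simps)
    qed
    then show ?thesis
      using x K b(1) unfolding G_def is_cube_def
      by (intro conjI exI[of _ u] exI[of _ "2 * b / 2 ^ n"] bexI[of _ x]) auto
  qed
  define A where "A = (\<lambda>n. U - \<Union>(e ` {..n}))"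
  have Am: "A n \<in> sets lebesgue" for n
  proof -
    have "e i \<in> sets lebesgue" for i
      using cell[OF e[of i]] by (auto simp: is_cube_def)
    moreover have "U \<in> sets lebesgue" using \<open>open U\<close> by (simp add: borel_open)
    ultimately show ?thesis unfolding A_def by (intro sets.Diff sets.finite_Union) auto
  qed
  have "(\<lambda>n. integral U (\<lambda>x. if x \<in> A n then \<psi> x else 0)) \<longlonglongrightarrow> integral U (\<lambda>x. 0)"
  proof (rule dominated_convergence(2))
    show "(\<lambda>x. if x \<in> A n then \<psi> x else 0) integrable_on U" for n
    proof -
      have "\<psi> absolutely_integrable_on A n"
        using set_integrable_subset[OF \<psi>(1) Am] by (auto simp: A_def)
      then have "\<psi> integrable_on A n \<inter> U"
        unfolding absolutely_integrable_on_def by (metis A_def Diff_subset inf.absorb1)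
      then show ?thesis by (simp add: integrable_restrict_Int)
    qed
    show "\<psi> integrable_on U" using \<psi>(1) absolutely_integrable_on_def by blast
    show "norm (if x \<in> A n then \<psi> x else 0) \<le> \<psi> x" if "x \<in> U" for n x
      using \<psi>(2)[OF that] by auto
    show "(\<lambda>n. if x \<in> A n then \<psi> x else 0) \<longlonglongrightarrow> 0" if xU: "x \<in> U" for x
    proof -
      obtain K where "K \<in> \<D>" "x \<in> K" using cover xU by blast
      then obtain i where "x \<in> e i" using esurj by blast
      then have "\<forall>\<^sub>F n in sequentially. 0 = (if x \<in> A n then \<psi> x else 0)"
        unfolding A_def by (intro eventually_mono[OF eventually_ge_at_top[of i]]) auto
      then show ?thesis by (rule Lim_transform_eventually[OF tendsto_const])
    qed
  qed
  then have "\<forall>\<^sub>F n in sequentially. integral U (\<lambda>x. if x \<in> A n then \<psi> x else 0) < \<epsilon>"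
    using \<open>\<epsilon> > 0\<close> by (intro order_tendstoD) auto
  then obtain n where n: "integral U (\<lambda>x. if x \<in> A n then \<psi> x else 0) < \<epsilon>"
    using eventually_happens'[OF sequentially_bot] by blast
  have "A n \<inter> U = A n" by (auto simp: A_def)
  then have "integral U (\<lambda>x. if x \<in> A n then \<psi> x else 0) = integral (A n) \<psi>"
    using integral_restrict_Int[of U "A n" \<psi>] by simp
  moreover have "pairwise (\<lambda>A B. interior A \<inter> interior B = {}) (e ` {..n})"
    using e by (intro pairwise_subset[OF pw]) auto
  ultimately show ?thesis
    using n cell e unfolding A_def by (intro exI[of _ "e ` {..n}"]) auto
  qed
qed

section \<open>Quantization error and its scaling\<close>

lemma content_cube:
  "r \<ge> 0 \<Longrightarrow> measure lborel (cbox a (a + vec r :: real^'n::finite)) = r ^ CARD('n)"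
  by (simp add: content_cbox_cart interval_ne_empty_cart)

text \<open>The affine map from the unit cube multiplies distances by \<open>r\<close>, hence the
  integrand by r^q, and volumes by r^n.\<close>

lemma integral_cube_infdist:
  fixes a :: "real^'n::finite"
  assumes "r > 0" "q > 0" "finite S" "S \<noteq> {}"
  shows "integral (cbox a (a + vec r)) (\<lambda>x. infdist x ((\<lambda>s. r *\<^sub>R s + a) ` S) powr q) =
    r powr (real CARD('n) + q) * integral (cbox 0 (vec 1)) (\<lambda>x. infdist x S powr q)"
proof -
  let ?T = "(\<lambda>s. r *\<^sub>R s + a) ` S"
  let ?f = "\<lambda>x. infdist x ?T powr q"
  have inf: "infdist (r *\<^sub>R y + a) ?T = r * infdist y S" for y
  proof -
    have "infdist (r *\<^sub>R y + a) ?T = (INF s\<in>S. r * dist y s)"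
      using assms by (simp add: infdist_notempty image_image dist_norm flip: scaleR_diff_right)
    also have "\<dots> = (INF u\<in>(\<lambda>s. dist y s) ` S. r * u)" by (simp add: image_image)
    also have "\<dots> = r * infdist y S"
    proof -
      have "mono (\<lambda>u. r * u)" using \<open>r > 0\<close> by (auto intro!: monoI mult_left_mono)
      then have "r * Min ((\<lambda>s. dist y s) ` S) = Min ((\<lambda>u. r * u) ` (\<lambda>s. dist y s) ` S)"
        using assms by (intro mono_Min_commute) auto
      then show ?thesis using assms by (simp add: infdist_notempty cInf_eq_Min)
    qed
    finally show ?thesis .
  qed
  have fi: "?f integrable_on cbox a (a + vec r)"
    using \<open>q > 0\<close> by (intro infdist_powr_integrable_on) auto
  from has_integral_affinity[OF integrable_integral[OF fi], of r a]
  have "((\<lambda>x. ?f (r *\<^sub>R x + a)) has_integral (1 / r ^ CARD('n)) *\<^sub>R integral (cbox a (a + vec r)) ?f)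
      ((\<lambda>x. (1 / r) *\<^sub>R x + - ((1 / r) *\<^sub>R a)) ` cbox a (a + vec r))"
    using \<open>r > 0\<close> by simp
  also have "(\<lambda>x. (1 / r) *\<^sub>R x + - ((1 / r) *\<^sub>R a)) ` cbox a (a + vec r) = cbox 0 (vec 1)"
  proof -
    have "cbox a (a + vec r) \<noteq> {}" using \<open>r > 0\<close> by (simp add: interval_ne_empty_cart)
    moreover have "(1 / r) *\<^sub>R (a + vec r) + - ((1 / r) *\<^sub>R a) = vec 1"
      using \<open>r > 0\<close> by (simp add: vec_eq_iff field_simps)
    moreover have "(1 / r) *\<^sub>R a + - ((1 / r) *\<^sub>R a) = 0" by simp
    moreover have "0 \<le> 1 / r" using \<open>r > 0\<close> by simp
    ultimately show ?thesis
      unfolding image_affinity_cbox by presburger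
  qed
  finally have "(1 / r ^ CARD('n)) * integral (cbox a (a + vec r)) ?f = integral (cbox 0 (vec 1)) (\<lambda>x. ?f (r *\<^sub>R x + a))"
    by (metis integral_unique real_scaleR_def)
  also have "(\<lambda>x. ?f (r *\<^sub>R x + a)) = (\<lambda>x. r powr q * infdist x S powr q)"
    using \<open>r > 0\<close> by (simp add: inf powr_mult infdist_nonneg)
  finally have "integral (cbox a (a + vec r)) ?f = r ^ CARD('n) * (r powr q * integral (cbox 0 (vec 1)) (\<lambda>x. infdist x S powr q))"
    using \<open>r > 0\<close> by (simp add: field_simps)
  then show ?thesis using \<open>r > 0\<close> by (simp add: powr_add powr_realpow)
qed

text \<open>Quantizers may lie anywhere and have at most \<open>k\<close> points: the error is then
  antitone in \<open>k\<close>, and points can be added to a quantizer or moved by affine maps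
  without leaving the admissible class. \<open>zador_limit\<close> returns to exactly
  \<open>m\<close> points inside \<open>J\<close>.\<close>

definition qerr :: "real \<Rightarrow> (real^'n::finite) set \<Rightarrow> nat \<Rightarrow> real" where
  "qerr q J k = (INF S\<in>{S. finite S \<and> S \<noteq> {} \<and> card S \<le> k}. integral J (\<lambda>x. infdist x S powr q))"

lemma integral_infdist_nonneg: "0 \<le> integral J (\<lambda>x. infdist x S powr q)"
proof (cases "(\<lambda>x. infdist x S powr q) integrable_on J")
  case True
  then show ?thesis by (rule integral_nonneg) auto
qed (simp add: not_integrable_integral)

lemma qerr_le:
  assumes "finite S" "S \<noteq> {}" "card S \<le> k"
  shows "qerr q J k \<le> integral J (\<lambda>x. infdist x S powr q)"
  unfolding qerr_def using assms
  by (intro cINF_lower bdd_belowI[of _ 0]) (auto simp: integral_infdist_nonneg)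

lemma qerr_greatest:
  assumes "k \<ge> 1" "\<And>S. finite S \<Longrightarrow> S \<noteq> {} \<Longrightarrow> card S \<le> k \<Longrightarrow> c \<le> integral J (\<lambda>x. infdist x S powr q)"
  shows "c \<le> qerr q J k"
proof -
  have "{undefined} \<in> {S :: (real^'a) set. finite S \<and> S \<noteq> {} \<and> card S \<le> k}" using assms by simp
  then show ?thesis unfolding qerr_def using assms by (intro cINF_greatest) blast+
qed

lemma qerr_nonneg: "k \<ge> 1 \<Longrightarrow> 0 \<le> qerr q J k"
  by (rule qerr_greatest) (auto simp: integral_infdist_nonneg)

lemma qerr_approx:
  assumes "k \<ge> 1" "\<epsilon> > 0"
  shows "\<exists>S. finite S \<and> S \<noteq> {} \<and> card S \<le> k \<and> integral J (\<lambda>x. infdist x S powr q) < qerr q J k + \<epsilon>"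
proof (rule ccontr)
  assume "\<not> ?thesis"
  then have "qerr q J k + \<epsilon> \<le> qerr q J k"
    using assms(1) by (intro qerr_greatest) (auto simp: not_less)
  then show False using assms by simp
qed

lemma qerr_antimono: "1 \<le> k \<Longrightarrow> k \<le> k' \<Longrightarrow> qerr q J k' \<le> qerr q J k"
  by (rule qerr_greatest) (auto intro: qerr_le)

text \<open>Projecting the quantizers to a convex set does not increase any distance.\<close>

lemma qerr_approx_convex:
  fixes J :: "(real^'n::finite) set"
  assumes "k \<ge> 1" "\<epsilon> > 0" and J: "compact J" "convex J" "J \<noteq> {}" and "q > 0"
  obtains S where "S \<subseteq> J" "finite S" "S \<noteq> {}" "card S \<le> k" "integral J (\<lambda>x. infdist x S powr q) < qerr q J k + \<epsilon>"
proof -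
  obtain S where S: "finite S" "S \<noteq> {}" "card S \<le> k" "integral J (\<lambda>x. infdist x S powr q) < qerr q J k + \<epsilon>"
    using qerr_approx[OF assms(1,2)] by blast
  have cl: "closed J" using J by (simp add: compact_imp_closed)
  let ?T = "closest_point J ` S"
  have "integral J (\<lambda>x. infdist x ?T powr q) \<le> integral J (\<lambda>x. infdist x S powr q)"
  proof (rule integral_le)
    fix x assume x: "x \<in> J"
    obtain s where s: "s \<in> S" "infdist x S = dist x s"
      using S by (rule_tac infdist_finite_attained)
    have "infdist x ?T \<le> dist x (closest_point J s)" using s by (intro infdist_le) blast
    also have "\<dots> = dist (closest_point J x) (closest_point J s)"
      using x by (simp add: closest_point_self)
    also have "\<dots> \<le> dist x s" by (rule closest_point_lipschitz[OF J(2) cl J(3)])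
    finally show "infdist x ?T powr q \<le> infdist x S powr q"
      using s \<open>q > 0\<close> by (intro powr_mono2) (auto simp: infdist_nonneg)
  qed (use J \<open>q > 0\<close> in \<open>auto intro!: infdist_powr_integrable_on simp: compact_imp_bounded lmeasurable_compact fmeasurableD\<close>)
  then show ?thesis
    using S cl J by (intro that[of ?T]) (auto intro: closest_point_in_set order_trans[OF card_image_le])
qed

text \<open>Each of the j^n tiles of side 1 / j gets a scaled copy of one configuration; each tile
  integral is j^(-n-q) times the original one.\<close>

lemma qerr_cube_tiling:
  assumes "j \<ge> 1" "m \<ge> 1" "q > 0"
  shows "qerr q (cbox 0 (vec 1) :: (real^'n::finite) set) (j ^ CARD('n) * m) \<le>
    real j powr (- q) * qerr q (cbox 0 (vec 1) :: (real^'n) set) m"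
proof -
  let ?Q = "cbox 0 (vec 1) :: (real^'n) set"
  define r where "r = 1 / real j"
  have r: "r > 0" using assms by (simp add: r_def)
  define Z where "Z = PiE (UNIV :: 'n set) (\<lambda>_. {..<j})"
  have Z: "finite Z" "card Z = j ^ CARD('n)"
    unfolding Z_def by (auto simp: finite_PiE card_PiE)
  define a where "a = (\<lambda>z :: 'n \<Rightarrow> nat. (\<chi> i. r * real (z i)) :: real^'n)"
  have "real j powr q * qerr q ?Q (j ^ CARD('n) * m) \<le> qerr q ?Q m"
  proof (rule qerr_greatest[OF \<open>m \<ge> 1\<close>])
    fix S :: "(real^'n) set" assume S: "finite S" "S \<noteq> {}" "card S \<le> m"
    define T where "T = (\<lambda>z. (\<lambda>s. r *\<^sub>R s + a z) ` S)"
    define V where "V = (\<Union>z\<in>Z. T z)"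
    have "Z \<noteq> {}" using Z assms by (metis card.empty not_one_le_zero one_le_power)
    then have V: "finite V" "V \<noteq> {}" unfolding V_def T_def using Z S by auto
    have "card V \<le> (\<Sum>z\<in>Z. card (T z))" unfolding V_def by (rule card_UN_le[OF Z(1)])
    also have "\<dots> \<le> (\<Sum>z\<in>Z. m)"
      unfolding T_def using S by (intro sum_mono) (meson card_image_le order_trans)
    finally have "card V \<le> j ^ CARD('n) * m" using Z by simp
    then have "qerr q ?Q (j ^ CARD('n) * m) \<le> integral ?Q (\<lambda>x. infdist x V powr q)"
      using V by (intro qerr_le)
    also have "\<dots> \<le> (\<Sum>z\<in>Z. integral (cbox (a z) (a z + vec r)) (\<lambda>x. infdist x V powr q))"
    proof (rule integral_le_sum_cover)
      show "?Q \<subseteq> (\<Union>z\<in>Z. cbox (a z) (a z + vec r))"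
      proof
        fix x :: "real^'n" assume x: "x \<in> ?Q"
        \<comment> \<open>The minimum puts the coordinate 1 into the last tile, where the floor
          alone would give the index \<open>j\<close>.\<close>
        define z where "z = (\<lambda>i. min (nat \<lfloor>real j * x $ i\<rfloor>) (j - 1))"
        have "z \<in> Z" unfolding Z_def z_def using assms by auto
        moreover have "r * real (z i) \<le> x $ i \<and> x $ i \<le> r * real (z i) + r" for i
        proof -
          have xi: "0 \<le> x $ i" "x $ i \<le> 1" using x by (auto simp: mem_box_cart)
          then have y0: "0 \<le> real j * x $ i" "real j * x $ i \<le> real j" by (auto simp: mult_left_le)
          have "real (z i) \<le> real j * x $ i" unfolding z_def using y0(1) by linarith
          moreover have "real j * x $ i \<le> real (z i) + 1"
          proof (cases "nat \<lfloor>real j * x $ i\<rfloor> \<le> j - 1")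
            case True
            then show ?thesis unfolding z_def using y0(1) by (simp add: min_absorb1)
          next
            case False
            then show ?thesis unfolding z_def using y0 assms by (simp add: min_absorb2 of_nat_diff)
          qed
          ultimately show ?thesis using assms by (simp add: r_def field_simps)
        qed
        ultimately show "x \<in> (\<Union>z\<in>Z. cbox (a z) (a z + vec r))"
          by (intro UN_I[of z]) (auto simp: mem_box_cart a_def)
      qed
    qed (use Z \<open>q > 0\<close> in \<open>auto intro!: infdist_powr_integrable_on\<close>)
    also have "\<dots> \<le> (\<Sum>z\<in>Z. integral (cbox (a z) (a z + vec r)) (\<lambda>x. infdist x (T z) powr q))"
    proof (intro sum_mono integral_le)
      fix z x assume "z \<in> Z"
      then show "infdist x V powr q \<le> infdist x (T z) powr q"
        using S \<open>q > 0\<close> unfolding V_def T_def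
        by (intro powr_mono2 infdist_mono) (auto simp: infdist_nonneg)
    qed (use \<open>q > 0\<close> in \<open>auto intro!: infdist_powr_integrable_on\<close>)
    also have "\<dots> = (\<Sum>z\<in>Z. r powr (real CARD('n) + q) * integral ?Q (\<lambda>x. infdist x S powr q))"
      unfolding T_def using integral_cube_infdist[OF r \<open>q > 0\<close> S(1,2)] by simp
    also have "\<dots> = real j ^ CARD('n) * r powr (real CARD('n) + q) * integral ?Q (\<lambda>x. infdist x S powr q)"
      using Z by simp
    also have "real j ^ CARD('n) * r powr (real CARD('n) + q) = real j powr (- q)"
      using assms by (simp add: r_def powr_divide powr_add powr_minus powr_realpow field_simps)
    finally have "real j powr q * qerr q ?Q (j ^ CARD('n) * m) \<le>
        real j powr q * (real j powr (- q) * integral ?Q (\<lambda>x. infdist x S powr q))"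
      by (intro mult_left_mono) auto
    also have "\<dots> = integral ?Q (\<lambda>x. infdist x S powr q)"
      using assms by (simp add: powr_minus)
    finally show "real j powr q * qerr q ?Q (j ^ CARD('n) * m) \<le> integral ?Q (\<lambda>x. infdist x S powr q)" .
  qed
  then show ?thesis using assms by (simp add: powr_minus field_simps)
qed

text \<open>\<delta> is the infimum of the scaled errors, so besides the limit there is a lower
  bound for every \<open>k\<close>. The limit feeds the upper bounds; the inequality feeds the lower
  ones, where the number of points in a cell is not under control.\<close>

lemma qerr_cube_limit:
  fixes q :: real
  assumes "q > 0"
  shows "\<exists>\<delta>\<ge>0. (\<lambda>k. real k powr (q / real CARD('n)) * qerr q (cbox 0 (vec 1) :: (real^'n::finite) set) k) \<longlonglongrightarrow> \<delta> \<and>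
    (\<forall>k\<ge>1. \<delta> * real k powr (- (q / real CARD('n))) \<le> qerr q (cbox 0 (vec 1) :: (real^'n) set) k)"
proof -
  let ?Q = "cbox 0 (vec 1) :: (real^'n) set"
  define n where "n = real CARD('n)"
  have n: "n > 0" by (simp add: n_def)
  define \<theta> where "\<theta> = q / n"
  define u where "u = (\<lambda>k. real k powr \<theta> * qerr q ?Q k)"
  define \<delta> where "\<delta> = (INF k\<in>{1..}. u k)"
  have u0: "0 \<le> u k" if "k \<ge> 1" for k
    unfolding u_def using that by (intro mult_nonneg_nonneg qerr_nonneg) auto
  have \<delta>le: "\<delta> \<le> u k" if "k \<ge> 1" for k
    unfolding \<delta>_def using that u0 by (intro cINF_lower bdd_belowI[of _ 0]) auto
  have \<delta>0: "\<delta> \<ge> 0" unfolding \<delta>_def using u0 by (intro cINF_greatest) auto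
  have "u \<longlonglongrightarrow> \<delta>"
  proof (rule LIMSEQ_I)
    fix \<epsilon> :: real assume "\<epsilon> > 0"
    have "\<exists>m0\<ge>1. u m0 < \<delta> + \<epsilon>"
    proof (rule ccontr)
      assume "\<not> ?thesis"
      then have "\<delta> + \<epsilon> \<le> \<delta>"
        unfolding \<delta>_def[symmetric] by (subst (2) \<delta>_def, intro cINF_greatest) (auto simp: not_less)
      then show False using \<open>\<epsilon> > 0\<close> by simp
    qed
    then obtain m0 where m0: "m0 \<ge> 1" "u m0 < \<delta> + \<epsilon>" by blast
    \<comment> \<open>The integer part \<open>j\<close> of \<open>t m\<close> is the largest integer
      with j^n m0 \<le> m; tiling with it loses only the factor (t m / j)^q, which tends to
      1.\<close>
    define t where "t = (\<lambda>m. (real m / real m0) powr (1 / n))"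
    have t: "filterlim t at_top sequentially"
      unfolding t_def using m0 n by real_asymp
    have "((\<lambda>s::real. s / of_int \<lfloor>s\<rfloor>) \<longlongrightarrow> 1) at_top" by real_asymp
    from filterlim_compose[OF this t]
    have "(\<lambda>m. t m / of_int \<lfloor>t m\<rfloor>) \<longlonglongrightarrow> 1" .
    then have "(\<lambda>m. (t m / of_int \<lfloor>t m\<rfloor>) powr q) \<longlonglongrightarrow> 1 powr q"
      by (rule tendsto_powr) auto
    from tendsto_mult[OF this tendsto_const, of "u m0"]
    have "(\<lambda>m. (t m / of_int \<lfloor>t m\<rfloor>) powr q * u m0) \<longlonglongrightarrow> u m0" by simp
    then have "\<forall>\<^sub>F m in sequentially. (t m / of_int \<lfloor>t m\<rfloor>) powr q * u m0 < \<delta> + \<epsilon>"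
      using m0 by (intro order_tendstoD) auto
    moreover have "\<forall>\<^sub>F m in sequentially. t m \<ge> 1"
      using t by (simp add: filterlim_at_top)
    ultimately have "\<forall>\<^sub>F m in sequentially. norm (u m - \<delta>) < \<epsilon>"
      using eventually_ge_at_top[of 1]
    proof eventually_elim
      case (elim m)
      define j where "j = nat \<lfloor>t m\<rfloor>"
      have j: "j \<ge> 1" "real j = of_int \<lfloor>t m\<rfloor>" "real j \<le> t m" using elim unfolding j_def by linarith+
      have tn: "t m ^ CARD('n) = real m / real m0"
        using elim m0 unfolding t_def by (simp add: n_def powr_power)
      have "real j ^ CARD('n) \<le> real m / real m0"
        using power_mono[OF j(3), of "CARD('n)"] tn by simp
      then have "real (j ^ CARD('n) * m0) \<le> real m" using m0 by (simp add: field_simps)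
      then have jm: "j ^ CARD('n) * m0 \<le> m" by linarith
      have "qerr q ?Q m \<le> qerr q ?Q (j ^ CARD('n) * m0)"
        using jm j m0 by (intro qerr_antimono) (auto simp: Suc_le_eq)
      also have "\<dots> \<le> real j powr (- q) * qerr q ?Q m0"
        by (rule qerr_cube_tiling[OF j(1) m0(1) \<open>q > 0\<close>])
      finally have "u m \<le> real m powr \<theta> * (real j powr (- q) * qerr q ?Q m0)"
        unfolding u_def by (intro mult_left_mono) auto
      also have "real m powr \<theta> = real m0 powr \<theta> * t m powr q"
      proof -
        have "t m powr q = (real m / real m0) powr \<theta>"
          unfolding t_def \<theta>_def using n by (simp add: powr_powr)
        then show ?thesis using m0 by (simp add: powr_divide)
      qed
      also have "real m0 powr \<theta> * t m powr q * (real j powr (- q) * qerr q ?Q m0) = (t m / real j) powr q * u m0"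
      proof -
        have "(t m / real j) powr q = t m powr q * real j powr (- q)"
          by (simp add: powr_divide powr_minus_divide)
        then show ?thesis unfolding u_def by (simp add: mult_ac)
      qed
      finally have "u m < \<delta> + \<epsilon>" using elim j by simp
      with \<delta>le[of m] elim show ?case by (simp add: abs_less_iff)
    qed
    then show "\<exists>no. \<forall>m\<ge>no. norm (u m - \<delta>) < \<epsilon>" by (simp add: eventually_sequentially)
  qed
  moreover have "\<delta> * real k powr (- \<theta>) \<le> qerr q ?Q k" if "k \<ge> 1" for k
    using \<delta>le[OF that] that by (simp add: u_def powr_minus field_simps)
  ultimately show ?thesis using \<delta>0 unfolding u_def \<theta>_def n_def by blast
qed

section \<open>Zador's theorem for Jordan measurable sets\<close>

lemma is_cube_lmeasurable: "is_cube K \<Longrightarrow> K \<in> lmeasurable"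
  by (auto simp: is_cube_def)

lemma is_cube_measure_pos: "is_cube K \<Longrightarrow> 0 < measure lebesgue K"
  by (auto simp: is_cube_def content_cube)

lemma integral_interior_cube:
  fixes \<phi> :: "real^'n::finite \<Rightarrow> real"
  assumes "is_cube K"
  shows "integral (interior K) \<phi> = integral K \<phi>"
  using assms integral_open_interval[of _ _ \<phi>] by (auto simp: is_cube_def interior_cbox)

text \<open>Cubes may share faces; passing to interiors makes them disjoint and changes no
  integral.\<close>

lemma sum_integral_cells_le:
  fixes \<phi> :: "real^'n::finite \<Rightarrow> real"
  assumes "finite I" and cube: "\<And>K. K \<in> I \<Longrightarrow> is_cube K" and sub: "\<And>K. K \<in> I \<Longrightarrow> K \<subseteq> U"
    and pw: "pairwise (\<lambda>A B. interior A \<inter> interior B = {}) I"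
    and \<phi>: "\<phi> absolutely_integrable_on U" "\<And>x. x \<in> U \<Longrightarrow> 0 \<le> \<phi> x"
  shows "(\<Sum>K\<in>I. integral K \<phi>) \<le> integral U \<phi>"
proof -
  have "(\<Sum>K\<in>I. integral K \<phi>) = (\<Sum>K\<in>I. integral (interior K) \<phi>)"
    using cube by (simp add: integral_interior_cube)
  also have "\<dots> \<le> integral U \<phi>"
  proof (rule sum_integral_disjoint_le)
    show "interior K \<subseteq> U" if "K \<in> I" for K
      using sub[OF that] interior_subset by blast
    then have "\<phi> absolutely_integrable_on interior K" if "K \<in> I" for K
      using that by (intro set_integrable_subset[OF \<phi>(1)]) auto
    then show "\<phi> integrable_on interior K" if "K \<in> I" for K
      using that absolutely_integrable_on_def by blast
    show "\<phi> integrable_on U" using \<phi>(1) absolutely_integrable_on_def by blast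
  qed (use assms in \<open>auto simp: pairwise_def\<close>)
  finally show ?thesis .
qed

lemma integral_le_cells_rest:
  fixes \<phi> :: "real^'n::finite \<Rightarrow> real"
  assumes "finite I" and cube: "\<And>K. K \<in> I \<Longrightarrow> is_cube K" and sub: "\<And>K. K \<in> I \<Longrightarrow> K \<subseteq> U"
    and U: "U \<in> sets lebesgue"
    and \<phi>: "\<phi> absolutely_integrable_on U" "\<And>x. x \<in> U \<Longrightarrow> 0 \<le> \<phi> x"
  shows "integral U \<phi> \<le> integral (U - \<Union>I) \<phi> + (\<Sum>K\<in>I. integral K \<phi>)"
proof -
  have m: "T \<in> sets lebesgue \<and> T \<subseteq> U" if "T \<in> insert (U - \<Union>I) I" for T
    using that cube is_cube_lmeasurable sub U \<open>finite I\<close>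
    by (auto intro!: sets.Diff sets.finite_Union simp: fmeasurableD)
  have i: "\<phi> integrable_on T" if "T \<in> insert (U - \<Union>I) I" for T
    using set_integrable_subset[OF \<phi>(1)] m[OF that] absolutely_integrable_on_def by blast
  have "integral U \<phi> \<le> (\<Sum>T\<in>insert (U - \<Union>I) I. integral T \<phi>)"
  proof (rule integral_le_sum_cover)
    show "\<phi> integrable_on U" using \<phi>(1) absolutely_integrable_on_def by blast
    show "0 \<le> \<phi> x" if "T \<in> insert (U - \<Union>I) I" "x \<in> T" for T x
      using m[OF that(1)] that(2) \<phi>(2) by blast
  qed (use \<open>finite I\<close> i in auto)
  also have "\<dots> \<le> integral (U - \<Union>I) \<phi> + (\<Sum>K\<in>I. integral K \<phi>)"
  proof (cases "U - \<Union>I \<in> I")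
    case True
    then have "insert (U - \<Union>I) I = I" by blast
    moreover have "0 \<le> integral (U - \<Union>I) \<phi>"
      using i by (intro integral_nonneg) (auto simp: \<phi>(2))
    ultimately show ?thesis by simp
  qed (use \<open>finite I\<close> in simp)
  finally show ?thesis .
qed

lemma cube_volume_powr:
  assumes "r > 0" "\<theta> = q / real CARD('n)"
  shows "measure lebesgue (cbox a (a + vec r :: real^'n::finite)) powr (1 + \<theta>) = r powr (real CARD('n) + q)"
proof -
  have "measure lebesgue (cbox a (a + vec r)) = r powr real CARD('n)"
    using assms by (simp add: content_cube powr_realpow)
  then show ?thesis
    using assms by (simp add: powr_powr field_simps)
qed

text \<open>Cells are shrunk so that each quantizer outside the interior of a cell stays away from the
  shrunk cell.\<close>

lemma shrunk_cube:
  fixes K :: "(real^'n::finite) set"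
  assumes "is_cube K" and l: "0 < l" "l < 1"
  obtains K' where "is_cube K'" "K' \<subseteq> interior K" "measure lebesgue K' = l ^ CARD('n) * measure lebesgue K"
proof -
  obtain a r where K: "r > 0" "K = cbox a (a + vec r)" using assms by (auto simp: is_cube_def)
  define s where "s = (1 - l) * r / 2"
  have s: "s > 0" "r - s = s + l * r" using K l by (auto simp: s_def field_simps)
  let ?K = "cbox (a + vec s) (a + vec s + vec (l * r))"
  show ?thesis
  proof (rule that[of ?K])
    show "is_cube ?K" unfolding is_cube_def using K l by (intro exI[of _ "a + vec s"] exI[of _ "l * r"]) simp
    show "?K \<subseteq> interior K"
    proof
      fix x assume "x \<in> ?K"
      then have x: "a $ i + s \<le> x $ i" "x $ i \<le> a $ i + s + l * r" for i by (simp_all add: mem_box_cart)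
      have "a $ i < x $ i" "x $ i < a $ i + r" for i
        using x[of i] s by linarith+
      then show "x \<in> interior K" unfolding K interior_cbox by (simp add: mem_box_cart)
    qed
    show "measure lebesgue ?K = l ^ CARD('n) * measure lebesgue K"
      using K l by (simp add: content_cube power_mult_distrib)
  qed
qed

lemma compact_interior_margin:
  fixes K :: "'a::euclidean_space set"
  assumes "compact K'" "K' \<subseteq> interior K"
  shows "\<exists>d>0. \<forall>x\<in>K'. \<forall>s. s \<notin> interior K \<longrightarrow> d \<le> dist x s"
proof -
  have "K' \<inter> - interior K = {}" using assms(2) by blast
  from separate_compact_closed[OF assms(1) _ this] open_interior[of K] show ?thesis
    by (auto simp: closed_Compl)
qed

context
  fixes q \<delta> \<theta> :: real and J :: "(real^'n::finite) set"
  assumes q: "q > 0" and \<theta>: "\<theta> = q / real CARD('n)"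
    and \<delta>: "\<delta> \<ge> 0" "(\<lambda>k. real k powr \<theta> * qerr q (cbox 0 (vec 1) :: (real^'n) set) k) \<longlonglongrightarrow> \<delta>"
      "\<And>k. k \<ge> 1 \<Longrightarrow> \<delta> * real k powr (- \<theta>) \<le> qerr q (cbox 0 (vec 1) :: (real^'n) set) k"
    and J: "compact J" "negligible (frontier J)"
begin

private lemma \<theta>_pos: "\<theta> > 0" using q \<theta> by simp

lemma qerr_cube_ge:
  fixes S :: "(real^'n) set"
  assumes "is_cube K" "finite S" "S \<noteq> {}" "card S \<le> k"
  shows "\<delta> * measure lebesgue K powr (1 + \<theta>) * real k powr (- \<theta>) \<le> integral K (\<lambda>x. infdist x S powr q)"
proof -
  obtain a r where K: "r > 0" "K = cbox a (a + vec r)" using assms by (auto simp: is_cube_def)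
  define T where "T = (\<lambda>s. (1 / r) *\<^sub>R (s - a)) ` S"
  have S: "S = (\<lambda>s. r *\<^sub>R s + a) ` T"
    using K by (simp add: T_def image_image)
  have T: "finite T" "T \<noteq> {}" "card T \<le> k"
    unfolding T_def using assms by (auto intro: order_trans[OF card_image_le])
  have "card S > 0" using assms by (simp add: card_gt_0_iff)
  then have k: "k \<ge> 1" using assms by linarith
  have "\<delta> * real k powr (- \<theta>) \<le> integral (cbox 0 (vec 1)) (\<lambda>x. infdist x T powr q)"
    using \<delta>(3)[OF k] qerr_le[OF T] by (meson order_trans)
  then have "r powr (real CARD('n) + q) * (\<delta> * real k powr (- \<theta>)) \<le> integral K (\<lambda>x. infdist x S powr q)"
    unfolding S K(2) integral_cube_infdist[OF K(1) q T(1,2)] by (intro mult_left_mono) auto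
  then show ?thesis
    unfolding K(2) cube_volume_powr[OF K(1) \<theta>] by (simp add: mult_ac)
qed

text \<open>A near-optimal quantizer of the unit cube is first projected into the cube, so its
  scaled copy lies in \<open>K\<close>, as needed for quantizers inside \<open>J\<close>.\<close>

lemma qerr_cube_attained:
  fixes K :: "(real^'n) set"
  assumes "is_cube K" "k \<ge> 1" "\<epsilon> > 0"
  obtains S where "S \<subseteq> K" "finite S" "S \<noteq> {}" "card S \<le> k"
    "integral K (\<lambda>x. infdist x S powr q) \<le>
      measure lebesgue K powr (1 + \<theta>) * (qerr q (cbox 0 (vec 1) :: (real^'n) set) k + \<epsilon>)"
proof -
  obtain a r where K: "r > 0" "K = cbox a (a + vec r)" using assms by (auto simp: is_cube_def)
  obtain S where S: "S \<subseteq> cbox 0 (vec 1 :: real^'n)" "finite S" "S \<noteq> {}" "card S \<le> k"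
    and le: "integral (cbox 0 (vec 1)) (\<lambda>x. infdist x S powr q) < qerr q (cbox 0 (vec 1) :: (real^'n) set) k + \<epsilon>"
  proof (rule qerr_approx_convex[of k \<epsilon> "cbox 0 (vec 1) :: (real^'n) set" q])
    show "cbox 0 (vec 1 :: real^'n) \<noteq> {}" by (simp add: interval_ne_empty_cart)
  qed (use assms q in auto)
  show ?thesis
  proof (rule that[of "(\<lambda>s. r *\<^sub>R s + a) ` S"])
    show "(\<lambda>s. r *\<^sub>R s + a) ` S \<subseteq> K"
      using S(1) K(1) unfolding K(2) by (auto simp: mem_box_cart subset_iff mult_left_le)
    show "card ((\<lambda>s. r *\<^sub>R s + a) ` S) \<le> k"
      by (rule order_trans[OF card_image_le[OF S(2)] S(4)])
    show "integral K (\<lambda>x. infdist x ((\<lambda>s. r *\<^sub>R s + a) ` S) powr q) \<le>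
      measure lebesgue K powr (1 + \<theta>) * (qerr q (cbox 0 (vec 1) :: (real^'n) set) k + \<epsilon>)"
      unfolding K(2) integral_cube_infdist[OF K(1) q S(2,3)] cube_volume_powr[OF K(1) \<theta>]
      using le by (intro mult_left_mono) auto
  qed (use S in auto)
qed

text \<open>\<open>cube_cells\<close> for the interior, with density 1 and unrestricted
  neighbourhoods; the negligible frontier carries the estimates over to \<open>J\<close>.\<close>

lemma jordan_cells:
  assumes "\<epsilon> > 0"
  shows "\<exists>I. finite I \<and> (\<forall>K\<in>I. is_cube K) \<and> (\<forall>K\<in>I. K \<subseteq> interior J) \<and>
    pairwise (\<lambda>A B. interior A \<inter> interior B = {}) I \<and>
    measure lebesgue (J - \<Union>I) \<le> \<epsilon> \<and>
    (\<Sum>K\<in>I. measure lebesgue K) \<le> measure lebesgue J \<and>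
    measure lebesgue J \<le> \<epsilon> + (\<Sum>K\<in>I. measure lebesgue K)"
proof -
  have Jm: "J \<in> lmeasurable" using J by (simp add: lmeasurable_compact)
  have bJ: "bounded J" using J by (simp add: compact_imp_bounded)
  have Um: "interior J \<in> lmeasurable" using bJ by (rule lmeasurable_interior)
  have one: "(\<lambda>x. 1::real) absolutely_integrable_on interior J"
    using Um by (simp add: absolutely_integrable_on_const)
  have "\<exists>I. finite I \<and> (\<forall>K\<in>I. K \<subseteq> interior J \<and> is_cube K \<and> (\<exists>x\<in>K. K \<subseteq> UNIV)) \<and>
    pairwise (\<lambda>A B. interior A \<inter> interior B = {}) I \<and> integral (interior J - \<Union>I) (\<lambda>x. 1::real) \<le> \<epsilon>"
    by (rule cube_cells) (use bounded_interior[OF bJ] one assms in auto)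
  then obtain I where I0: "finite I" "\<forall>K\<in>I. K \<subseteq> interior J \<and> is_cube K \<and> (\<exists>x\<in>K. K \<subseteq> UNIV)"
    "pairwise (\<lambda>A B. interior A \<inter> interior B = {}) I"
    and small: "integral (interior J - \<Union>I) (\<lambda>x. 1::real) \<le> \<epsilon>"
    by (elim exE conjE) (rule that; assumption)
  have I: "finite I" "\<And>K. K \<in> I \<Longrightarrow> K \<subseteq> interior J" "\<And>K. K \<in> I \<Longrightarrow> is_cube K"
    "pairwise (\<lambda>A B. interior A \<inter> interior B = {}) I"
    using I0 by auto
  have UI: "\<Union>I \<in> lmeasurable" using I is_cube_lmeasurable by (intro fmeasurable.finite_Union) auto
  have rest: "measure lebesgue (J - \<Union>I) \<le> \<epsilon>"
  proof -
    have "measure lebesgue (J - \<Union>I) = measure lebesgue (interior J - \<Union>I)"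
    proof (rule measure_negligible_symdiff)
      show "negligible ((interior J - \<Union>I) - (J - \<Union>I) \<union> ((J - \<Union>I) - (interior J - \<Union>I)))"
        using J closure_subset[of J] interior_subset[of J]
        by (intro negligible_subset[OF J(2)]) (auto simp: frontier_def)
      show "interior J - \<Union>I \<in> lmeasurable" using Um UI by (intro fmeasurable.Diff)
    qed
    also have "\<dots> = integral (interior J - \<Union>I) (\<lambda>x. 1)"
      using Um UI by (intro lmeasure_integral fmeasurable.Diff)
    finally show ?thesis using small by simp
  qed
  have mK: "integral K (\<lambda>x. 1) = measure lebesgue K" if "K \<in> I" for K
    using I(3)[OF that] by (simp add: is_cube_lmeasurable lmeasure_integral)
  have "(\<Sum>K\<in>I. measure lebesgue K) \<le> integral (interior J) (\<lambda>x. 1)"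
    using sum_integral_cells_le[OF I(1,3,2,4) one] mK by simp
  also have "\<dots> \<le> measure lebesgue J"
    unfolding lmeasure_integral[OF Um, symmetric]
    using Um Jm by (intro measure_mono_fmeasurable interior_subset fmeasurableD)
  finally have up: "(\<Sum>K\<in>I. measure lebesgue K) \<le> measure lebesgue J" .
  have "measure lebesgue J \<le> measure lebesgue ((J - \<Union>I) \<union> \<Union>I)"
    using Jm UI by (intro measure_mono_fmeasurable) (auto intro: fmeasurable.Un fmeasurable.Diff simp: fmeasurableD)
  also have "\<dots> \<le> measure lebesgue (J - \<Union>I) + measure lebesgue (\<Union>I)"
    using Jm UI by (intro measure_Un_le) (auto simp: fmeasurableD)
  also have "measure lebesgue (\<Union>I) \<le> (\<Sum>K\<in>I. measure lebesgue K)"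
    using I by (intro measure_Union_le) (auto intro!: fmeasurableD is_cube_lmeasurable)
  finally have low: "measure lebesgue J \<le> \<epsilon> + (\<Sum>K\<in>I. measure lebesgue K)" using rest by linarith
  show ?thesis
    by (intro exI[of _ I] conjI ballI I rest up low)
qed

text \<open>The points are kept inside \<open>J\<close>, so that one estimate serves both
  \<open>qerr\<close> and the constrained infimum of \<open>zador_constant\<close>. The allocation
  weight of a cube is its volume.\<close>

lemma zador_upper:
  assumes "J \<noteq> {}" "\<epsilon> > 0"
  shows "\<forall>\<^sub>F m in sequentially. \<exists>S. S \<subseteq> J \<and> finite S \<and> S \<noteq> {} \<and> card S \<le> m \<and>
    real m powr \<theta> * integral J (\<lambda>x. infdist x S powr q) \<le> \<delta> * measure lebesgue J powr (1 + \<theta>) + \<epsilon>"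
proof -
  define F where "F = (\<lambda>k. (\<lambda>S x. infdist x S powr q) ` {S. S \<subseteq> J \<and> finite S \<and> S \<noteq> {} \<and> card S \<le> k})"
  have bJ: "bounded J" using J by (simp add: compact_imp_bounded)
  have Jm: "J \<in> lmeasurable" using J by (simp add: lmeasurable_compact)
  obtain R where R: "R > 0" and net: "\<And>k. k \<ge> 1 \<Longrightarrow> \<exists>T. T \<subseteq> J \<and> finite T \<and> T \<noteq> {} \<and> card T \<le> k \<and>
    (\<forall>z\<in>J. \<exists>t\<in>T. dist z t \<le> R * real k powr (- 1 / real CARD('n)))"
    using bounded_net[OF bJ assms(1)] by blast
  have "\<forall>\<^sub>F m in sequentially. \<exists>f\<in>F m. real m powr \<theta> * integral J f \<le> \<delta> * measure lebesgue J powr (1 + \<theta>) + \<epsilon>"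
  proof (rule asymptotic_upper_bound[where B = "R powr q"])
    fix a b f g assume "f \<in> F a" "g \<in> F b"
    then obtain S T where S: "S \<subseteq> J" "finite S" "S \<noteq> {}" "card S \<le> a" "f = (\<lambda>x. infdist x S powr q)"
      and T: "T \<subseteq> J" "finite T" "T \<noteq> {}" "card T \<le> b" "g = (\<lambda>x. infdist x T powr q)"
      unfolding F_def by blast
    have "card (S \<union> T) \<le> a + b" using S T card_Un_le[of S T] by linarith
    then have "(\<lambda>x. infdist x (S \<union> T) powr q) \<in> F (a + b)"
      unfolding F_def using S T by blast
    moreover have "infdist x (S \<union> T) powr q \<le> f x \<and> infdist x (S \<union> T) powr q \<le> g x" for x
      unfolding S T using S T q by (auto intro!: powr_mono2 infdist_mono simp: infdist_nonneg)
    ultimately show "\<exists>h\<in>F (a + b). \<forall>x\<in>J. h x \<le> f x \<and> h x \<le> g x"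
      by (intro bexI[of _ "\<lambda>x. infdist x (S \<union> T) powr q"]) auto
  next
    fix k :: nat assume k: "k \<ge> 1"
    from net[OF this] obtain T where T: "T \<subseteq> J" "finite T" "T \<noteq> {}" "card T \<le> k"
      and near: "\<And>z. z \<in> J \<Longrightarrow> \<exists>t\<in>T. dist z t \<le> R * real k powr (- 1 / real CARD('n))" by blast
    have "infdist z T powr q \<le> R powr q * real k powr (- \<theta>)" if zJ: "z \<in> J" for z
    proof -
      obtain t where "t \<in> T" "dist z t \<le> R * real k powr (- 1 / real CARD('n))" using near[OF zJ] by blast
      then have "infdist z T \<le> R * real k powr (- 1 / real CARD('n))" by (rule infdist_le2)
      then have "infdist z T powr q \<le> (R * real k powr (- 1 / real CARD('n))) powr q"
        using q by (intro powr_mono2) (auto simp: infdist_nonneg)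
      also have "\<dots> = R powr q * real k powr (- \<theta>)"
        using R by (simp add: powr_mult powr_powr \<theta>)
      finally show ?thesis .
    qed
    then show "\<exists>f\<in>F k. \<forall>x\<in>J. f x \<le> R powr q * real k powr (- \<theta>)"
      using T by (intro bexI[of _ "\<lambda>x. infdist x T powr q"]) (auto simp: F_def)
  next
    fix \<epsilon>' :: real assume "\<epsilon>' > 0"
    obtain I where I0: "finite I" "\<forall>K\<in>I. is_cube K" "\<forall>K\<in>I. K \<subseteq> interior J"
      "measure lebesgue (J - \<Union>I) \<le> \<epsilon>'" "(\<Sum>K\<in>I. measure lebesgue K) \<le> measure lebesgue J"
      using jordan_cells[OF \<open>\<epsilon>' > 0\<close>] by (elim exE conjE) (rule that; assumption)
    note I = I0(1) bspec[OF I0(2)] bspec[OF I0(3)] I0(4,5)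
    \<comment> \<open>The summand k^(-\<theta>-1) is the slack above an infimum that need not be
      attained; scaled by k^\<theta> it vanishes in the limit.\<close>
    define e where "e = (\<lambda>(K :: (real^'n) set) k. measure lebesgue K powr (1 + \<theta>) *
      (qerr q (cbox 0 (vec 1) :: (real^'n) set) k + real k powr (- \<theta> - 1)))"
    have lim: "(\<lambda>k. real k powr \<theta> * e K k) \<longlonglongrightarrow> \<delta> * measure lebesgue K powr (1 + \<theta>)" for K
    proof -
      have "(\<lambda>k. measure lebesgue K powr (1 + \<theta>) * (real k powr \<theta> * qerr q (cbox 0 (vec 1) :: (real^'n) set) k + real k powr (- 1)))
          \<longlonglongrightarrow> measure lebesgue K powr (1 + \<theta>) * (\<delta> + 0)"
        by (intro tendsto_mult tendsto_const tendsto_add \<delta>) real_asymp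
      moreover have "real k powr \<theta> * e K k = measure lebesgue K powr (1 + \<theta>) *
          (real k powr \<theta> * qerr q (cbox 0 (vec 1) :: (real^'n) set) k + real k powr (- 1))" for k
      proof -
        have "real k powr \<theta> * real k powr (- \<theta> - 1) = real k powr (- 1)"
          by (cases "k = 0") (simp_all flip: powr_add)
        then have "measure lebesgue K powr (1 + \<theta>) * (real k powr \<theta> * qerr q (cbox 0 (vec 1) :: (real^'n) set) k + real k powr (- 1)) =
            measure lebesgue K powr (1 + \<theta>) * (real k powr \<theta> * qerr q (cbox 0 (vec 1) :: (real^'n) set) k + real k powr \<theta> * real k powr (- \<theta> - 1))"
          by (simp only:)
        then show ?thesis unfolding e_def by (simp only: distrib_left mult_ac)
      qed
      ultimately show ?thesis by (simp add: mult.commute)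
    qed
    have "\<exists>f\<in>F k. integral K f \<le> e K k" if "K \<in> I" "k \<ge> 1" for K k
    proof -
      have "real k powr (- \<theta> - 1) > 0" using that by simp
      from qerr_cube_attained[OF I(2)[OF that(1)] that(2) this] obtain S where
        S: "S \<subseteq> K" "finite S" "S \<noteq> {}" "card S \<le> k" "integral K (\<lambda>x. infdist x S powr q) \<le> e K k"
        unfolding e_def by blast
      moreover have "K \<subseteq> J" using I(3)[OF that(1)] interior_subset by blast
      ultimately have "(\<lambda>x. infdist x S powr q) \<in> F k" using S unfolding F_def by blast
      then show ?thesis using S by blast
    qed
    moreover have "K \<subseteq> J \<and> K \<in> lmeasurable \<and> 0 < measure lebesgue K" if "K \<in> I" for K
      using I(2,3)[OF that] interior_subset[of J] is_cube_lmeasurable is_cube_measure_pos by blast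
    ultimately show "\<exists>I c e. finite I \<and>
        (\<forall>K\<in>I. K \<subseteq> J \<and> K \<in> lmeasurable \<and> 0 < c K \<and>
           (\<lambda>k. real k powr \<theta> * e K k) \<longlonglongrightarrow> \<delta> * c K powr (1 + \<theta>) \<and>
           (\<forall>k\<ge>1. \<exists>f\<in>F k. integral K f \<le> e K k)) \<and>
        sum c I \<le> measure lebesgue J + \<epsilon>' \<and> measure lebesgue (J - \<Union>I) \<le> \<epsilon>'"
      using I lim \<open>\<epsilon>' > 0\<close>
      by (intro exI[of _ I] exI[of _ "measure lebesgue"] exI[of _ e]) auto
  next
    show "\<theta> > 0" by (rule \<theta>_pos)
    show "J \<in> lmeasurable" by (rule Jm)
    show "f absolutely_integrable_on J" if "f \<in> F k" for f k
      using that q bJ Jm unfolding F_def by (auto intro: infdist_powr_integrable fmeasurableD)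
    show "0 \<le> f x" if "f \<in> F k" for f k x using that unfolding F_def by auto
    show "F a \<subseteq> F b" if "a \<le> b" for a b using that unfolding F_def by auto
    show "0 \<le> R powr q" "0 \<le> measure lebesgue J" by auto
    show "0 \<le> \<delta>" by (rule \<delta>(1))
    show "0 < \<epsilon>" by fact
  qed
  then show ?thesis unfolding F_def by (rule eventually_mono) blast
qed

lemma zador_lower:
  assumes "\<epsilon> > 0"
  shows "\<forall>\<^sub>F m in sequentially. \<forall>S. finite S \<and> S \<noteq> {} \<and> card S \<le> m \<longrightarrow>
    \<delta> * measure lebesgue J powr (1 + \<theta>) - \<epsilon> \<le> real m powr \<theta> * integral J (\<lambda>x. infdist x S powr q)"
proof -
  define F where "F = (\<lambda>k. {S :: (real^'n) set. finite S \<and> S \<noteq> {} \<and> card S \<le> k})"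
  have bJ: "bounded J" using J by (simp add: compact_imp_bounded)
  have Jm: "J \<in> sets lebesgue" using J by (simp add: lmeasurable_compact fmeasurableD)
  have "\<forall>\<^sub>F m in sequentially. \<forall>S\<in>F m.
    \<delta> * measure lebesgue J powr (1 + \<theta>) - \<epsilon> \<le> real m powr \<theta> * integral J (\<lambda>x. infdist x S powr q)"
  proof (rule asymptotic_lower_bound[where 'i = "(real^'n) set"])
    fix \<eta> :: real assume "\<eta> > 0"
    define \<mu> where "\<mu> = measure lebesgue J"
    \<comment> \<open>\<open>e\<close> governs both the shrinking of the cells and the volume they
      miss; the total volume of the shrunk cells has to stay above \<mu> - \<eta>.\<close>
    have "((\<lambda>e. (1 - e) ^ CARD('n) * (\<mu> - e)) \<longlongrightarrow> (1 - 0) ^ CARD('n) * (\<mu> - 0)) (at_right 0)"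
      by (intro tendsto_intros)
    then have "\<forall>\<^sub>F e in at_right 0. \<mu> - \<eta> < (1 - e) ^ CARD('n) * (\<mu> - e)"
      using \<open>\<eta> > 0\<close> by (intro order_tendstoD) auto
    then obtain e where e: "0 < e" "e < 1" "\<mu> - \<eta> < (1 - e) ^ CARD('n) * (\<mu> - e)"
      by (rule eventually_at_right_0_obtain[of _ 1]) auto
    define l where "l = 1 - e"
    have l: "0 < l" "l < 1" using e by (auto simp: l_def)
    obtain I where I0: "finite I" "\<forall>K\<in>I. is_cube K" "\<forall>K\<in>I. K \<subseteq> interior J"
      "pairwise (\<lambda>A B. interior A \<inter> interior B = {}) I"
      and sumI: "\<mu> \<le> e + (\<Sum>K\<in>I. measure lebesgue K)"
      using jordan_cells[OF e(1)] unfolding \<mu>_def[symmetric] by (elim exE conjE) (rule that; assumption)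
    note I = I0(1) bspec[OF I0(2)] bspec[OF I0(3)] I0(4)
    \<comment> \<open>One predicate collects the data of a cell, so that a single choice provides
      them for all cells: the shrunk cell, its margin \<open>d\<close>, and a net \<open>T\<close>
      finer than the margin.\<close>
    define P where "P = (\<lambda>K K' (d::real) T. is_cube K' \<and> K' \<subseteq> interior K \<and>
      measure lebesgue K' = l ^ CARD('n) * measure lebesgue K \<and>
      finite T \<and> T \<noteq> {} \<and> (\<forall>x\<in>K'. \<forall>s. s \<notin> interior K \<longrightarrow> d \<le> dist x s) \<and>
      (\<forall>x\<in>K'. \<exists>t\<in>T. dist x (t :: real^'n) < d))"
    have "\<forall>K\<in>I. \<exists>K' d T. P K K' d T"
    proof
      fix K assume K: "K \<in> I"
      obtain K' where K': "is_cube K'" "K' \<subseteq> interior K" "measure lebesgue K' = l ^ CARD('n) * measure lebesgue K"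
        using shrunk_cube[OF I(2)[OF K] l] .
      have cK: "compact K'" using K'(1) by (auto simp: is_cube_def)
      obtain d where d: "d > 0" "\<And>x s. x \<in> K' \<Longrightarrow> s \<notin> interior K \<Longrightarrow> d \<le> dist x s"
        using compact_interior_margin[OF cK K'(2)] by blast
      obtain T where T: "finite T" "\<And>x. x \<in> K' \<Longrightarrow> \<exists>t\<in>T. dist x t < d"
        using compact_finite_net[OF cK d(1)] by blast
      have "K' \<noteq> {}" using is_cube_measure_pos[OF K'(1)] by force
      then have "T \<noteq> {}" using T(2) by blast
      then show "\<exists>K' d T. P K K' d T" 
        unfolding P_def using K' d T by (intro exI[of _ K'] exI[of _ d] exI[of _ T] conjI) auto
    qed
    then obtain K' d T where PK: "\<forall>K\<in>I. P K (K' K) (d K) (T K)"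
      unfolding bchoice_iff by blast
    note PK' = bspec[OF PK, unfolded P_def]
    have K': "is_cube (K' K)" "K' K \<subseteq> interior K"
      "measure lebesgue (K' K) = l ^ CARD('n) * measure lebesgue K" if "K \<in> I" for K
      using PK'[OF that] by simp_all
    have T: "finite (T K)" "T K \<noteq> {}" if "K \<in> I" for K
      using PK'[OF that] by simp_all
    have d: "s \<notin> interior K \<Longrightarrow> d K \<le> dist x s" "\<exists>t\<in>T K. dist x t < d K"
      if "K \<in> I" "x \<in> K' K" for K x s
      using PK'[OF that(1)] that(2) by simp_all
    define c where "c = (\<lambda>K. measure lebesgue (K' K))"
    have sumc: "\<mu> - \<eta> \<le> sum c I"
    proof -
      have "l ^ CARD('n) * (\<mu> - e) \<le> l ^ CARD('n) * (\<Sum>K\<in>I. measure lebesgue K)"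
        using sumI l by (intro mult_left_mono) auto
      also have "\<dots> = sum c I" unfolding c_def sum_distrib_left using K'(3) by simp
      finally show ?thesis using e(3) by (simp add: l_def)
    qed
    have low: "\<exists>k. (\<forall>K\<in>I. 1 \<le> k K) \<and> sum k I \<le> m + (\<Sum>K\<in>I. card (T K)) \<and>
        (\<delta> - \<eta>) * (\<Sum>K\<in>I. c K powr (1 + \<theta>) * real (k K) powr (- \<theta>)) \<le> integral J (\<lambda>x. infdist x S powr q)"
      if "S \<in> F m" for m S
    proof -
      have S: "finite S" "S \<noteq> {}" "card S \<le> m" using that by (auto simp: F_def)
      \<comment> \<open>\<open>V K\<close> replaces the points of \<open>S\<close> outside the
        interior of \<open>K\<close> by the net: from any place in the shrunk cell some net point is
        nearer than all of those. Interiors of cells are disjoint, so every point of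
        \<open>S\<close> is counted at most once.\<close>
      define V where "V = (\<lambda>K. (S \<inter> interior K) \<union> T K)"
      define k where "k = (\<lambda>K. card (S \<inter> interior K) + card (T K))"
      have V: "finite (V K)" "V K \<noteq> {}" "card (V K) \<le> k K" if "K \<in> I" for K
        unfolding V_def k_def using S T[OF that] by (auto intro: card_Un_le)
      have k1: "1 \<le> k K" if "K \<in> I" for K
        using T[OF that] by (simp add: k_def card_gt_0_iff Suc_le_eq)
      have "(\<Sum>K\<in>I. card (S \<inter> interior K)) = card (\<Union>K\<in>I. S \<inter> interior K)"
        using I(1,4) S by (intro card_UN_disjoint[symmetric]) (auto simp: pairwise_def)
      also have "\<dots> \<le> card S" using S by (intro card_mono) auto
      finally have ksum: "sum k I \<le> m + (\<Sum>K\<in>I. card (T K))"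
        using S unfolding k_def sum.distrib by linarith
      have cell: "\<delta> * c K powr (1 + \<theta>) * real (k K) powr (- \<theta>) \<le> integral (K' K) (\<lambda>x. infdist x S powr q)"
        if K: "K \<in> I" for K
      proof -
        have "\<delta> * c K powr (1 + \<theta>) * real (k K) powr (- \<theta>) \<le> integral (K' K) (\<lambda>x. infdist x (V K) powr q)"
          unfolding c_def using V[OF K] by (intro qerr_cube_ge K' K) auto
        also have "\<dots> \<le> integral (K' K) (\<lambda>x. infdist x S powr q)"
        proof (rule integral_le)
          fix x assume x: "x \<in> K' K"
          obtain s where s: "s \<in> S" "infdist x S = dist x s" using S by (rule_tac infdist_finite_attained)
          have "infdist x (V K) \<le> dist x s"
          proof (cases "s \<in> interior K")
            case True
            then show ?thesis using s by (intro infdist_le) (auto simp: V_def)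
          next
            case False
            obtain t where "t \<in> T K" "dist x t < d K" using d(2)[OF K x] by blast
            then show ?thesis
              using d(1)[OF K x False] by (intro infdist_le2[of t]) (auto simp: V_def)
          qed
          then show "infdist x (V K) powr q \<le> infdist x S powr q"
            using q s by (intro powr_mono2) (auto simp: infdist_nonneg)
        qed (use K'(1)[OF K] q in \<open>auto intro!: infdist_powr_integrable_on simp: is_cube_def\<close>)
        finally show ?thesis .
      qed
      have "(\<delta> - \<eta>) * (\<Sum>K\<in>I. c K powr (1 + \<theta>) * real (k K) powr (- \<theta>)) \<le>
          \<delta> * (\<Sum>K\<in>I. c K powr (1 + \<theta>) * real (k K) powr (- \<theta>))"
        using \<open>\<eta> > 0\<close> by (intro mult_right_mono sum_nonneg) auto
      also have "\<dots> = (\<Sum>K\<in>I. \<delta> * c K powr (1 + \<theta>) * real (k K) powr (- \<theta>))"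
        by (simp add: sum_distrib_left mult_ac)
      also have "\<dots> \<le> (\<Sum>K\<in>I. integral (K' K) (\<lambda>x. infdist x S powr q))"
        using cell by (rule sum_mono)
      also have "\<dots> \<le> integral J (\<lambda>x. infdist x S powr q)"
      proof (rule sum_integral_disjoint_le)
        show "K' K \<subseteq> J" if "K \<in> I" for K
          using K'(2)[OF that] I(3)[OF that] interior_subset by blast
        show "K' A \<inter> K' B = {}" if "A \<in> I" "B \<in> I" "A \<noteq> B" for A B
          using K'(2) that I(4) unfolding pairwise_def by blast
        show "(\<lambda>x. infdist x S powr q) integrable_on J"
          using q bJ Jm by (rule infdist_powr_integrable_on)
        show "(\<lambda>x. infdist x S powr q) integrable_on K' K" if "K \<in> I" for K
          using K'(1)[OF that] q by (auto intro!: infdist_powr_integrable_on simp: is_cube_def)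
      qed (use I in auto)
      finally show ?thesis using k1 ksum by (intro exI[of _ k]) blast
    qed
    show "\<exists>(I :: (real^'n) set set) c N. finite I \<and> (\<forall>K\<in>I. 0 < c K) \<and> measure lebesgue J - \<eta> \<le> sum c I \<and>
        (\<forall>m\<ge>1. \<forall>S\<in>F m. \<exists>k. (\<forall>K\<in>I. 1 \<le> k K) \<and> sum k I \<le> m + N \<and>
          (\<delta> - \<eta>) * (\<Sum>K\<in>I. c K powr (1 + \<theta>) * real (k K) powr (- \<theta>)) \<le> integral J (\<lambda>x. infdist x S powr q))"
    proof (intro exI[of _ I] exI[of _ c] exI[of _ "\<Sum>K\<in>I. card (T K)"] conjI ballI allI impI)
      show "measure lebesgue J - \<eta> \<le> sum c I" using sumc by (simp add: \<mu>_def)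
      show "0 < c K" if "K \<in> I" for K unfolding c_def using K'(1)[OF that] by (rule is_cube_measure_pos)
      show "\<exists>k. (\<forall>K\<in>I. 1 \<le> k K) \<and> sum k I \<le> m + (\<Sum>K\<in>I. card (T K)) \<and>
        (\<delta> - \<eta>) * (\<Sum>K\<in>I. c K powr (1 + \<theta>) * real (k K) powr (- \<theta>)) \<le> integral J (\<lambda>x. infdist x S powr q)"
        if "S \<in> F m" for m S using that by (rule low)
    qed (rule I(1))
  qed (use \<theta>_pos \<delta>(1) \<open>\<epsilon> > 0\<close> in \<open>auto intro: integral_infdist_nonneg\<close>)
  then show ?thesis unfolding F_def by (rule eventually_mono) blast
qed

text \<open>\<open>zador_upper\<close> uses points of \<open>J\<close> only and
  \<open>zador_lower\<close> admits all points, so the free and the constrained infimum have the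
  same limit.\<close>

lemma qerr_jordan_limit:
  assumes "J \<noteq> {}"
  shows "(\<lambda>k. real k powr \<theta> * qerr q J k) \<longlonglongrightarrow> \<delta> * measure lebesgue J powr (1 + \<theta>)"
  unfolding qerr_def
proof (rule tendsto_scaled_INF)
  fix \<epsilon> :: real assume "\<epsilon> > 0"
  show "\<forall>\<^sub>F m in sequentially. \<exists>S\<in>{S. finite S \<and> S \<noteq> {} \<and> card S \<le> m}.
      real m powr \<theta> * integral J (\<lambda>x. infdist x S powr q) \<le> \<delta> * measure lebesgue J powr (1 + \<theta>) + \<epsilon>"
    using zador_upper[OF assms \<open>\<epsilon> > 0\<close>] by (rule eventually_mono) blast
  show "\<forall>\<^sub>F m in sequentially. \<forall>S\<in>{S. finite S \<and> S \<noteq> {} \<and> card S \<le> m}.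
      \<delta> * measure lebesgue J powr (1 + \<theta>) - \<epsilon> \<le> real m powr \<theta> * integral J (\<lambda>x. infdist x S powr q)"
    using zador_lower[OF \<open>\<epsilon> > 0\<close>] by (rule eventually_mono) blast
qed (rule integral_infdist_nonneg)

lemma zador_limit:
  assumes "measure lebesgue J > 0"
  shows "(\<lambda>m. real m powr \<theta> * (INF S\<in>{S. S \<subseteq> J \<and> finite S \<and> card S = m}.
      integral J (\<lambda>x. Min ((\<lambda>s. norm (x - s) powr q) ` S)))) \<longlonglongrightarrow> \<delta> * measure lebesgue J powr (1 + \<theta>)"
proof -
  have bJ: "bounded J" using J by (simp add: compact_imp_bounded)
  have Jm: "J \<in> sets lebesgue" using J by (simp add: lmeasurable_compact fmeasurableD)
  have ne: "J \<noteq> {}" using assms by force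
  have inf: "infinite J" using assms negligible_finite negligible_iff_measure0 by (metis less_irrefl negligible_imp_measure0)
  define G where "G = (\<lambda>S. integral J (\<lambda>x. Min ((\<lambda>s. norm (x - s) powr q) ` S)))"
  \<comment> \<open>For \<open>m = 0\<close> the only candidate is the empty set, for which
    \<open>Min\<close> is unspecified; \<open>F 0\<close> is emptied so that \<open>G\<close> is
    nonnegative on every \<open>F m\<close>.\<close>
  define F where "F = (\<lambda>m. if m = 0 then {} else {S. S \<subseteq> J \<and> finite S \<and> card S = m})"
  have G: "G S = integral J (\<lambda>x. infdist x S powr q)" if "finite S" "S \<noteq> {}" for S
    unfolding G_def using Min_norm_powr_eq_infdist[OF that q] by simp
  have "(\<lambda>m. real m powr \<theta> * (INF S\<in>F m. G S)) \<longlonglongrightarrow> \<delta> * measure lebesgue J powr (1 + \<theta>)"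
  proof (rule tendsto_scaled_INF)
    fix \<epsilon> :: real assume "\<epsilon> > 0"
    show "\<forall>\<^sub>F m in sequentially. \<exists>S\<in>F m. real m powr \<theta> * G S \<le> \<delta> * measure lebesgue J powr (1 + \<theta>) + \<epsilon>"
      using zador_upper[OF ne \<open>\<epsilon> > 0\<close>] eventually_gt_at_top[of 0]
    proof eventually_elim
      case (elim m)
      then obtain S where S: "S \<subseteq> J" "finite S" "S \<noteq> {}" "card S \<le> m"
        and le: "real m powr \<theta> * integral J (\<lambda>x. infdist x S powr q) \<le> \<delta> * measure lebesgue J powr (1 + \<theta>) + \<epsilon>" by blast
      have "infinite (J - S)" using inf S by simp
      \<comment> \<open>\<open>zador_upper\<close> gives at most \<open>m\<close> points; padding to
        exactly \<open>m\<close> with points of the infinite set \<open>J\<close> cannot increase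
        distances.\<close>
      then obtain T where T: "T \<subseteq> J - S" "finite T" "card T = m - card S"
        using infinite_arbitrarily_large by metis
      have card: "card (S \<union> T) = m" using S T by (subst card_Un_disjoint) auto
      have "integral J (\<lambda>x. infdist x (S \<union> T) powr q) \<le> integral J (\<lambda>x. infdist x S powr q)"
        using S q bJ Jm
        by (intro integral_le infdist_powr_integrable_on powr_mono2 infdist_mono) (auto simp: infdist_nonneg)
      then have "real m powr \<theta> * G (S \<union> T) \<le> real m powr \<theta> * integral J (\<lambda>x. infdist x S powr q)"
        using G[of "S \<union> T"] S T by (intro mult_left_mono) auto
      moreover have "m \<noteq> 0" using elim by simp
      then have "S \<union> T \<in> F m" unfolding F_def using S T card by simp blast
      ultimately show ?case using le by (meson order_trans)
    qed
    show "\<forall>\<^sub>F m in sequentially. \<forall>S\<in>F m. \<delta> * measure lebesgue J powr (1 + \<theta>) - \<epsilon> \<le> real m powr \<theta> * G S"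
      using zador_lower[OF \<open>\<epsilon> > 0\<close>]
    proof (rule eventually_mono, intro ballI)
      fix m S
      assume all: "\<forall>S. finite S \<and> S \<noteq> {} \<and> card S \<le> m \<longrightarrow>
        \<delta> * measure lebesgue J powr (1 + \<theta>) - \<epsilon> \<le> real m powr \<theta> * integral J (\<lambda>x. infdist x S powr q)"
        and "S \<in> F m"
      then have S: "finite S" "S \<noteq> {}" "card S \<le> m" by (auto simp: F_def split: if_splits)
      with all G[OF S(1,2)] show "\<delta> * measure lebesgue J powr (1 + \<theta>) - \<epsilon> \<le> real m powr \<theta> * G S" by simp
    qed
  next
    fix k S assume "S \<in> F k"
    then have "finite S" "S \<noteq> {}" by (auto simp: F_def split: if_splits)
    then show "0 \<le> G S" by (simp add: G integral_infdist_nonneg)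
  qed
  moreover have "\<forall>\<^sub>F m in sequentially. real m powr \<theta> * (INF S\<in>F m. G S) = real m powr \<theta> *
      (INF S\<in>{S. S \<subseteq> J \<and> finite S \<and> card S = m}. integral J (\<lambda>x. Min ((\<lambda>s. norm (x - s) powr q) ` S)))"
    using eventually_gt_at_top[of 0] by eventually_elim (simp add: F_def G_def)
  ultimately show ?thesis by (rule Lim_transform_eventually)
qed

end

section \<open>Smooth convex functions\<close>

text \<open>Gram-Schmidt for the inner product \<open>x \<bullet> (A *v y)\<close>: the columns of
  \<open>C\<close> are orthonormal for it, so C^T A C = 1, and \<open>B\<close> is the inverse of
  \<open>C\<close>.\<close>

lemma posdef_factor:
  fixes A :: "real^'n^'n::finite"
  assumes sym: "transpose A = A" and pos: "\<And>h. h \<noteq> 0 \<Longrightarrow> h \<bullet> (A *v h) > 0"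
  shows "\<exists>B :: real^'n^'n. invertible B \<and> transpose B ** B = A"
proof -
  let ?ip = "\<lambda>x y. x \<bullet> (A *v y)"
  have sym': "?ip x y = ?ip y x" for x y
    by (metis dot_lmul_matrix inner_commute sym transpose_matrix_vector)
  have "\<exists>e :: 'n \<Rightarrow> real^'n. \<forall>i\<in>F. \<forall>j\<in>F. ?ip (e i) (e j) = (if i = j then 1 else 0)" for F :: "'n set"
    using finite[of F]
  proof (induction F rule: finite_induct)
    case empty
    then show ?case by simp
  next
    case (insert i0 F)
    then obtain e :: "'n \<Rightarrow> real^'n" where e: "\<And>i j. i \<in> F \<Longrightarrow> j \<in> F \<Longrightarrow> ?ip (e i) (e j) = (if i = j then 1 else 0)"
      by blast
    let ?S = "(\<lambda>j. A *v e j) ` F"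
    have "dim ?S \<le> card ?S" by (rule dim_le_card') simp
    also have "\<dots> \<le> card F" by (rule card_image_le) simp
    also have "\<dots> < card (insert i0 F)" using insert by simp
    also have "\<dots> \<le> CARD('n)" by (rule card_mono) auto
    finally have "dim ?S < DIM(real^'n)" by simp
    \<comment> \<open>Fewer than n vectors \<open>A *v e j\<close> leave a nonzero vector orthogonal
      to all of them, the next direction before normalization.\<close>
    then obtain x where x: "x \<noteq> 0" "\<And>y. y \<in> span ?S \<Longrightarrow> orthogonal x y"
      using orthogonal_to_subspace_exists by blast
    have x0: "?ip x (e j) = 0" if "j \<in> F" for j
      using x(2)[OF span_base, of "A *v e j"] that by (auto simp: orthogonal_def)
    define c where "c = 1 / sqrt (?ip x x)"
    have cc: "c * c * ?ip x x = 1"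
      using pos[OF x(1)] by (simp add: c_def)
    let ?e = "e(i0 := c *\<^sub>R x)"
    have "?ip (?e i) (?e j) = (if i = j then 1 else 0)" if "i \<in> insert i0 F" "j \<in> insert i0 F" for i j
    proof -
      have "?ip (c *\<^sub>R x) (c *\<^sub>R x) = 1"
        using cc by (simp add: matrix_vector_mult_scaleR mult.assoc)
      moreover have "?ip (c *\<^sub>R x) (e j) = 0" "?ip (e j) (c *\<^sub>R x) = 0" if "j \<in> F" for j
        using x0[OF that] sym' by (simp_all add: matrix_vector_mult_scaleR)
      ultimately show ?thesis
        using that insert(2) e by auto
    qed
    then show ?case by blast
  qed
  from this[of UNIV] obtain e :: "'n \<Rightarrow> real^'n" where e: "\<And>i j. ?ip (e i) (e j) = (if i = j then 1 else 0)"
    by blast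
  define C :: "real^'n^'n" where "C = (\<chi> r i. e i $ r)"
  have "transpose C ** (A ** C) = mat 1"
  proof (simp only: vec_eq_iff, intro allI)
    fix i j
    have "(A *v e j) $ k = (\<Sum>l\<in>UNIV. A $ k $ l * e j $ l)" for k
      by (simp add: matrix_vector_mult_def)
    then show "(transpose C ** (A ** C)) $ i $ j = mat 1 $ i $ j"
      using e[of i j] by (simp add: matrix_matrix_mult_def transpose_def C_def mat_def inner_vec_def)
  qed
  then have "invertible (A ** C)" and invT: "invertible (transpose C)"
    using matrix_left_right_inverse unfolding invertible_def by blast+
  then have invC: "invertible C"
    by (metis invertible_det_nz det_transpose)
  obtain B where CB: "C ** B = mat 1" "B ** C = mat 1"
    using invC unfolding invertible_def by blast
  have TB: "transpose B ** transpose C = mat 1"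
    by (metis CB(1) matrix_transpose_mul transpose_mat)
  have "A = (transpose B ** transpose C) ** A ** (C ** B)"
    by (simp add: CB TB)
  also have "\<dots> = transpose B ** (transpose C ** (A ** C)) ** B"
    by (simp add: matrix_mul_assoc)
  finally have "A = transpose B ** B"
    using \<open>transpose C ** (A ** C) = mat 1\<close> by simp
  moreover have "invertible B"
    using CB unfolding invertible_def by blast
  ultimately show ?thesis by metis
qed

lemma gram_quadratic_form:
  fixes B :: "real^'n^'n::finite"
  shows "h \<bullet> ((transpose B ** B) *v h) = (norm (B *v h))\<^sup>2"
proof -
  have "h \<bullet> ((transpose B ** B) *v h) = h \<bullet> (transpose B *v (B *v h))"
    by (simp add: matrix_vector_mul_assoc)
  also have "\<dots> = (B *v h) \<bullet> (B *v h)"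
    by (metis dot_lmul_matrix inner_commute transpose_matrix_vector)
  finally show ?thesis by (simp add: power2_norm_eq_inner)
qed

section \<open>Tangents, Taylor expansion and symmetry of the Hessian\<close>

lemma DERIV_along_line:
  assumes "(f has_derivative (\<lambda>h. G \<bullet> h)) (at (p + a *\<^sub>R h))"
  shows "((\<lambda>a. f (p + a *\<^sub>R h)) has_real_derivative G \<bullet> (h :: 'a::euclidean_space)) (at a)"
proof -
  have "((\<lambda>a. p + a *\<^sub>R h) has_derivative (\<lambda>d. d *\<^sub>R h)) (at a)"
    by (auto intro!: derivative_eq_intros)
  from has_derivative_compose[OF this assms]
  have "((\<lambda>a. f (p + a *\<^sub>R h)) has_derivative (\<lambda>d. G \<bullet> (d *\<^sub>R h))) (at a)" .
  then show ?thesis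
    unfolding has_field_derivative_def by (simp add: mult_commute_abs)
qed

lemma DERIV_inner_along_line:
  fixes g :: "real^'n::finite \<Rightarrow> real^'n"
  assumes "(g has_derivative (\<lambda>h. M *v h)) (at (p + a *\<^sub>R k))"
  shows "((\<lambda>a. g (p + a *\<^sub>R k) \<bullet> h) has_real_derivative (M *v k) \<bullet> h) (at a)"
proof -
  have "((\<lambda>a. p + a *\<^sub>R k) has_derivative (\<lambda>d. d *\<^sub>R k)) (at a)"
    by (auto intro!: derivative_eq_intros)
  from has_derivative_compose[OF this assms]
  have "((\<lambda>a. g (p + a *\<^sub>R k)) has_derivative (\<lambda>d. M *v (d *\<^sub>R k))) (at a)" .
  then have "((\<lambda>a. g (p + a *\<^sub>R k) \<bullet> h) has_derivative (\<lambda>d. (M *v (d *\<^sub>R k)) \<bullet> h)) (at a)"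
    by (rule has_derivative_inner_left)
  then show ?thesis
    unfolding has_field_derivative_def
    by (simp add: matrix_vector_mult_scaleR mult_commute_abs)
qed

locale smooth_convex =
  fixes X :: "(real^'n::finite) set" and v :: "real^'n \<Rightarrow> real"
    and g :: "real^'n \<Rightarrow> real^'n" and H :: "real^'n \<Rightarrow> real^'n^'n" and L :: real
  assumes X: "compact X" "convex X"
    and lip: "L-lipschitz_on X v" and conv: "convex_on X v"
    and der_v: "\<And>x. x \<in> interior X \<Longrightarrow> (v has_derivative (\<lambda>h. g x \<bullet> h)) (at x)"
    and der_g: "\<And>x. x \<in> interior X \<Longrightarrow> (g has_derivative (\<lambda>h. H x *v h)) (at x)"
    and posdef: "\<And>x h. x \<in> interior X \<Longrightarrow> h \<noteq> 0 \<Longrightarrow> h \<bullet> (H x *v h) > 0"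
    and contH: "continuous_on (interior X) H"
begin

abbreviation "U \<equiv> interior X"

lemma U_props: "open U" "convex U" "bounded U" "U \<subseteq> X" "U \<in> lmeasurable"
  using X by (auto simp: convex_interior compact_imp_bounded bounded_interior interior_subset lmeasurable_interior)

lemma continuous_v: "continuous_on X v"
  using lip by (rule lipschitz_on_continuous_on)

lemma continuous_quadratic: "continuous_on U (\<lambda>y. (H y *v k) \<bullet> h)"
  unfolding matrix_vector_mult_def inner_vec_def
  by (simp, intro continuous_intros contH)

text \<open>Only differentiability at \<open>s\<close> enters, through difference quotients from the
  right along the segment to \<open>x\<close>; so \<open>x\<close> may be a boundary point.\<close>

lemma tangent_le:
  assumes "s \<in> U" "x \<in> X"
  shows "v s + g s \<bullet> (x - s) \<le> v x"
proof -
  have sX: "s \<in> X" using assms U_props by blast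
  let ?q = "\<lambda>t. (v (s + t *\<^sub>R (x - s)) - v (s + 0 *\<^sub>R (x - s))) / (t - 0)"
  have "((\<lambda>t. v (s + t *\<^sub>R (x - s))) has_real_derivative g s \<bullet> (x - s)) (at 0)"
    using der_v[OF assms(1)] by (intro DERIV_along_line) simp
  then have "(?q \<longlongrightarrow> g s \<bullet> (x - s)) (at 0)"
    unfolding has_field_derivative_iff .
  then have lim: "(?q \<longlongrightarrow> g s \<bullet> (x - s)) (at_right 0)"
    by (rule filterlim_mono) (auto simp: at_le)
  have "\<forall>\<^sub>F t in at_right (0::real). t \<in> {0<..<1}"
    by (rule eventually_at_right_real) simp
  then have "\<forall>\<^sub>F t in at_right 0. ?q t \<le> v x - v s"
  proof eventually_elim
    case (elim t)
    then have t: "0 < t" "t < 1" by auto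
    have "v (s + t *\<^sub>R (x - s)) = v ((1 - t) *\<^sub>R s + t *\<^sub>R x)"
      by (simp add: algebra_simps)
    also have "\<dots> \<le> (1 - t) * v s + t * v x"
      using convex_onD[OF conv _ _ sX assms(2), of t] t by simp
    finally have "v (s + t *\<^sub>R (x - s)) - v s \<le> (v x - v s) * t"
      by (simp add: algebra_simps)
    then show ?case using t by (simp add: pos_divide_le_eq)
  qed
  then have "g s \<bullet> (x - s) \<le> v x - v s"
    using tendsto_upperbound[OF lim] by simp
  then show ?thesis by simp
qed

text \<open>A step from \<open>s\<close> in the direction \<open>g s\<close> raises \<open>v\<close>
  at least as much as the tangent and at most by \<open>L\<close> times its length.\<close>

lemma norm_gradient_le:
  assumes "s \<in> U"
  shows "norm (g s) \<le> L"
proof (cases "g s = 0")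
  case True
  then show ?thesis using lipschitz_on_nonneg[OF lip] by simp
next
  case False
  obtain e where e: "e > 0" "ball s e \<subseteq> U"
    using assms open_contains_ball[of U] U_props by blast
  define t where "t = e / (2 * norm (g s))"
  have t: "t > 0" using e False by (simp add: t_def)
  let ?x = "s + t *\<^sub>R g s"
  have "norm (t *\<^sub>R g s) = e / 2" using e False by (simp add: t_def)
  then have "?x \<in> U" using e by (intro subsetD[OF e(2)]) (simp add: dist_norm)
  then have x: "?x \<in> X" and s: "s \<in> X" using U_props assms by blast+
  have "t * (norm (g s) * norm (g s)) \<le> v ?x - v s"
    using tangent_le[OF assms x] by (simp add: inner_scaleR_right power2_norm_eq_inner flip: power2_eq_square)
  also have "\<dots> \<le> L * dist ?x s"
    using lipschitz_onD[OF lip x s] by (simp add: dist_real_def)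
  also have "\<dots> = t * (L * norm (g s))"
    using t by (simp add: dist_norm)
  finally show ?thesis using t False by simp
qed

text \<open>The intermediate point lies in \<open>K\<close>, so bounds for the Hessian on a cell
  apply to it.\<close>

lemma taylor2:
  assumes "convex K" "K \<subseteq> U" "s \<in> K" "x \<in> K"
  shows "\<exists>\<xi>\<in>K. v x = v s + g s \<bullet> (x - s) + ((x - s) \<bullet> (H \<xi> *v (x - s))) / 2"
proof -
  define h where "h = x - s"
  have inK: "s + t *\<^sub>R h \<in> K" if "0 \<le> t" "t \<le> 1" for t
  proof -
    have "s + t *\<^sub>R h = (1 - t) *\<^sub>R s + t *\<^sub>R x" by (simp add: h_def algebra_simps)
    then show ?thesis using convexD[OF assms(1,3,4), of "1 - t" t] that by simp
  qed
  define diff where "diff = (\<lambda>m::nat. if m = 0 then (\<lambda>t. v (s + t *\<^sub>R h)) else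
    if m = 1 then (\<lambda>t. g (s + t *\<^sub>R h) \<bullet> h) else (\<lambda>t. (H (s + t *\<^sub>R h) *v h) \<bullet> h))"
  have "\<exists>t. 0 < t \<and> t < 1 \<and> diff 0 1 = (\<Sum>m<2. diff m 0 / fact m * 1 ^ m) + diff 2 t / fact 2 * 1 ^ 2"
  proof (rule Maclaurin)
    show "\<forall>m t. m < 2 \<and> 0 \<le> t \<and> t \<le> 1 \<longrightarrow> (diff m has_real_derivative diff (Suc m) t) (at t)"
    proof (intro allI impI)
      fix m :: nat and t :: real assume a: "m < 2 \<and> 0 \<le> t \<and> t \<le> 1"
      then have "s + t *\<^sub>R h \<in> U" using inK assms(2) by blast
      note d = DERIV_along_line[OF der_v[OF this]] DERIV_inner_along_line[OF der_g[OF this], of h]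
      have "m = 0 \<or> m = 1" using a by auto
      then show "(diff m has_real_derivative diff (Suc m) t) (at t)"
        using d by (auto simp: diff_def)
    qed
  qed auto
  then obtain t where t: "0 < t" "t < 1" and eq: "diff 0 1 = (\<Sum>m<2. diff m 0 / fact m * 1 ^ m) + diff 2 t / fact 2 * 1 ^ 2"
    by blast
  have "(\<Sum>m<2. diff m 0 / fact m * 1 ^ m) = diff 0 0 + diff 1 0"
    by (simp add: numeral_2_eq_2)
  with eq have "v x = v s + g s \<bullet> h + ((H (s + t *\<^sub>R h) *v h) \<bullet> h) / 2"
    by (simp add: diff_def h_def)
  then show ?thesis
    using inK[of t] t unfolding h_def by (intro bexI[of _ "s + t *\<^sub>R h"]) (auto simp: h_def inner_commute)
qed

text \<open>Adding the expansions of \<open>v\<close> from \<open>y\<close> to \<open>x\<close> and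
  from \<open>x\<close> to \<open>y\<close> leaves two positive quadratic forms. The resulting
  injectivity of \<open>g\<close> serves both the integrability of \<open>det H\<close> and the
  count of minorants.\<close>

lemma gradient_strictly_monotone:
  assumes "x \<in> U" "y \<in> U" "x \<noteq> y"
  shows "(g x - g y) \<bullet> (x - y) > 0"
proof -
  obtain a where a: "a \<in> U" "v x = v y + g y \<bullet> (x - y) + ((x - y) \<bullet> (H a *v (x - y))) / 2"
    using taylor2[OF U_props(2) subset_refl assms(2,1)] by blast
  obtain b where b: "b \<in> U" "v y = v x + g x \<bullet> (y - x) + ((y - x) \<bullet> (H b *v (y - x))) / 2"
    using taylor2[OF U_props(2) subset_refl assms(1,2)] by blast
  have "(x - y) \<bullet> (H a *v (x - y)) > 0" "(y - x) \<bullet> (H b *v (y - x)) > 0"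
    using posdef a b assms by auto
  moreover have "g x \<bullet> (y - x) = - (g x \<bullet> (x - y))" by (simp add: inner_diff_right)
  moreover have "(g x - g y) \<bullet> (x - y) = g x \<bullet> (x - y) - g y \<bullet> (x - y)" by (rule inner_diff_left)
  ultimately show ?thesis using a(2) b(2) by linarith
qed

text \<open>The mean value theorem is applied in direction \<open>h\<close> to the difference of
  \<open>v\<close> on two parallel lines, then in direction \<open>k\<close> to the
  gradient.\<close>

lemma second_difference:
  assumes "t > 0" and box: "\<And>a b. 0 \<le> a \<Longrightarrow> a \<le> t \<Longrightarrow> 0 \<le> b \<Longrightarrow> b \<le> t \<Longrightarrow> x + a *\<^sub>R h + b *\<^sub>R k \<in> U"
  shows "\<exists>a b. 0 \<le> a \<and> a \<le> t \<and> 0 \<le> b \<and> b \<le> t \<and>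
    v (x + t *\<^sub>R h + t *\<^sub>R k) - v (x + t *\<^sub>R h) - v (x + t *\<^sub>R k) + v x =
    t * (t * ((H (x + a *\<^sub>R h + b *\<^sub>R k) *v k) \<bullet> h))"
proof -
  have "\<exists>a>0. a < t \<and> (v ((x + t *\<^sub>R k) + t *\<^sub>R h) - v (x + t *\<^sub>R h)) - (v ((x + t *\<^sub>R k) + 0 *\<^sub>R h) - v (x + 0 *\<^sub>R h)) =
      (t - 0) * (g ((x + t *\<^sub>R k) + a *\<^sub>R h) \<bullet> h - g (x + a *\<^sub>R h) \<bullet> h)"
  proof (rule MVT2[OF \<open>t > 0\<close>])
    fix a assume a: "0 \<le> a" "a \<le> t"
    have "x + t *\<^sub>R k + a *\<^sub>R h \<in> U" "x + a *\<^sub>R h \<in> U"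
      using box[OF a, of t] box[OF a, of 0] \<open>t > 0\<close> by (auto simp: add_ac)
    then show "((\<lambda>a. v (x + t *\<^sub>R k + a *\<^sub>R h) - v (x + a *\<^sub>R h)) has_real_derivative
        g (x + t *\<^sub>R k + a *\<^sub>R h) \<bullet> h - g (x + a *\<^sub>R h) \<bullet> h) (at a)"
      by (intro DERIV_diff DERIV_along_line der_v)
  qed
  then obtain a where a: "0 < a" "a < t" and ea: "(v ((x + t *\<^sub>R k) + t *\<^sub>R h) - v (x + t *\<^sub>R h)) - (v ((x + t *\<^sub>R k) + 0 *\<^sub>R h) - v (x + 0 *\<^sub>R h)) =
      (t - 0) * (g ((x + t *\<^sub>R k) + a *\<^sub>R h) \<bullet> h - g (x + a *\<^sub>R h) \<bullet> h)" by blast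
  have "\<exists>b>0. b < t \<and> g ((x + a *\<^sub>R h) + t *\<^sub>R k) \<bullet> h - g ((x + a *\<^sub>R h) + 0 *\<^sub>R k) \<bullet> h =
      (t - 0) * ((H ((x + a *\<^sub>R h) + b *\<^sub>R k) *v k) \<bullet> h)"
  proof (rule MVT2[OF \<open>t > 0\<close>])
    fix b assume "0 \<le> b" "b \<le> t"
    then have "x + a *\<^sub>R h + b *\<^sub>R k \<in> U" using box a by auto
    then show "((\<lambda>b. g (x + a *\<^sub>R h + b *\<^sub>R k) \<bullet> h) has_real_derivative (H (x + a *\<^sub>R h + b *\<^sub>R k) *v k) \<bullet> h) (at b)"
      by (intro DERIV_inner_along_line der_g)
  qed
  then obtain b where b: "0 < b" "b < t" and eb: "g ((x + a *\<^sub>R h) + t *\<^sub>R k) \<bullet> h - g ((x + a *\<^sub>R h) + 0 *\<^sub>R k) \<bullet> h =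
      (t - 0) * ((H ((x + a *\<^sub>R h) + b *\<^sub>R k) *v k) \<bullet> h)" by blast
  have sw: "x + t *\<^sub>R k + r *\<^sub>R h = x + r *\<^sub>R h + t *\<^sub>R k" for r by (simp add: add_ac)
  show ?thesis
    using a b ea eb unfolding sw by (intro exI[of _ a] exI[of _ b]) (simp add: algebra_simps)
qed

text \<open>Schwarz's theorem: the mixed second difference does not depend on the order of
  \<open>h\<close> and \<open>k\<close>, while \<open>second_difference\<close> expresses it by
  either mixed derivative at points near \<open>x\<close>. Symmetry is not part of
  \<open>C2_plus_on\<close>, but the factorization of \<open>H x\<close> needs it.\<close>

lemma hessian_symmetric:
  assumes x: "x \<in> U"
  shows "transpose (H x) = H x"
proof -
  have "(H x *v k) \<bullet> h = (H x *v h) \<bullet> k" for h k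
  proof (rule ccontr)
    assume ne: "(H x *v k) \<bullet> h \<noteq> (H x *v h) \<bullet> k"
    define e where "e = \<bar>(H x *v k) \<bullet> h - (H x *v h) \<bullet> k\<bar> / 2"
    have e: "e > 0" using ne by (simp add: e_def)
    have c: "isCont (\<lambda>y. (H y *v k) \<bullet> h) x" for h k
      using continuous_quadratic x U_props(1) by (simp add: continuous_on_eq_continuous_at)
    obtain d1 where d1: "d1 > 0" "\<And>y. dist y x < d1 \<Longrightarrow> dist ((H y *v k) \<bullet> h) ((H x *v k) \<bullet> h) < e"
      using c[of k h] e unfolding continuous_at_eps_delta by blast
    obtain d2 where d2: "d2 > 0" "\<And>y. dist y x < d2 \<Longrightarrow> dist ((H y *v h) \<bullet> k) ((H x *v h) \<bullet> k) < e"
      using c[of h k] e unfolding continuous_at_eps_delta by blast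
    obtain d3 where d3: "d3 > 0" "ball x d3 \<subseteq> U"
      using x open_contains_ball[of U] U_props by blast
    define d where "d = min d1 (min d2 d3)"
    \<comment> \<open>Small enough for the parallelogram spanned at \<open>x\<close> by the
      multiples of \<open>h\<close> and \<open>k\<close> with factor \<open>t\<close> to stay within
      distance \<open>d\<close> of \<open>x\<close>.\<close>
    define t where "t = d / (2 * (norm h + norm k + 1))"
    have d: "d > 0" using d1 d2 d3 by (simp add: d_def)
    have t: "t > 0" unfolding t_def using d by (intro divide_pos_pos) (auto intro: add_nonneg_pos)
    have near: "dist (x + a *\<^sub>R h + b *\<^sub>R k) x < d" if "0 \<le> a" "a \<le> t" "0 \<le> b" "b \<le> t" for a b
    proof -
      have "dist (x + a *\<^sub>R h + b *\<^sub>R k) x \<le> a * norm h + b * norm k"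
        using norm_triangle_ineq[of "a *\<^sub>R h" "b *\<^sub>R k"] that by (simp add: dist_norm algebra_simps)
      also have "\<dots> \<le> t * norm h + t * norm k"
        using that by (intro add_mono mult_right_mono) auto
      also have "\<dots> < t * (2 * (norm h + norm k + 1))"
        using t by (simp add: algebra_simps) (smt (verit) mult_nonneg_nonneg norm_ge_zero)
      also have "\<dots> = d"
      proof -
        have "norm h + norm k + 1 > 0" by (intro add_nonneg_pos) auto
        then show ?thesis by (simp add: t_def)
      qed
      finally show ?thesis .
    qed
    have near': "dist (x + a *\<^sub>R k + b *\<^sub>R h) x < d" if "0 \<le> a" "a \<le> t" "0 \<le> b" "b \<le> t" for a b
      using near[OF that(3,4,1,2)] by (simp add: add_ac)
    have inU: "y \<in> U" if "dist y x < d" for y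
      using that d3(2) by (auto simp: d_def dist_commute)
    obtain a b where ab: "0 \<le> a" "a \<le> t" "0 \<le> b" "b \<le> t"
      and e1: "v (x + t *\<^sub>R h + t *\<^sub>R k) - v (x + t *\<^sub>R h) - v (x + t *\<^sub>R k) + v x =
        t * (t * ((H (x + a *\<^sub>R h + b *\<^sub>R k) *v k) \<bullet> h))"
      using second_difference[OF t, of x h k] near inU by blast
    obtain a' b' where ab': "0 \<le> a'" "a' \<le> t" "0 \<le> b'" "b' \<le> t"
      and e2: "v (x + t *\<^sub>R k + t *\<^sub>R h) - v (x + t *\<^sub>R k) - v (x + t *\<^sub>R h) + v x =
        t * (t * ((H (x + a' *\<^sub>R k + b' *\<^sub>R h) *v h) \<bullet> k))"
      using second_difference[OF t, of x k h] near' inU by blast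
    have sw: "x + t *\<^sub>R k + t *\<^sub>R h = x + t *\<^sub>R h + t *\<^sub>R k" by (simp add: add_ac)
    have "t * (t * ((H (x + a *\<^sub>R h + b *\<^sub>R k) *v k) \<bullet> h)) = t * (t * ((H (x + a' *\<^sub>R k + b' *\<^sub>R h) *v h) \<bullet> k))"
      using e1 e2 unfolding sw by linarith
    then have eq: "(H (x + a *\<^sub>R h + b *\<^sub>R k) *v k) \<bullet> h = (H (x + a' *\<^sub>R k + b' *\<^sub>R h) *v h) \<bullet> k"
      using t by simp
    have "\<bar>(H (x + a *\<^sub>R h + b *\<^sub>R k) *v k) \<bullet> h - (H x *v k) \<bullet> h\<bar> < e"
      using d1(2)[of "x + a *\<^sub>R h + b *\<^sub>R k"] near[OF ab] by (simp add: d_def dist_real_def)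
    moreover have "\<bar>(H (x + a' *\<^sub>R k + b' *\<^sub>R h) *v h) \<bullet> k - (H x *v h) \<bullet> k\<bar> < e"
      using d2(2)[of "x + a' *\<^sub>R k + b' *\<^sub>R h"] near'[OF ab'] by (simp add: d_def dist_real_def)
    ultimately have "\<bar>(H x *v k) \<bullet> h - (H x *v h) \<bullet> k\<bar> < 2 * e"
      unfolding eq by linarith
    then show False by (simp add: e_def)
  qed
  note sym = this
  show ?thesis
  proof (simp only: vec_eq_iff, intro allI)
    fix i j
    have "(H x *v axis i 1) \<bullet> axis j 1 = (H x *v axis j 1) \<bullet> axis i 1" by (rule sym)
    then show "transpose (H x) $ i $ j = H x $ i $ j"
      by (simp add: transpose_def inner_axis matrix_vector_mul_component inner_axis')
  qed
qed

lemma partial_deriv_eq: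
  assumes "y \<in> U"
  shows "partial_deriv v j y = g y $ j"
proof -
  have "((\<lambda>t. v (y + t *\<^sub>R axis j 1)) has_real_derivative g y \<bullet> axis j 1) (at 0)"
    using der_v[OF assms] by (intro DERIV_along_line) simp
  then show ?thesis
    unfolding partial_deriv_def by (simp add: DERIV_imp_deriv inner_axis)
qed

text \<open>Differentiating \<open>partial_deriv v j\<close> in direction \<open>i\<close> gives the
  entry of \<open>H\<close> in row \<open>j\<close> and column \<open>i\<close>. The iterated
  partial derivatives thus form the transpose, which equals \<open>H x\<close> by symmetry.\<close>

lemma hessian_eq:
  assumes "x \<in> U"
  shows "hessian v x = H x"
proof -
  have "partial_deriv (\<lambda>y. partial_deriv v j y) i x = H x $ j $ i" for i j
  proof -
    have "((\<lambda>t. g (x + t *\<^sub>R axis i 1) \<bullet> axis j 1) has_real_derivative (H x *v axis i 1) \<bullet> axis j 1) (at 0)"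
      using der_g[OF assms] by (intro DERIV_inner_along_line) simp
    moreover have ev: "\<forall>\<^sub>F t in nhds 0. g (x + t *\<^sub>R axis i 1) \<bullet> axis j 1 = partial_deriv v j (x + t *\<^sub>R axis i 1)"
    proof -
      have "((\<lambda>t. x + t *\<^sub>R axis i (1::real)) \<longlongrightarrow> x + 0 *\<^sub>R axis i 1) (nhds 0)"
        by (intro tendsto_intros filterlim_ident)
      then have "\<forall>\<^sub>F t in nhds 0. x + t *\<^sub>R axis i (1::real) \<in> U"
        using U_props(1) assms by (intro topological_tendstoD) auto
      then show ?thesis by eventually_elim (simp add: partial_deriv_eq inner_axis)
    qed
    ultimately have "((\<lambda>t. partial_deriv v j (x + t *\<^sub>R axis i 1)) has_real_derivative (H x *v axis i 1) \<bullet> axis j 1) (at 0)"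
      using DERIV_cong_ev[OF refl ev refl] by blast
    then show ?thesis
      unfolding partial_deriv_def[of _ i] by (simp add: DERIV_imp_deriv inner_axis matrix_vector_mul_component inner_axis')
  qed
  then have "hessian v x = transpose (H x)"
    by (simp add: hessian_def transpose_def)
  then show ?thesis using hessian_symmetric[OF assms] by simp
qed

lemma hessian_factor:
  assumes "x \<in> U"
  shows "\<exists>B. invertible B \<and> (\<forall>h. h \<bullet> (H x *v h) = (norm (B *v h))\<^sup>2) \<and> det (H x) = (det B)\<^sup>2"
proof -
  obtain B :: "real^'n^'n" where B: "invertible B" "transpose B ** B = H x"
    using posdef_factor[of "H x"] hessian_symmetric[OF assms] posdef[OF assms] by blast
  have "det (H x) = (det B)\<^sup>2"
    unfolding B(2)[symmetric] by (simp add: det_mul det_transpose power2_eq_square)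
  then show ?thesis using B gram_quadratic_form[of _ B] by metis
qed

lemma det_hessian_pos: "x \<in> U \<Longrightarrow> det (H x) > 0"
  using hessian_factor invertible_det_nz by (metis zero_less_power2)

text \<open>The error is relative to |B h|^2 and uniform in \<open>h\<close>. This is possible
  because \<open>B\<close> is invertible, so that |h| \<le> M |B h|.\<close>

lemma hessian_almost_constant:
  assumes "x \<in> U" "\<epsilon> > 0" "invertible B" and B: "\<And>h. h \<bullet> (H x *v h) = (norm (B *v h))\<^sup>2"
  shows "\<forall>\<^sub>F y in nhds x. \<forall>h. \<bar>h \<bullet> (H y *v h) - (norm (B *v h))\<^sup>2\<bar> \<le> \<epsilon> * (norm (B *v h))\<^sup>2"
proof -
  obtain C where C: "C ** B = mat 1" using assms(3) invertible_def by blast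
  define M where "M = onorm ((*v) C)"
  have M: "norm h \<le> M * norm (B *v h)" for h
  proof -
    have "h = C *v (B *v h)" by (simp add: matrix_vector_mul_assoc C)
    then show ?thesis unfolding M_def by (metis onorm matrix_vector_mul_bounded_linear)
  qed
  have "isCont H x" using contH assms(1) U_props(1) by (simp add: continuous_on_eq_continuous_at)
  then have lim: "(H \<longlongrightarrow> H x) (nhds x)" by (simp add: isCont_def tendsto_at_iff_tendsto_nhds)
  define N where "N = (\<lambda>y. \<Sum>i\<in>UNIV. \<Sum>j\<in>UNIV. \<bar>H y $ i $ j - H x $ i $ j\<bar>)"
  have "(N \<longlongrightarrow> (\<Sum>i\<in>UNIV. \<Sum>j\<in>UNIV. \<bar>H x $ i $ j - H x $ i $ j\<bar>)) (nhds x)"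
    unfolding N_def by (intro tendsto_intros tendsto_vec_nth lim)
  then have "(N \<longlongrightarrow> 0) (nhds x)" by simp
  moreover have "\<epsilon> / (M\<^sup>2 + 1) > 0" using assms(2) by (simp add: add_nonneg_pos)
  ultimately have "\<forall>\<^sub>F y in nhds x. N y < \<epsilon> / (M\<^sup>2 + 1)"
    by (intro order_tendstoD)
  then show ?thesis
  proof eventually_elim
    case (elim y)
    show ?case
    proof
      fix h
      have "norm ((H y - H x) *v h) \<le> onorm ((*v) (H y - H x)) * norm h"
        by (rule onorm[OF matrix_vector_mul_bounded_linear])
      also have "\<dots> \<le> N y * norm h"
        unfolding N_def using onorm_le_matrix_component_sum[of "H y - H x"] by (intro mult_right_mono) auto
      finally have n1: "norm ((H y - H x) *v h) \<le> N y * norm h" .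
      have "h \<bullet> (H y *v h) - (norm (B *v h))\<^sup>2 = h \<bullet> ((H y - H x) *v h)"
        by (simp add: B[symmetric] matrix_vector_mult_diff_rdistrib inner_diff_right)
      also have "\<bar>\<dots>\<bar> \<le> norm h * norm ((H y - H x) *v h)" by (rule Cauchy_Schwarz_ineq2)
      also have "\<dots> \<le> norm h * (N y * norm h)" using n1 by (intro mult_left_mono) auto
      also have "\<dots> = N y * (norm h)\<^sup>2" by (simp add: power2_eq_square)
      also have "\<dots> \<le> \<epsilon> / (M\<^sup>2 + 1) * (M * norm (B *v h))\<^sup>2"
        using elim M[of h] assms(2) by (intro mult_mono power_mono) (auto simp: add_nonneg_pos)
      also have "\<dots> = \<epsilon> * (M\<^sup>2 / (M\<^sup>2 + 1)) * (norm (B *v h))\<^sup>2" by (simp add: power_mult_distrib)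
      also have "\<dots> \<le> \<epsilon> * 1 * (norm (B *v h))\<^sup>2"
        using assms(2) by (intro mult_right_mono mult_left_mono) (auto simp: divide_le_eq_1 add_nonneg_pos)
      finally show "\<bar>h \<bullet> (H y *v h) - (norm (B *v h))\<^sup>2\<bar> \<le> \<epsilon> * (norm (B *v h))\<^sup>2" by simp
    qed
  qed
qed

lemma det_hessian_integrable: "(\<lambda>x. det (H x)) absolutely_integrable_on U"
proof -
  have "(\<lambda>x. \<bar>det (matrix (\<lambda>h. H x *v h))\<bar>) absolutely_integrable_on U"
  proof (rule abs_det_integrable_inj)
    show "open U" by (rule U_props)
    show "(g has_derivative (\<lambda>h. H x *v h)) (at x)" if "x \<in> U" for x using that by (rule der_g)
    show "inj_on g U"
      using gradient_strictly_monotone by (intro inj_onI) force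
    show "bounded (g ` U)"
      using norm_gradient_le by (auto simp: bounded_iff)
  qed
  then show ?thesis
    by (rule set_integrable_cong[THEN iffD1, rotated -1])
       (use det_hessian_pos in \<open>auto simp: matrix_of_matrix_vector_mul abs_of_pos\<close>)
qed

end

section \<open>Tangents and affine minorants\<close>

lemma linear_image_integral_infdist:
  fixes B :: "real^'n^'n::finite"
  assumes "invertible B" "compact K" "q > 0"
  shows "integral ((*v) B ` K) (\<lambda>y. infdist y T powr q) = \<bar>det B\<bar> * integral K (\<lambda>x. infdist (B *v x) T powr q)"
proof -
  have lin: "linear ((*v) B)" by simp
  have "continuous_on K (\<lambda>x. infdist (B *v x) T powr q)"
    using \<open>q > 0\<close> lin
    by (intro continuous_on_powr' continuous_on_infdist linear_continuous_on continuous_on_const)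
       (auto simp: infdist_nonneg linear_conv_bounded_linear)
  then have "(\<lambda>x. infdist (B *v x) T powr q) absolutely_integrable_on K"
    using assms by (intro continuous_imp_absolutely_integrable_on[OF _ _ subset_refl]) (auto intro: fmeasurableD lmeasurable_compact)
  then show ?thesis
    using integral_linear_image[OF lin, where f = "\<lambda>y. infdist y T powr q" and S = K] by (simp add: o_def)
qed

lemma compact_linear_image_mat: "compact K \<Longrightarrow> compact ((*v) (B :: real^'n^'n::finite) ` K)"
  by (intro compact_continuous_image linear_continuous_on) (auto simp: linear_conv_bounded_linear[symmetric])

lemma measure_linear_image_mat:
  fixes B :: "real^'n^'n::finite"
  assumes "compact K"
  shows "measure lebesgue ((*v) B ` K) = \<bar>det B\<bar> * measure lebesgue K"
proof -
  have "(\<lambda>x. 1::real) absolutely_integrable_on K"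
    using assms by (simp add: absolutely_integrable_on_const lmeasurable_compact)
  then have "integral ((*v) B ` K) (\<lambda>x. 1::real) = \<bar>det B\<bar> * integral K (\<lambda>x. 1)"
    using integral_linear_image[where g = "(*v) B" and f = "\<lambda>x. 1" and S = K] by (simp add: o_def)
  then show ?thesis
    using assms compact_linear_image_mat[OF assms, of B] by (simp add: lmeasure_integral lmeasurable_compact)
qed

lemma continuous_on_Max_image:
  fixes f :: "'i \<Rightarrow> 'a::topological_space \<Rightarrow> real"
  assumes "finite A" "A \<noteq> {}" "\<And>i. i \<in> A \<Longrightarrow> continuous_on S (f i)"
  shows "continuous_on S (\<lambda>x. Max ((\<lambda>i. f i x) ` A))"
  using assms
proof (induction A rule: finite_ne_induct)
  case (insert i A)
  then have "continuous_on S (\<lambda>x. max (f i x) (Max ((\<lambda>i. f i x) ` A)))"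
    by (intro continuous_on_max) auto
  then show ?case using insert by simp
qed simp

lemma Pc_le: "l \<in> Pc k X v \<Longrightarrow> x \<in> X \<Longrightarrow> l x \<le> v x"
  by (auto simp: Pc_def)

lemma Pc_mono: "a \<le> b \<Longrightarrow> Pc a X v \<subseteq> Pc b X v"
  unfolding Pc_def by (fastforce intro: order_trans)

lemma Pc_continuous: "l \<in> Pc k X v \<Longrightarrow> continuous_on S l"
  unfolding Pc_def affine_fun_def by (auto intro!: continuous_on_Max_image continuous_intros)

lemma Pc_combine:
  assumes "l \<in> Pc a X v" "l' \<in> Pc b X v"
  shows "\<exists>l''\<in>Pc (a + b) X v. \<forall>x. l x \<le> l'' x \<and> l' x \<le> l'' x"
proof -
  obtain A where A: "finite A" "A \<noteq> {}" "card A \<le> a" "l = (\<lambda>x. Max ((\<lambda>ab. affine_fun ab x) ` A))" "\<forall>x\<in>X. l x \<le> v x"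
    using assms(1) unfolding Pc_def by blast
  obtain A' where A': "finite A'" "A' \<noteq> {}" "card A' \<le> b" "l' = (\<lambda>x. Max ((\<lambda>ab. affine_fun ab x) ` A'))" "\<forall>x\<in>X. l' x \<le> v x"
    using assms(2) unfolding Pc_def by blast
  define l'' where "l'' = (\<lambda>x. Max ((\<lambda>ab. affine_fun ab x) ` (A \<union> A')))"
  have eq: "l'' x = max (l x) (l' x)" for x
    unfolding l''_def A(4) A'(4) image_Un using A A' by (intro Max_Un) auto
  have "card (A \<union> A') \<le> a + b" using card_Un_le[of A A'] A A' by linarith
  then have "l'' \<in> Pc (a + b) X v"
    unfolding Pc_def mem_Collect_eq using A A' eq l''_def by (intro exI[of _ "A \<union> A'"]) auto
  then show ?thesis using eq by (intro bexI[of _ l'']) auto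
qed

context smooth_convex
begin

definition tangent :: "real^'n \<Rightarrow> (real^'n) \<times> real" where
  "tangent s = (g s, v s - g s \<bullet> s)"

lemma affine_tangent: "affine_fun (tangent s) x = v s + g s \<bullet> (x - s)"
  by (simp add: affine_fun_def tangent_def inner_diff_right)

lemma tangents_Pc:
  assumes "finite S" "S \<noteq> {}" "S \<subseteq> U" "card S \<le> k"
  shows "\<exists>l\<in>Pc k X v. \<forall>x. \<forall>s\<in>S. v s + g s \<bullet> (x - s) \<le> l x"
proof -
  define l where "l = (\<lambda>x. Max ((\<lambda>ab. affine_fun ab x) ` tangent ` S))"
  have le: "affine_fun (tangent s) x \<le> v x" if "s \<in> S" "x \<in> X" for s x
    unfolding affine_tangent using tangent_le that assms by blast
  have "l \<in> Pc k X v"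
    unfolding Pc_def mem_Collect_eq
  proof (intro exI[of _ "tangent ` S"] conjI ballI)
    show "l = (\<lambda>x. Max ((\<lambda>ab. affine_fun ab x) ` tangent ` S))" by (rule l_def)
    show "card (tangent ` S) \<le> k" using assms by (meson card_image_le order_trans)
    show "l x \<le> v x" if "x \<in> X" for x
      unfolding l_def using assms le[OF _ that] by (subst Max_le_iff) auto
  qed (use assms in auto)
  moreover have "v s + g s \<bullet> (x - s) \<le> l x" if "s \<in> S" for s x
    unfolding l_def affine_tangent[symmetric] using assms that by (intro Max_ge) auto
  ultimately show ?thesis by blast
qed

text \<open>Dudley's argument: the map \<open>x \<mapsto> x + g x\<close> controls both \<open>x\<close> and the gradient, so a net
  of its image yields tangents that are quadratically accurate, uniformly up to the boundary.\<close>

lemma uniform_approximation: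
  assumes "U \<noteq> {}"
  shows "\<exists>R>0. \<forall>k\<ge>1. \<exists>l\<in>Pc k X v. \<forall>x\<in>U. v x - l x \<le> R * real k powr (- 2 / real CARD('n))"
proof -
  define \<Phi> where "\<Phi> = (\<lambda>x. x + g x)"
  obtain b where b: "\<And>x. x \<in> U \<Longrightarrow> norm x \<le> b" using U_props(3) unfolding bounded_iff by blast
  have "norm (\<Phi> x) \<le> b + L" if "x \<in> U" for x
    unfolding \<Phi>_def using b[OF that] norm_gradient_le[OF that] by (rule norm_triangle_mono)
  then have "bounded (\<Phi> ` U)" unfolding bounded_iff by blast
  then obtain R where R: "R > 0" and net: "\<And>k. k \<ge> 1 \<Longrightarrow> \<exists>T. T \<subseteq> \<Phi> ` U \<and> finite T \<and> T \<noteq> {} \<and> card T \<le> k \<and>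
    (\<forall>z\<in>\<Phi> ` U. \<exists>t\<in>T. dist z t \<le> R * real k powr (- 1 / real CARD('n)))"
    using bounded_net[of "\<Phi> ` U"] assms by blast
  show ?thesis
  proof (intro exI[of _ "R\<^sup>2"] conjI allI impI)
    show "R\<^sup>2 > 0" using R by simp
    fix k :: nat assume "k \<ge> 1"
    from net[OF this] obtain T where T: "T \<subseteq> \<Phi> ` U" "finite T" "T \<noteq> {}" "card T \<le> k"
      and near: "\<And>z. z \<in> \<Phi> ` U \<Longrightarrow> \<exists>t\<in>T. dist z t \<le> R * real k powr (- 1 / real CARD('n))" by blast
    define S where "S = inv_into U \<Phi> ` T"
    have "S \<subseteq> U" unfolding S_def using T(1) by (auto intro: inv_into_into)
    moreover have "card S \<le> k" unfolding S_def using T by (meson card_image_le order_trans)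
    ultimately obtain l where l: "l \<in> Pc k X v" "\<And>x s. s \<in> S \<Longrightarrow> v s + g s \<bullet> (x - s) \<le> l x"
      using tangents_Pc[of S k] T unfolding S_def by blast
    show "\<exists>l\<in>Pc k X v. \<forall>x\<in>U. v x - l x \<le> R\<^sup>2 * real k powr (- 2 / real CARD('n))"
    proof (intro bexI[OF _ l(1)] ballI)
      fix x assume x: "x \<in> U"
      obtain t where t: "t \<in> T" "dist (\<Phi> x) t \<le> R * real k powr (- 1 / real CARD('n))"
        using near x by blast
      define s where "s = inv_into U \<Phi> t"
      have s: "s \<in> S" "s \<in> U" "\<Phi> s = t"
        using t T(1) unfolding s_def S_def by (auto intro: inv_into_into f_inv_into_f)
      have "v x - l x \<le> v x - v s - g s \<bullet> (x - s)" using l(2)[OF s(1), of x] by simp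
      also have "\<dots> \<le> (g x - g s) \<bullet> (x - s)"
        using tangent_le[OF x, of s] s(2) U_props(4) by (auto simp: inner_diff_left inner_diff_right)
      \<comment> \<open>With a = x - s and b = g x - g s, monotonicity gives a \<bullet> b \<ge> 0,
        so |a + b|^2 = |a|^2 + 2 a \<bullet> b + |b|^2 is at least a \<bullet> b.\<close>
      also have "\<dots> \<le> (norm ((x - s) + (g x - g s)))\<^sup>2"
      proof -
        have "(norm ((x - s) + (g x - g s)))\<^sup>2 = (norm (x - s))\<^sup>2 + 2 * ((x - s) \<bullet> (g x - g s)) + (norm (g x - g s))\<^sup>2"
          by (simp add: power2_norm_eq_inner inner_add_left inner_add_right inner_commute)
        moreover have "0 \<le> (g x - g s) \<bullet> (x - s)"
          using gradient_strictly_monotone[OF x s(2)] by (cases "x = s") auto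
        ultimately show ?thesis by (simp add: inner_commute[of "x - s"])
      qed
      also have "\<dots> = (dist (\<Phi> x) t)\<^sup>2"
        unfolding s(3)[symmetric] \<Phi>_def dist_norm by (simp add: algebra_simps)
      also have "\<dots> \<le> (R * real k powr (- 1 / real CARD('n)))\<^sup>2"
        using t(2) by (intro power_mono) auto
      also have "\<dots> = R\<^sup>2 * real k powr (- 2 / real CARD('n))"
      proof -
        have "(real k powr (- 1 / real CARD('n)))\<^sup>2 = real k powr (- 1 / real CARD('n) + - 1 / real CARD('n))"
          unfolding powr_add by (rule power2_eq_square)
        then show ?thesis by (simp add: power_mult_distrib flip: add_divide_distrib)
      qed
      finally show "v x - l x \<le> R\<^sup>2 * real k powr (- 2 / real CARD('n))" .
    qed
  qed
qed

section \<open>Minimizers of the gap to an affine function\<close>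

lemma minimizer_first_order:
  assumes K: "convex K" "K \<subseteq> U" and s: "s \<in> K" "x \<in> K"
    and min: "\<And>y. y \<in> K \<Longrightarrow> v s - a \<bullet> s \<le> v y - a \<bullet> y"
  shows "0 \<le> (g s - a) \<bullet> (x - s)"
proof -
  let ?q = "\<lambda>t. (v (s + t *\<^sub>R (x - s)) - v (s + 0 *\<^sub>R (x - s))) / (t - 0)"
  have "((\<lambda>t. v (s + t *\<^sub>R (x - s))) has_real_derivative g s \<bullet> (x - s)) (at 0)"
    using der_v[of s] s K by (intro DERIV_along_line) auto
  then have "(?q \<longlongrightarrow> g s \<bullet> (x - s)) (at 0)"
    unfolding has_field_derivative_iff .
  then have lim: "(?q \<longlongrightarrow> g s \<bullet> (x - s)) (at_right 0)"
    by (rule filterlim_mono) (auto simp: at_le)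
  have "\<forall>\<^sub>F t in at_right (0::real). t \<in> {0<..<1}"
    by (rule eventually_at_right_real) simp
  then have "\<forall>\<^sub>F t in at_right 0. a \<bullet> (x - s) \<le> ?q t"
  proof eventually_elim
    case (elim t)
    then have t: "0 < t" "t < 1" by auto
    have "s + t *\<^sub>R (x - s) = (1 - t) *\<^sub>R s + t *\<^sub>R x" by (simp add: algebra_simps)
    then have "s + t *\<^sub>R (x - s) \<in> K" using convexD[OF K(1) s, of "1 - t" t] t by simp
    from min[OF this] have "a \<bullet> (x - s) * t \<le> v (s + t *\<^sub>R (x - s)) - v s"
      by (simp add: inner_add_right algebra_simps)
    then show ?case using t by (simp add: pos_le_divide_eq)
  qed
  then have "a \<bullet> (x - s) \<le> g s \<bullet> (x - s)"
    using tendsto_lowerbound[OF lim] by simp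
  then show ?thesis by (simp add: inner_diff_left)
qed

text \<open>Otherwise a step from \<open>s\<close> against \<open>g s - a\<close> would contradict
  the first-order condition.\<close>

lemma interior_minimizer_gradient:
  assumes K: "convex K" "K \<subseteq> U" and s: "s \<in> interior K"
    and min: "\<And>y. y \<in> K \<Longrightarrow> v s - a \<bullet> s \<le> v y - a \<bullet> y"
  shows "g s = a"
proof (rule ccontr)
  assume ne: "g s \<noteq> a"
  obtain e where e: "e > 0" "cball s e \<subseteq> K"
    using s by (meson mem_interior_cball)
  define u where "u = g s - a"
  define x where "x = s - (e / norm u) *\<^sub>R u"
  have "x \<in> K" using e ne by (intro subsetD[OF e(2)]) (simp add: x_def dist_norm u_def)
  moreover have "s \<in> K" using s interior_subset by blast
  ultimately have "0 \<le> u \<bullet> (x - s)"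
    unfolding u_def using minimizer_first_order[OF K _ _ min] by blast
  moreover have "u \<bullet> (x - s) = - (e * norm u)"
    using ne by (simp add: x_def u_def flip: power2_norm_eq_inner) (simp add: power2_eq_square)
  ultimately show False using e ne by (simp add: u_def mult_le_0_iff)
qed

text \<open>An affine minorant need not touch \<open>v\<close>, so growth is measured from the
  minimizer \<open>s\<close> of the gap instead of a point of contact. The gap at \<open>s\<close>
  and the first-order term are nonnegative, and the Hessian supplies the quadratic growth. The
  minimizer may lie on the boundary of \<open>K\<close>.\<close>

lemma gap_at_minimizer:
  assumes K: "convex K" "K \<subseteq> U" and s: "s \<in> K" "x \<in> K"
    and min: "\<And>y. y \<in> K \<Longrightarrow> v s - a \<bullet> s \<le> v y - a \<bullet> y"
    and nonneg: "0 \<le> v s - (a \<bullet> s + c)"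
    and lower: "\<And>y h. y \<in> K \<Longrightarrow> \<kappa> * (norm (B *v h))\<^sup>2 \<le> h \<bullet> (H y *v h)"
  shows "\<kappa> / 2 * (norm (B *v (x - s)))\<^sup>2 \<le> v x - (a \<bullet> x + c)"
proof -
  obtain \<xi> where \<xi>: "\<xi> \<in> K" "v x = v s + g s \<bullet> (x - s) + ((x - s) \<bullet> (H \<xi> *v (x - s))) / 2"
    using taylor2[OF K s] by blast
  have "0 \<le> (g s - a) \<bullet> (x - s)" by (rule minimizer_first_order[OF K s min])
  moreover have "(g s - a) \<bullet> (x - s) = g s \<bullet> (x - s) - (a \<bullet> x - a \<bullet> s)"
    by (simp add: inner_diff_left inner_diff_right)
  moreover have "\<kappa> / 2 * (norm (B *v (x - s)))\<^sup>2 = (\<kappa> * (norm (B *v (x - s)))\<^sup>2) / 2" by simp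
  ultimately show ?thesis
    using \<xi>(2) lower[OF \<xi>(1), of "x - s"] nonneg by linarith
qed

end

section \<open>Upper bound for the approximation error\<close>

text \<open>\<open>W x\<close> stands for the weight at the point of the graph above
  \<open>x\<close>. The quantization limit is assumed for general compact sets with negligible
  frontier, since it is applied to linear images of cubes.\<close>

locale weighted_smooth_convex = smooth_convex X v g H L
  for X :: "(real^'n::finite) set" and v g H L +
  fixes p \<theta> \<delta> :: real and W :: "real^'n \<Rightarrow> real"
  assumes p: "p > 0" and \<theta>: "\<theta> = 2 * p / real CARD('n)"
    and W: "continuous_on X W" "\<And>x. x \<in> X \<Longrightarrow> W x > 0"
    and \<delta>: "\<delta> \<ge> 0"
    and zador: "\<And>J :: (real^'n) set. compact J \<Longrightarrow> negligible (frontier J) \<Longrightarrow> J \<noteq> {} \<Longrightarrow>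
      (\<lambda>k. real k powr \<theta> * qerr (2 * p) J k) \<longlonglongrightarrow> \<delta> * measure lebesgue J powr (1 + \<theta>)"
begin

lemma \<theta>_pos: "\<theta> > 0" using p \<theta> by simp

definition \<alpha> :: real where "\<alpha> = \<theta> / (1 + \<theta>)"
definition \<beta> :: real where "\<beta> = 1 / (1 + \<theta>)"

lemma \<alpha>\<beta>: "0 < \<alpha>" "\<alpha> < 1" "0 < \<beta>" "\<alpha> * (1 + \<theta>) = \<theta>" "\<beta> * (1 + \<theta>) = 1"
  using \<theta>_pos by (auto simp: \<alpha>_def \<beta>_def)

text \<open>The integrand of the limit: \<alpha> / 2 = p / (n + 2 p) and \<beta> = n / (n + 2 p).
  The half comes from det H = (det B)^2.\<close>

definition \<phi> :: "real^'n \<Rightarrow> real" where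
  "\<phi> x = det (H x) powr (\<alpha> / 2) * W x powr \<beta>"

text \<open>The allocation weight of a cell on which \<open>W\<close> is frozen at \<open>w\<close>
  and the quadratic form at |B h|^2. Its power 1 + \<theta>, computed in
  \<open>cell_const_powr\<close>, is the constant in the asymptotic error up to the factor \<delta>
  / 2^p.\<close>

definition cell_const :: "real \<Rightarrow> real^'n^'n \<Rightarrow> (real^'n) set \<Rightarrow> real" where
  "cell_const w B K = w powr \<beta> * \<bar>det B\<bar> powr \<alpha> * measure lebesgue K"

lemma cell_const_powr:
  assumes "w > 0"
  shows "cell_const w B K powr (1 + \<theta>) = w * \<bar>det B\<bar> powr \<theta> * measure lebesgue K powr (1 + \<theta>)"
  unfolding cell_const_def powr_mult powr_powr \<alpha>\<beta> using assms by simp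

lemma W_bound: "\<exists>b>0. \<forall>x\<in>X. W x \<le> b"
proof -
  have "bounded (W ` X)"
    using W(1) X(1) by (simp add: compact_continuous_image compact_imp_bounded)
  then obtain b where "b > 0" "\<forall>y\<in>W ` X. norm y \<le> b" unfolding bounded_pos by blast
  then show ?thesis by (intro exI[of _ b]) (auto simp: abs_le_iff)
qed

lemma continuous_det: "continuous_on U (\<lambda>x. det (H x))"
  unfolding det_def by (intro continuous_intros contH)

lemma continuous_\<phi>: "continuous_on U \<phi>"
  unfolding \<phi>_def
proof (intro continuous_intros continuous_det)
  show "continuous_on U W" using W(1) U_props(4) continuous_on_subset by blast
  show "\<forall>x\<in>U. W x \<noteq> 0" using W(2) U_props(4) by force
  show "\<forall>x\<in>U. det (H x) \<noteq> 0" using det_hessian_pos by force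
qed

lemma \<phi>_pos: "x \<in> U \<Longrightarrow> \<phi> x > 0"
  unfolding \<phi>_def using det_hessian_pos[of x] W(2)[of x] U_props(4) by (intro mult_pos_pos) auto

text \<open>The exponent \<alpha> / 2 is below 1, so det^(\<alpha>/2) \<le> 1 + det, and the
  integrable determinant dominates \<phi>, which may be unbounded.\<close>

lemma \<phi>_integrable: "\<phi> absolutely_integrable_on U"
proof -
  obtain b where b: "b > 0" "\<And>x. x \<in> X \<Longrightarrow> W x \<le> b" using W_bound by blast
  have Ul: "U \<in> sets lebesgue" using U_props(5) by (rule fmeasurableD)
  show ?thesis
  proof (rule measurable_bounded_by_integrable_imp_absolutely_integrable)
    show "\<phi> \<in> borel_measurable (lebesgue_on U)"
      using continuous_\<phi> Ul by (rule continuous_imp_measurable_on_sets_lebesgue)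
    have "(\<lambda>x. det (H x)) integrable_on U"
      using det_hessian_integrable absolutely_integrable_on_def by blast
    moreover have "(\<lambda>x. 1::real) integrable_on U"
      using U_props(5) by (rule integrable_on_const)
    ultimately show "(\<lambda>x. b powr \<beta> * (1 + det (H x))) integrable_on U"
      by (intro integrable_on_mult_right integrable_add)
    fix x assume x: "x \<in> U"
    have d: "det (H x) > 0" by (rule det_hessian_pos[OF x])
    have "det (H x) powr (\<alpha> / 2) \<le> 1 + det (H x)"
    proof (cases "det (H x) \<le> 1")
      case True
      then have "det (H x) powr (\<alpha> / 2) \<le> 1" using d \<alpha>\<beta> by (intro powr_le1) auto
      then show ?thesis using d by linarith
    next
      case False
      then have "det (H x) powr (\<alpha> / 2) \<le> det (H x) powr 1" using \<alpha>\<beta> by (intro powr_mono) auto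
      then show ?thesis using d by simp
    qed
    moreover have "W x powr \<beta> \<le> b powr \<beta>"
      using b(2)[of x] W(2)[of x] x U_props(4) \<alpha>\<beta>(3) by (intro powr_mono2) (auto simp: less_imp_le)
    ultimately have "\<phi> x \<le> (1 + det (H x)) * b powr \<beta>"
      unfolding \<phi>_def using d by (intro mult_mono) auto
    then show "norm (\<phi> x) \<le> b powr \<beta> * (1 + det (H x))"
      using \<phi>_pos[OF x] by (simp add: mult.commute)
  qed (rule Ul)
qed

text \<open>\<open>B\<close> and \<open>w\<close> stand for the data at one reference point. All
  deviations are relative, so they become factors 1 - \<eta> and 1 + \<eta> in the cell errors,
  however large the Hessian is.\<close>

definition good_cell :: "real \<Rightarrow> (real^'n) set \<Rightarrow> real^'n^'n \<Rightarrow> real \<Rightarrow> bool" where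
  "good_cell \<eta> K B w \<longleftrightarrow> is_cube K \<and> K \<subseteq> U \<and> invertible B \<and> w > 0 \<and>
    (\<forall>y\<in>K. (1 - \<eta>) * w \<le> W y \<and> W y \<le> (1 + \<eta>) * w) \<and>
    (\<forall>y\<in>K. \<forall>h. (1 - \<eta>) * (norm (B *v h))\<^sup>2 \<le> h \<bullet> (H y *v h) \<and> h \<bullet> (H y *v h) \<le> (1 + \<eta>) * (norm (B *v h))\<^sup>2) \<and>
    (1 - \<eta>) * cell_const w B K \<le> integral K \<phi> \<and> integral K \<phi> \<le> (1 + \<eta>) * cell_const w B K"

lemma good_cell_neighbourhood:
  assumes x: "x \<in> U" and "\<eta> > 0"
  shows "\<exists>N B. open N \<and> x \<in> N \<and> (\<forall>K. is_cube K \<longrightarrow> K \<subseteq> U \<longrightarrow> K \<subseteq> N \<longrightarrow> good_cell \<eta> K B (W x))"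
proof -
  obtain B where B: "invertible B" "\<And>h. h \<bullet> (H x *v h) = (norm (B *v h))\<^sup>2" "det (H x) = (det B)\<^sup>2"
    using hessian_factor[OF x] by blast
  have xX: "x \<in> X" using x U_props(4) by blast
  have Wx: "W x > 0" using W(2)[OF xX] .
  have "\<phi> x = W x powr \<beta> * \<bar>det B\<bar> powr \<alpha>"
  proof -
    have "(det B)\<^sup>2 = \<bar>det B\<bar> powr 2" using B(1) by (simp add: invertible_det_nz powr_numeral)
    then have "(det B)\<^sup>2 powr (\<alpha> / 2) = \<bar>det B\<bar> powr (2 * (\<alpha> / 2))"
      by (simp only: powr_powr)
    then show ?thesis unfolding \<phi>_def B(3) by (simp add: mult.commute)
  qed
  then have cc: "cell_const (W x) B K = \<phi> x * measure lebesgue K" for K by (simp add: cell_const_def)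
  have "isCont W x" "isCont \<phi> x"
    using continuous_on_interior[OF W(1) x] continuous_\<phi> x U_props(1) by (auto simp: continuous_on_eq_continuous_at)
  then have lim: "(W \<longlongrightarrow> W x) (nhds x)" "(\<phi> \<longlongrightarrow> \<phi> x) (nhds x)"
    by (simp_all add: isCont_def tendsto_at_iff_tendsto_nhds)
  have \<phi>x: "\<phi> x > 0" by (rule \<phi>_pos[OF x])
  have "\<forall>\<^sub>F y in nhds x. (1 - \<eta>) * W x < W y" "\<forall>\<^sub>F y in nhds x. W y < (1 + \<eta>) * W x"
    "\<forall>\<^sub>F y in nhds x. (1 - \<eta>) * \<phi> x < \<phi> y" "\<forall>\<^sub>F y in nhds x. \<phi> y < (1 + \<eta>) * \<phi> x"
  proof -
    have "(1 - \<eta>) * W x < W x" "W x < (1 + \<eta>) * W x" "(1 - \<eta>) * \<phi> x < \<phi> x" "\<phi> x < (1 + \<eta>) * \<phi> x"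
      using Wx \<phi>x \<open>\<eta> > 0\<close> by (simp_all add: algebra_simps)
    note ineq = this
    show "\<forall>\<^sub>F y in nhds x. (1 - \<eta>) * W x < W y" by (rule order_tendstoD(1)[OF lim(1) ineq(1)])
    show "\<forall>\<^sub>F y in nhds x. W y < (1 + \<eta>) * W x" by (rule order_tendstoD(2)[OF lim(1) ineq(2)])
    show "\<forall>\<^sub>F y in nhds x. (1 - \<eta>) * \<phi> x < \<phi> y" by (rule order_tendstoD(1)[OF lim(2) ineq(3)])
    show "\<forall>\<^sub>F y in nhds x. \<phi> y < (1 + \<eta>) * \<phi> x" by (rule order_tendstoD(2)[OF lim(2) ineq(4)])
  qed
  with hessian_almost_constant[OF x \<open>\<eta> > 0\<close> B(1,2)]
  have "\<forall>\<^sub>F y in nhds x. (\<forall>h. \<bar>h \<bullet> (H y *v h) - (norm (B *v h))\<^sup>2\<bar> \<le> \<eta> * (norm (B *v h))\<^sup>2) \<and>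
      (1 - \<eta>) * W x < W y \<and> W y < (1 + \<eta>) * W x \<and> (1 - \<eta>) * \<phi> x < \<phi> y \<and> \<phi> y < (1 + \<eta>) * \<phi> x"
    by (intro eventually_conj)
  then obtain N where N: "open N" "x \<in> N"
    and NH: "\<And>y h. y \<in> N \<Longrightarrow> \<bar>h \<bullet> (H y *v h) - (norm (B *v h))\<^sup>2\<bar> \<le> \<eta> * (norm (B *v h))\<^sup>2"
    and NW: "\<And>y. y \<in> N \<Longrightarrow> (1 - \<eta>) * W x < W y \<and> W y < (1 + \<eta>) * W x"
    and N\<phi>: "\<And>y. y \<in> N \<Longrightarrow> (1 - \<eta>) * \<phi> x < \<phi> y \<and> \<phi> y < (1 + \<eta>) * \<phi> x"
    unfolding eventually_nhds by blast
  have "good_cell \<eta> K B (W x)" if K: "is_cube K" "K \<subseteq> U" "K \<subseteq> N" for K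
  proof -
    have Km: "K \<in> lmeasurable" by (rule is_cube_lmeasurable[OF K(1)])
    have \<phi>K: "\<phi> integrable_on K"
      using set_integrable_subset[OF \<phi>_integrable fmeasurableD[OF Km] K(2)] absolutely_integrable_on_def by blast
    have up: "integral K \<phi> \<le> (1 + \<eta>) * \<phi> x * measure lebesgue K"
      using N\<phi> K(3) by (intro integral_le_const_measure[OF Km \<phi>K]) (auto intro: less_imp_le)
    have "integral K (\<lambda>y. - \<phi> y) \<le> (- ((1 - \<eta>) * \<phi> x)) * measure lebesgue K"
      using N\<phi> K(3) \<phi>K by (intro integral_le_const_measure[OF Km] integrable_neg) (auto intro: less_imp_le)
    then have low: "(1 - \<eta>) * \<phi> x * measure lebesgue K \<le> integral K \<phi>" by simp
    have "(1 - \<eta>) * (norm (B *v h))\<^sup>2 \<le> h \<bullet> (H y *v h)" "h \<bullet> (H y *v h) \<le> (1 + \<eta>) * (norm (B *v h))\<^sup>2"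
      if "y \<in> K" for y h
      using NH[of y h] that K(3) by (auto simp: abs_le_iff algebra_simps)
    then show ?thesis
      unfolding good_cell_def cc using K B(1) Wx NW up low by (auto simp: less_imp_le mult.assoc subset_iff)
  qed
  then show ?thesis using N by blast
qed

lemma good_cells:
  assumes "\<eta> > 0"
  shows "\<exists>I B w. finite I \<and> (\<forall>K\<in>I. good_cell \<eta> K (B K) (w K)) \<and>
    pairwise (\<lambda>A B. interior A \<inter> interior B = {}) I \<and>
    measure lebesgue (U - \<Union>I) \<le> \<eta> \<and> integral (U - \<Union>I) \<phi> \<le> \<eta>"
proof -
  have "\<forall>x\<in>U. \<exists>N B. open N \<and> x \<in> N \<and> (\<forall>K. is_cube K \<longrightarrow> K \<subseteq> U \<longrightarrow> K \<subseteq> N \<longrightarrow> good_cell \<eta> K B (W x))"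
    using good_cell_neighbourhood assms by blast
  then obtain N B where NB: "\<forall>x\<in>U. open (N x) \<and> x \<in> N x \<and>
      (\<forall>K. is_cube K \<longrightarrow> K \<subseteq> U \<longrightarrow> K \<subseteq> N x \<longrightarrow> good_cell \<eta> K (B x) (W x))"
    unfolding bchoice_iff by (elim exE) (rule that)
  \<comment> \<open>With the density 1 + \<phi> a single covering controls both the volume of the
    uncovered part and the integral of \<phi> over it.\<close>
  define \<psi> where "\<psi> = (\<lambda>x. 1 + \<phi> x)"
  have one: "(\<lambda>x. 1::real) absolutely_integrable_on U"
    using U_props(5) by (simp add: absolutely_integrable_on_const)
  have \<psi>: "\<psi> absolutely_integrable_on U"
    unfolding \<psi>_def using one \<phi>_integrable by (rule set_integral_add(1))
  have "\<exists>I. finite I \<and> (\<forall>K\<in>I. K \<subseteq> U \<and> is_cube K \<and> (\<exists>x\<in>K. K \<subseteq> N x)) \<and>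
    pairwise (\<lambda>A B. interior A \<inter> interior B = {}) I \<and> integral (U - \<Union>I) \<psi> \<le> \<eta>"
  proof (rule cube_cells[OF U_props(1,3) _ \<psi> _ assms])
    show "0 \<le> \<psi> x" if "x \<in> U" for x using \<phi>_pos[OF that] by (simp add: \<psi>_def)
  qed (use NB in blast)
  then obtain I where I: "finite I" "\<forall>K\<in>I. K \<subseteq> U \<and> is_cube K \<and> (\<exists>x\<in>K. K \<subseteq> N x)"
    "pairwise (\<lambda>A B. interior A \<inter> interior B = {}) I" and small: "integral (U - \<Union>I) \<psi> \<le> \<eta>"
    by (elim exE conjE) (rule that; assumption)
  have "\<forall>K\<in>I. \<exists>x. x \<in> K \<and> K \<subseteq> N x" using I(2) by blast
  then obtain c where c: "\<forall>K\<in>I. c K \<in> K \<and> K \<subseteq> N (c K)" unfolding bchoice_iff by (elim exE) (rule that)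
  have good: "good_cell \<eta> K (B (c K)) (W (c K))" if "K \<in> I" for K
  proof -
    have "K \<subseteq> U" "is_cube K" "c K \<in> K" "K \<subseteq> N (c K)" using I(2) c that by blast+
    then show ?thesis using NB by blast
  qed
  define R where "R = U - \<Union>I"
  have Rm: "R \<in> lmeasurable"
    unfolding R_def using U_props(5) I is_cube_lmeasurable
    by (intro fmeasurable.Diff fmeasurable.finite_Union) auto
  have "\<phi> absolutely_integrable_on R"
    using \<phi>_integrable fmeasurableD[OF Rm] by (rule set_integrable_subset) (auto simp: R_def)
  then have \<phi>R: "\<phi> integrable_on R" using absolutely_integrable_on_def by blast
  have "integral R \<psi> = integral R (\<lambda>x. 1) + integral R \<phi>"
    unfolding \<psi>_def using \<phi>R Rm by (intro integral_add integrable_on_const)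
  moreover have "integral R (\<lambda>x. 1) = measure lebesgue R" using Rm by (simp add: lmeasure_integral)
  moreover have "integral R \<phi> \<ge> 0" using \<phi>R \<phi>_pos by (intro integral_nonneg) (auto simp: R_def less_imp_le)
  ultimately have "measure lebesgue R \<le> \<eta>" "integral R \<phi> \<le> \<eta>"
    using small measure_nonneg[of lebesgue R] unfolding R_def by linarith+
  then show ?thesis
    using I good unfolding R_def
    by (intro exI[of _ I] exI[of _ "\<lambda>K. B (c K)"] exI[of _ "\<lambda>K. W (c K)"]) auto
qed

text \<open>The image is a parallelepiped; being convex, it has a negligible frontier, so the
  quantization limit applies to it.\<close>

lemma linear_image_cell:
  fixes K :: "(real^'n) set" and B :: "real^'n^'n"
  assumes "is_cube K" "invertible B"
  shows "compact ((*v) B ` K)" "convex ((*v) B ` K)" "(*v) B ` K \<noteq> {}" "negligible (frontier ((*v) B ` K))"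
    "measure lebesgue ((*v) B ` K) = \<bar>det B\<bar> * measure lebesgue K" "measure lebesgue ((*v) B ` K) > 0"
proof -
  have K: "compact K" "convex K" using assms(1) by (auto simp: is_cube_def)
  have "K \<noteq> {}" using is_cube_measure_pos[OF assms(1)] by force
  then show "(*v) B ` K \<noteq> {}" by simp
  show "compact ((*v) B ` K)" using K(1) by (rule compact_linear_image_mat)
  show cx: "convex ((*v) B ` K)" using K(2) by (intro convex_linear_image) auto
  show "negligible (frontier ((*v) B ` K))" using cx by (rule negligible_convex_frontier)
  show m: "measure lebesgue ((*v) B ` K) = \<bar>det B\<bar> * measure lebesgue K" by (rule measure_linear_image_mat[OF K(1)])
  show "measure lebesgue ((*v) B ` K) > 0"
    unfolding m using is_cube_measure_pos[OF assms(1)] assms(2) by (simp add: invertible_det_nz)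
qed

text \<open>The volume of the image brings |det B|^(1+\<theta>) and the change of variables 1 / |det
  B|; together they make |det B|^\<theta>, as in \<open>cell_const_powr\<close>. The term
  k^(-\<theta>-1) is slack for near-optimal quantizers.\<close>

lemma cell_limit:
  fixes K :: "(real^'n) set" and B :: "real^'n^'n"
  assumes K: "is_cube K" and B: "invertible B" and "w > 0"
  shows "(\<lambda>k. real k powr \<theta> * (w / 2 powr p / \<bar>det B\<bar> * (qerr (2 * p) ((*v) B ` K) k + real k powr (- \<theta> - 1))))
    \<longlonglongrightarrow> \<delta> / 2 powr p * cell_const w B K powr (1 + \<theta>)"
proof -
  note J = linear_image_cell[OF K B]
  have d: "\<bar>det B\<bar> > 0" using B by (simp add: invertible_det_nz)
  have "(\<lambda>k. w / 2 powr p / \<bar>det B\<bar> * (real k powr \<theta> * qerr (2 * p) ((*v) B ` K) k + real k powr (- 1)))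
      \<longlonglongrightarrow> w / 2 powr p / \<bar>det B\<bar> * (\<delta> * measure lebesgue ((*v) B ` K) powr (1 + \<theta>) + 0)"
    by (intro tendsto_mult tendsto_const tendsto_add zador J) real_asymp
  moreover have "w / 2 powr p / \<bar>det B\<bar> * (real k powr \<theta> * qerr (2 * p) ((*v) B ` K) k + real k powr (- 1)) =
      real k powr \<theta> * (w / 2 powr p / \<bar>det B\<bar> * (qerr (2 * p) ((*v) B ` K) k + real k powr (- \<theta> - 1)))" for k
  proof -
    have "real k powr (- 1) = real k powr \<theta> * real k powr (- \<theta> - 1)"
      by (cases "k = 0") (simp_all flip: powr_add)
    then show ?thesis by (simp only: distrib_left mult_ac)
  qed
  moreover have "w / 2 powr p / \<bar>det B\<bar> * (\<delta> * measure lebesgue ((*v) B ` K) powr (1 + \<theta>) + 0) =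
      \<delta> / 2 powr p * cell_const w B K powr (1 + \<theta>)"
    unfolding cell_const_powr[OF \<open>w > 0\<close>] J(5) powr_mult using d by (simp add: powr_add field_simps)
  ultimately show ?thesis by (simp only:)
qed

text \<open>Error functions instead of minorants are collected, because the class in
  \<open>asymptotic_upper_bound\<close> is compared pointwise.\<close>

definition errors :: "nat \<Rightarrow> (real^'n \<Rightarrow> real) set" where
  "errors k = (\<lambda>l x. (v x - l x) powr p * W x) ` Pc k X v"

lemma error_continuous:
  assumes "f \<in> errors k"
  shows "continuous_on X f"
proof -
  obtain l where l: "l \<in> Pc k X v" "f = (\<lambda>x. (v x - l x) powr p * W x)"
    using assms unfolding errors_def by blast
  show ?thesis
    unfolding l(2)
    by (intro continuous_on_mult continuous_on_powr' continuous_on_diff continuous_v W(1) continuous_on_const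
        Pc_continuous[OF l(1)]) (use Pc_le[OF l(1)] p in auto)
qed

lemma error_integrable:
  assumes "f \<in> errors k" "S \<subseteq> X" "S \<in> sets lebesgue"
  shows "f absolutely_integrable_on S"
  using X(1) error_continuous[OF assms(1)] assms(2,3) by (rule continuous_imp_absolutely_integrable_on)

lemma error_nonneg: "f \<in> errors k \<Longrightarrow> x \<in> X \<Longrightarrow> 0 \<le> f x"
  unfolding errors_def using W(2) by (auto simp: less_imp_le)

text \<open>A near-optimal quantizer of the image cell, taken inside it by convexity, pulls back to
  points of \<open>K\<close>. The tangents at these points err by at most (1 + \<eta>) / 2 times the
  squared distance in the image. Of the exponent 1 + p, \<open>p\<close> is due to the quadratic
  form and 1 to the weight.\<close>

lemma cell_upper:
  assumes good: "good_cell \<eta> K B w" and \<eta>: "0 < \<eta>" and k: "k \<ge> 1"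
  shows "\<exists>f\<in>errors k. integral K f \<le>
    ((1 + \<eta>) powr (1 + p) * w) / 2 powr p / \<bar>det B\<bar> * (qerr (2 * p) ((*v) B ` K) k + real k powr (- \<theta> - 1))"
proof -
  have K: "is_cube K" "K \<subseteq> U" and B: "invertible B" and w: "w > 0"
    and WK: "\<And>y. y \<in> K \<Longrightarrow> W y \<le> (1 + \<eta>) * w"
    and HK: "\<And>y h. y \<in> K \<Longrightarrow> h \<bullet> (H y *v h) \<le> (1 + \<eta>) * (norm (B *v h))\<^sup>2"
    using good unfolding good_cell_def by blast+
  have cK: "compact K" "convex K" using K by (auto simp: is_cube_def)
  have Km: "K \<in> sets lebesgue" using is_cube_lmeasurable[OF K(1)] by (rule fmeasurableD)
  note J = linear_image_cell[OF K(1) B]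
  have d: "\<bar>det B\<bar> > 0" using B by (simp add: invertible_det_nz)
  have "real k powr (- \<theta> - 1) > 0" "2 * p > 0" using k p by auto
  from qerr_approx_convex[OF k this(1) J(1-3) this(2)] obtain T where T: "T \<subseteq> (*v) B ` K" "finite T" "T \<noteq> {}" "card T \<le> k"
    and Tq: "integral ((*v) B ` K) (\<lambda>x. infdist x T powr (2 * p)) < qerr (2 * p) ((*v) B ` K) k + real k powr (- \<theta> - 1)"
    by blast
  obtain S where S: "S \<subseteq> K" "finite S" "T = (*v) B ` S" "card S = card T"
  proof -
    obtain S where "S \<subseteq> K" "inj_on ((*v) B) S" "T = (*v) B ` S"
      using T(1) by (rule subset_image_inj[THEN iffD1, THEN exE]) blast
    then show thesis using that[of S] T(2) by (auto simp: card_image dest: finite_imageD)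
  qed
  have "S \<noteq> {}" "S \<subseteq> U" "card S \<le> k" using S T K by auto
  then obtain l where l: "l \<in> Pc k X v" "\<And>x s. s \<in> S \<Longrightarrow> v s + g s \<bullet> (x - s) \<le> l x"
    using tangents_Pc[of S k] S(2) by blast
  define f where "f = (\<lambda>x. (v x - l x) powr p * W x)"
  have fe: "f \<in> errors k" unfolding errors_def f_def using l(1) by blast
  define c where "c = ((1 + \<eta>) powr (1 + p) * w) / 2 powr p"
  have c: "c \<ge> 0" using w \<eta> by (simp add: c_def)
  have point: "f x \<le> c * infdist (B *v x) T powr (2 * p)" if x: "x \<in> K" for x
  proof -
    obtain t where t: "t \<in> T" "infdist (B *v x) T = dist (B *v x) t"
      using infdist_finite_attained[OF T(2,3)] by blast
    obtain s where s: "s \<in> S" "t = B *v s" using t(1) S(3) by blast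
    have sK: "s \<in> K" using s S by blast
    obtain \<xi> where \<xi>: "\<xi> \<in> K" "v x = v s + g s \<bullet> (x - s) + ((x - s) \<bullet> (H \<xi> *v (x - s))) / 2"
      using taylor2[OF cK(2) K(2) sK x] by blast
    have "dist (B *v x) t = norm (B *v (x - s))"
      by (simp add: dist_norm s(2) matrix_vector_mult_diff_distrib)
    then have inf: "infdist (B *v x) T = norm (B *v (x - s))" using t by simp
    have "v x - l x \<le> ((x - s) \<bullet> (H \<xi> *v (x - s))) / 2"
      using l(2)[OF s(1), of x] \<xi>(2) by linarith
    also have "\<dots> \<le> (1 + \<eta>) / 2 * (infdist (B *v x) T)\<^sup>2"
      using HK[OF \<xi>(1), of "x - s"] unfolding inf by simp
    finally have le: "v x - l x \<le> (1 + \<eta>) / 2 * (infdist (B *v x) T)\<^sup>2" .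
    have xX: "x \<in> X" using x K U_props(4) by blast
    have "f x \<le> ((1 + \<eta>) / 2 * (infdist (B *v x) T)\<^sup>2) powr p * ((1 + \<eta>) * w)"
      unfolding f_def using le WK[OF x] W(2)[OF xX] Pc_le[OF l(1) xX] p
      by (intro mult_mono powr_mono2) (auto simp: less_imp_le)
    also have "((1 + \<eta>) / 2 * (infdist (B *v x) T)\<^sup>2) powr p = ((1 + \<eta>) powr p / 2 powr p) * infdist (B *v x) T powr (2 * p)"
    proof -
      have "(infdist (B *v x) T)\<^sup>2 = infdist (B *v x) T powr 2"
        using infdist_nonneg[of "B *v x" T] by (cases "infdist (B *v x) T = 0") (auto simp: powr_numeral)
      then show ?thesis by (simp only: powr_mult powr_divide powr_powr)
    qed
    also have "(1 + \<eta>) powr p / 2 powr p * infdist (B *v x) T powr (2 * p) * ((1 + \<eta>) * w) = c * infdist (B *v x) T powr (2 * p)"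
      using \<eta> by (simp add: c_def powr_add)
    finally show ?thesis .
  qed
  have intg: "(\<lambda>x. infdist (B *v x) T powr (2 * p)) integrable_on K"
  proof -
    have "continuous_on K (\<lambda>x. infdist (B *v x) T powr (2 * p))"
      using p by (intro continuous_on_powr' continuous_on_infdist linear_continuous_on continuous_on_const)
         (auto simp: infdist_nonneg linear_conv_bounded_linear[symmetric])
    from continuous_imp_absolutely_integrable_on[OF cK(1) this subset_refl Km]
    show ?thesis using absolutely_integrable_on_def by blast
  qed
  have "f absolutely_integrable_on K" using K U_props(4) by (intro error_integrable[OF fe _ Km]) blast
  then have "integral K f \<le> integral K (\<lambda>x. c * infdist (B *v x) T powr (2 * p))"
    using intg point absolutely_integrable_on_def by (intro integral_le integrable_on_mult_right) auto
  also have "\<dots> = c * integral K (\<lambda>x. infdist (B *v x) T powr (2 * p))"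
    by (rule integral_mult_right)
  also have "integral K (\<lambda>x. infdist (B *v x) T powr (2 * p)) = integral ((*v) B ` K) (\<lambda>x. infdist x T powr (2 * p)) / \<bar>det B\<bar>"
    using linear_image_integral_infdist[OF B cK(1), of "2 * p" T] p d by simp
  also have "c * (integral ((*v) B ` K) (\<lambda>x. infdist x T powr (2 * p)) / \<bar>det B\<bar>) \<le>
      c * ((qerr (2 * p) ((*v) B ` K) k + real k powr (- \<theta> - 1)) / \<bar>det B\<bar>)"
    using Tq d c by (intro mult_left_mono divide_right_mono) auto
  finally show ?thesis using fe unfolding c_def by (intro bexI[of _ f]) (simp_all add: field_simps)
qed

lemma cell_const_scale:
  assumes "a > 0" "w > 0"
  shows "cell_const (a * w) B K = a powr \<beta> * cell_const w B K"
  by (simp add: cell_const_def powr_mult)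

lemma approx_upper:
  assumes "U \<noteq> {}" "\<epsilon> > 0"
  shows "\<forall>\<^sub>F m in sequentially. \<exists>f\<in>errors m. real m powr \<theta> * integral U f \<le>
    \<delta> / 2 powr p * integral U \<phi> powr (1 + \<theta>) + \<epsilon>"
proof -
  obtain R where R: "R > 0" and unif: "\<And>k. k \<ge> 1 \<Longrightarrow> \<exists>l\<in>Pc k X v. \<forall>x\<in>U. v x - l x \<le> R * real k powr (- 2 / real CARD('n))"
    using uniform_approximation[OF assms(1)] by blast
  obtain b where b: "b > 0" "\<And>x. x \<in> X \<Longrightarrow> W x \<le> b" using W_bound by blast
  have C0: "0 \<le> integral U \<phi>"
    using \<phi>_integrable \<phi>_pos absolutely_integrable_on_def by (intro integral_nonneg) (auto simp: less_imp_le)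
  show ?thesis
  proof (rule asymptotic_upper_bound[where B = "R powr p * b" and F = errors])
    show "\<theta> > 0" by (rule \<theta>_pos)
    show "U \<in> lmeasurable" by (rule U_props)
    show "f absolutely_integrable_on U" if "f \<in> errors k" for f k
      using U_props by (intro error_integrable[OF that]) (auto intro: fmeasurableD)
    show "0 \<le> f x" if "f \<in> errors k" "x \<in> U" for f k x
      using error_nonneg[OF that(1)] that(2) U_props(4) by blast
    show "errors a \<subseteq> errors b" if "a \<le> b" for a b
      unfolding errors_def using Pc_mono[OF that] by blast
    show "0 \<le> R powr p * b" using b by simp
    show "0 \<le> integral U \<phi>" by (rule C0)
    show "0 \<le> \<delta> / 2 powr p" using \<delta> by simp
    show "0 < \<epsilon>" by fact
  next
    fix a b f f' assume "f \<in> errors a" "f' \<in> errors b"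
    then obtain l l' where l: "l \<in> Pc a X v" "f = (\<lambda>x. (v x - l x) powr p * W x)"
      and l': "l' \<in> Pc b X v" "f' = (\<lambda>x. (v x - l' x) powr p * W x)"
      unfolding errors_def by blast
    obtain l'' where l'': "l'' \<in> Pc (a + b) X v" "\<And>x. l x \<le> l'' x" "\<And>x. l' x \<le> l'' x"
      using Pc_combine[OF l(1) l'(1)] by blast
    show "\<exists>h\<in>errors (a + b). \<forall>x\<in>U. h x \<le> f x \<and> h x \<le> f' x"
    proof (intro bexI[of _ "\<lambda>x. (v x - l'' x) powr p * W x"] ballI)
      show "(\<lambda>x. (v x - l'' x) powr p * W x) \<in> errors (a + b)" unfolding errors_def using l'' by blast
      fix x assume "x \<in> U"
      then have x: "x \<in> X" using U_props(4) by blast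
      show "(v x - l'' x) powr p * W x \<le> f x \<and> (v x - l'' x) powr p * W x \<le> f' x"
        unfolding l(2) l'(2) using l''(2,3)[of x] Pc_le[OF l''(1) x] W(2)[OF x] p
        by (intro conjI mult_right_mono powr_mono2) auto
    qed
  next
    fix k :: nat assume "k \<ge> 1"
    from unif[OF this] obtain l where l: "l \<in> Pc k X v" "\<And>x. x \<in> U \<Longrightarrow> v x - l x \<le> R * real k powr (- 2 / real CARD('n))" by blast
    show "\<exists>f\<in>errors k. \<forall>x\<in>U. f x \<le> R powr p * b * real k powr (- \<theta>)"
    proof (intro bexI[of _ "\<lambda>x. (v x - l x) powr p * W x"] ballI)
      show "(\<lambda>x. (v x - l x) powr p * W x) \<in> errors k" unfolding errors_def using l by blast
      fix x assume xU: "x \<in> U"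
      then have x: "x \<in> X" using U_props(4) by blast
      have "(v x - l x) powr p * W x \<le> (R * real k powr (- 2 / real CARD('n))) powr p * b"
        using l(2)[OF xU] Pc_le[OF l(1) x] W(2)[OF x] b(2)[OF x] p by (intro mult_mono powr_mono2) auto
      also have "(R * real k powr (- 2 / real CARD('n))) powr p = R powr p * real k powr (- \<theta>)"
        unfolding powr_mult powr_powr by (simp add: \<theta>)
      finally show "(v x - l x) powr p * W x \<le> R powr p * b * real k powr (- \<theta>)" by (simp add: mult_ac)
    qed
  next
    fix e :: real assume "e > 0"
    define C where "C = integral U \<phi>"
    \<comment> \<open>The total distortion of the cell weights: (1 + \<eta>)^(1+p) from
      \<open>cell_upper\<close> enters with the power \<beta> through
      \<open>cell_const_scale\<close>, and 1 / (1 - \<eta>) comes from bounding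
      \<open>cell_const\<close> by the integral of \<phi>.\<close>
    have "((\<lambda>\<eta>. ((1 + \<eta>) powr (1 + p)) powr \<beta> / (1 - \<eta>) * C) \<longlongrightarrow> ((1 + 0) powr (1 + p)) powr \<beta> / (1 - 0) * C) (at_right 0)"
      by (intro tendsto_intros) auto
    then have "\<forall>\<^sub>F \<eta> in at_right 0. ((1 + \<eta>) powr (1 + p)) powr \<beta> / (1 - \<eta>) * C < C + e"
      using \<open>e > 0\<close> by (intro order_tendstoD) auto
    then obtain \<eta> where \<eta>: "0 < \<eta>" "\<eta> < min e 1" and small: "((1 + \<eta>) powr (1 + p)) powr \<beta> / (1 - \<eta>) * C < C + e"
      using \<open>e > 0\<close> by (elim eventually_at_right_0_obtain[of _ "min e 1"]) auto
    obtain I B w where I: "finite I" and good: "\<forall>K\<in>I. good_cell \<eta> K (B K) (w K)"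
      and pw: "pairwise (\<lambda>A B. interior A \<inter> interior B = {}) I"
      and rest: "measure lebesgue (U - \<Union>I) \<le> \<eta>" "integral (U - \<Union>I) \<phi> \<le> \<eta>"
      using good_cells[OF \<eta>(1)] by (elim exE conjE) (rule that; assumption)
    define w' where "w' = (\<lambda>K. (1 + \<eta>) powr (1 + p) * w K)"
    define c where "c = (\<lambda>K. cell_const (w' K) (B K) K)"
    define er where "er = (\<lambda>K k. w' K / 2 powr p / \<bar>det (B K)\<bar> * (qerr (2 * p) ((*v) (B K) ` K) k + real k powr (- \<theta> - 1)))"
    have K: "is_cube K" "K \<subseteq> U" "invertible (B K)" "w K > 0"
      "(1 - \<eta>) * cell_const (w K) (B K) K \<le> integral K \<phi>" if "K \<in> I" for K
      using bspec[OF good that] unfolding good_cell_def by blast+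
    have w': "w' K > 0" if "K \<in> I" for K using K(4)[OF that] \<eta> by (simp add: w'_def)
    have cpos: "c K > 0" if "K \<in> I" for K
      unfolding c_def cell_const_def using w'[OF that] K(3)[OF that] is_cube_measure_pos[OF K(1)[OF that]]
      by (intro mult_pos_pos) (auto simp: invertible_det_nz)
    have "c K \<le> ((1 + \<eta>) powr (1 + p)) powr \<beta> / (1 - \<eta>) * integral K \<phi>" if "K \<in> I" for K
    proof -
      have "cell_const (w K) (B K) K \<le> integral K \<phi> / (1 - \<eta>)"
        using K(5)[OF that] \<eta> by (simp add: pos_le_divide_eq mult.commute)
      then have "((1 + \<eta>) powr (1 + p)) powr \<beta> * cell_const (w K) (B K) K \<le> ((1 + \<eta>) powr (1 + p)) powr \<beta> * (integral K \<phi> / (1 - \<eta>))"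
        by (intro mult_left_mono) auto
      moreover have "c K = ((1 + \<eta>) powr (1 + p)) powr \<beta> * cell_const (w K) (B K) K"
        unfolding c_def w'_def using \<eta> K(4)[OF that] by (intro cell_const_scale) auto
      ultimately show ?thesis by simp
    qed
    then have "sum c I \<le> (\<Sum>K\<in>I. ((1 + \<eta>) powr (1 + p)) powr \<beta> / (1 - \<eta>) * integral K \<phi>)"
      by (rule sum_mono)
    also have "\<dots> = ((1 + \<eta>) powr (1 + p)) powr \<beta> / (1 - \<eta>) * (\<Sum>K\<in>I. integral K \<phi>)"
      by (rule sum_distrib_left[symmetric])
    also have "\<dots> \<le> ((1 + \<eta>) powr (1 + p)) powr \<beta> / (1 - \<eta>) * C"
    proof (rule mult_left_mono)
      show "(\<Sum>K\<in>I. integral K \<phi>) \<le> C"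
        unfolding C_def using I K pw \<phi>_integrable \<phi>_pos by (intro sum_integral_cells_le) (auto simp: less_imp_le)
    qed (use \<eta> in auto)
    finally have sumc: "sum c I \<le> C + e" using small by linarith
    show "\<exists>I c er. finite I \<and>
        (\<forall>K\<in>I. K \<subseteq> U \<and> K \<in> lmeasurable \<and> 0 < c K \<and>
           (\<lambda>k. real k powr \<theta> * er K k) \<longlonglongrightarrow> \<delta> / 2 powr p * c K powr (1 + \<theta>) \<and>
           (\<forall>k\<ge>1. \<exists>f\<in>errors k. integral K f \<le> er K k)) \<and>
        sum c I \<le> integral U \<phi> + e \<and> measure lebesgue (U - \<Union>I) \<le> e"
    proof (intro exI[of _ I] exI[of _ c] exI[of _ er] conjI ballI allI impI)
      show "sum c I \<le> integral U \<phi> + e" using sumc by (simp add: C_def)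
      show "measure lebesgue (U - \<Union>I) \<le> e" using rest(1) \<eta> by simp
      show "finite I" by fact
    next
      fix A assume A: "A \<in> I"
      show "A \<subseteq> U" by (rule K(2)[OF A])
      show "A \<in> lmeasurable" by (rule is_cube_lmeasurable[OF K(1)[OF A]])
      show "0 < c A" by (rule cpos[OF A])
      show "(\<lambda>k. real k powr \<theta> * er A k) \<longlonglongrightarrow> \<delta> / 2 powr p * c A powr (1 + \<theta>)"
        unfolding er_def c_def by (rule cell_limit[OF K(1,3)[OF A] w'[OF A]])
      show "\<exists>f\<in>errors k. integral A f \<le> er A k" if "1 \<le> k" for k
        unfolding er_def w'_def by (rule cell_upper[OF bspec[OF good A] \<eta>(1) that])
    qed
  qed
qed

end

section \<open>Lower bound and limit\<close>

context weighted_smooth_convex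
begin

text \<open>The margin is measured by |B h|, since the net \<open>T\<close> and the quantizers live
  in the image of the cell. For these images the Zador bound is only asymptotic, hence the loss
  \<open>e\<close> and the threshold \<open>k0\<close>, in contrast to
  \<open>qerr_cube_ge\<close>.\<close>

lemma lower_cell_data:
  fixes K :: "(real^'n) set" and B :: "real^'n^'n"
  assumes "is_cube K" "invertible B" "0 < l" "l < 1" "e > 0"
  shows "\<exists>K' d T k0. is_cube K' \<and> K' \<subseteq> interior K \<and> measure lebesgue K' = l ^ CARD('n) * measure lebesgue K \<and>
    finite T \<and> T \<noteq> {} \<and> (\<forall>x\<in>K'. \<forall>s. s \<notin> interior K \<longrightarrow> d \<le> norm (B *v (x - s))) \<and>
    (\<forall>x\<in>K'. \<exists>t\<in>T. dist (B *v x) t < d) \<and>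
    (\<forall>k\<ge>k0. (\<delta> - e) * measure lebesgue ((*v) B ` K') powr (1 + \<theta>) \<le> real k powr \<theta> * qerr (2 * p) ((*v) B ` K') k)"
proof -
  obtain K' where K': "is_cube K'" "K' \<subseteq> interior K" "measure lebesgue K' = l ^ CARD('n) * measure lebesgue K"
    using shrunk_cube[OF assms(1,3,4)] .
  have cK: "compact K'" using K'(1) by (auto simp: is_cube_def)
  note J = linear_image_cell[OF K'(1) assms(2)]
  obtain d0 where d0: "d0 > 0" "\<forall>x\<in>K'. \<forall>s. s \<notin> interior K \<longrightarrow> d0 \<le> dist x s"
    using compact_interior_margin[OF cK K'(2)] by blast
  obtain C where C: "C ** B = mat 1" using assms(2) invertible_def by blast
  \<comment> \<open>The added 1 makes \<open>M\<close> visibly positive, so that the margin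
    \<open>d0\<close> can be divided by it.\<close>
  define M where "M = onorm ((*v) C) + 1"
  have M0: "M > 0" unfolding M_def by (intro add_nonneg_pos onorm_pos_le matrix_vector_mul_bounded_linear) simp
  have M: "norm h \<le> M * norm (B *v h)" for h
  proof -
    have "h = C *v (B *v h)" by (simp add: matrix_vector_mul_assoc C)
    then have "norm h \<le> onorm ((*v) C) * norm (B *v h)" by (metis onorm matrix_vector_mul_bounded_linear)
    also have "\<dots> \<le> M * norm (B *v h)" by (intro mult_right_mono) (auto simp: M_def)
    finally show ?thesis .
  qed
  define d where "d = d0 / M"
  have d: "d > 0" using d0 M0 by (simp add: d_def)
  have margin: "d \<le> norm (B *v (x - s))" if "x \<in> K'" "s \<notin> interior K" for x s
  proof -
    have "d0 \<le> norm (x - s)" using d0(2) that by (simp add: dist_norm)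
    also have "\<dots> \<le> M * norm (B *v (x - s))" by (rule M)
    finally show ?thesis using M0 by (simp add: d_def pos_divide_le_eq mult.commute)
  qed
  obtain T where T: "finite T" "\<forall>y\<in>(*v) B ` K'. \<exists>t\<in>T. dist y t < d"
    using compact_finite_net[OF J(1) d] by blast
  have "T \<noteq> {}" using T(2) J(3) by blast
  have "(\<delta> - e) * measure lebesgue ((*v) B ` K') powr (1 + \<theta>) < \<delta> * measure lebesgue ((*v) B ` K') powr (1 + \<theta>)"
    using J(6) \<open>e > 0\<close> by (intro mult_strict_right_mono) auto
  from order_tendstoD(1)[OF zador[OF J(1,4,3)] this] obtain k0 where
    k0: "\<forall>k\<ge>k0. (\<delta> - e) * measure lebesgue ((*v) B ` K') powr (1 + \<theta>) < real k powr \<theta> * qerr (2 * p) ((*v) B ` K') k"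
    unfolding eventually_sequentially by blast
  show ?thesis
    using K' T(1) \<open>T \<noteq> {}\<close> margin T(2) k0
    by (intro exI[of _ K'] exI[of _ d] exI[of _ T] exI[of _ k0] conjI) (auto intro: less_imp_le)
qed

text \<open>Some affine function of \<open>l\<close> is active at \<open>x\<close>; let
  \<open>s\<close> minimize its gap to \<open>v\<close> over \<open>K\<close>. If \<open>s\<close>
  is interior, the slope of that function is \<open>g s\<close>, so \<open>B *v s\<close> belongs to
  \<open>V\<close>; otherwise \<open>s\<close> is beyond the margin, and some net point is nearer to
  \<open>B *v x\<close> than \<open>B *v s\<close>. In both cases \<open>gap_at_minimizer\<close>
  gives the bound.\<close>

lemma cell_lower_pointwise:
  assumes good: "good_cell \<eta> K B w" and \<eta>: "0 < \<eta>" "\<eta> < 1"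
    and A: "finite A" "A \<noteq> {}" "l = (\<lambda>x. Max ((\<lambda>ab. affine_fun ab x) ` A))" "\<forall>x\<in>X. l x \<le> v x"
    and K': "K' \<subseteq> interior K"
    and margin: "\<And>x s. x \<in> K' \<Longrightarrow> s \<notin> interior K \<Longrightarrow> d \<le> norm (B *v (x - s))"
    and net: "\<And>x. x \<in> K' \<Longrightarrow> \<exists>t\<in>T. dist (B *v x) t < d"
    and V: "V = (*v) B ` {s \<in> interior K. g s \<in> fst ` A} \<union> T"
    and x: "x \<in> K'"
  shows "(1 - \<eta>) / 2 * (infdist (B *v x) V)\<^sup>2 \<le> v x - l x"
proof -
  have K: "is_cube K" "K \<subseteq> U"
    and HK: "\<And>y h. y \<in> K \<Longrightarrow> (1 - \<eta>) * (norm (B *v h))\<^sup>2 \<le> h \<bullet> (H y *v h)"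
    using good unfolding good_cell_def by blast+
  have cK: "compact K" "convex K" using K by (auto simp: is_cube_def)
  have xK: "x \<in> K" using x K' interior_subset by blast
  have KX: "K \<subseteq> X" using K(2) U_props(4) by blast
  have "l x \<in> (\<lambda>ab. affine_fun ab x) ` A" unfolding A(3) using A(1,2) by (intro Max_in) auto
  then obtain a c where ac: "(a, c) \<in> A" "l x = a \<bullet> x + c" by (auto simp: affine_fun_def)
  have "continuous_on K (\<lambda>y. v y - a \<bullet> y)"
    using continuous_on_subset[OF continuous_v KX] by (intro continuous_intros)
  then obtain s where s: "s \<in> K" "\<And>y. y \<in> K \<Longrightarrow> v s - a \<bullet> s \<le> v y - a \<bullet> y"
    using continuous_attains_inf[OF cK(1), of "\<lambda>y. v y - a \<bullet> y"] xK by blast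
  have "affine_fun (a, c) s \<le> l s" unfolding A(3) using A(1) ac(1) by (intro Max_ge) auto
  also have "\<dots> \<le> v s" using A(4) s(1) KX by blast
  finally have nonneg: "0 \<le> v s - (a \<bullet> s + c)" by (simp add: affine_fun_def)
  have gap: "(1 - \<eta>) / 2 * (norm (B *v (x - s)))\<^sup>2 \<le> v x - l x"
    unfolding ac(2) using gap_at_minimizer[OF cK(2) K(2) s(1) xK s(2) nonneg HK] by blast
  have "infdist (B *v x) V \<le> norm (B *v (x - s))"
  proof (cases "s \<in> interior K")
    case True
    have "g s = a" using interior_minimizer_gradient[OF cK(2) K(2) True s(2)] by blast
    then have "g s \<in> fst ` A" using ac(1) by force
    then have "B *v s \<in> V" unfolding V using True by blast
    then have "infdist (B *v x) V \<le> dist (B *v x) (B *v s)" by (rule infdist_le)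
    then show ?thesis by (simp add: dist_norm matrix_vector_mult_diff_distrib)
  next
    case False
    obtain t where "t \<in> T" "dist (B *v x) t < d" using net[OF x] by blast
    then show ?thesis
      using margin[OF x False] by (intro infdist_le2[of t]) (auto simp: V)
  qed
  then have "(infdist (B *v x) V)\<^sup>2 \<le> (norm (B *v (x - s)))\<^sup>2"
    by (intro power_mono) (auto simp: infdist_nonneg)
  then have "(1 - \<eta>) / 2 * (infdist (B *v x) V)\<^sup>2 \<le> (1 - \<eta>) / 2 * (norm (B *v (x - s)))\<^sup>2"
    using \<eta> by (intro mult_left_mono) auto
  with gap show ?thesis by linarith
qed

lemma cell_lower:
  assumes good: "good_cell \<eta> K B w" and \<eta>: "0 < \<eta>" "\<eta> < 1"
    and l: "l \<in> Pc m X v" and K': "is_cube K'" "K' \<subseteq> interior K"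
    and V: "finite V" "V \<noteq> {}" "card V \<le> k"
    and point: "\<And>x. x \<in> K' \<Longrightarrow> (1 - \<eta>) / 2 * (infdist (B *v x) V)\<^sup>2 \<le> v x - l x"
  shows "((1 - \<eta>) powr (1 + p) * w) / 2 powr p / \<bar>det B\<bar> * qerr (2 * p) ((*v) B ` K') k \<le>
    integral K' (\<lambda>x. (v x - l x) powr p * W x)"
proof -
  have K: "K \<subseteq> U" and B: "invertible B" and w: "w > 0"
    and WK: "\<And>y. y \<in> K \<Longrightarrow> (1 - \<eta>) * w \<le> W y"
    using good unfolding good_cell_def by blast+
  have cK: "compact K'" using K'(1) by (auto simp: is_cube_def)
  have Km: "K' \<in> sets lebesgue" using is_cube_lmeasurable[OF K'(1)] by (rule fmeasurableD)
  have K'K: "K' \<subseteq> K" using K'(2) interior_subset by blast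
  have K'X: "K' \<subseteq> X" using K'K K U_props(4) by blast
  have d: "\<bar>det B\<bar> > 0" using B by (simp add: invertible_det_nz)
  define f where "f = (\<lambda>x. (v x - l x) powr p * W x)"
  have fe: "f \<in> errors m" unfolding errors_def f_def using l by blast
  define c where "c = ((1 - \<eta>) powr (1 + p) * w) / 2 powr p"
  have c: "c \<ge> 0" using w by (simp add: c_def)
  have pt: "c * infdist (B *v x) V powr (2 * p) \<le> f x" if x: "x \<in> K'" for x
  proof -
    have sq: "(infdist (B *v x) V)\<^sup>2 = infdist (B *v x) V powr 2"
      using infdist_nonneg[of "B *v x" V] by (cases "infdist (B *v x) V = 0") (auto simp: powr_numeral)
    have "((1 - \<eta>) / 2 * (infdist (B *v x) V)\<^sup>2) powr p = (1 - \<eta>) powr p / 2 powr p * infdist (B *v x) V powr (2 * p)"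
      unfolding sq by (simp only: powr_mult powr_divide powr_powr)
    then have "c * infdist (B *v x) V powr (2 * p) = ((1 - \<eta>) / 2 * (infdist (B *v x) V)\<^sup>2) powr p * ((1 - \<eta>) * w)"
      using \<eta> by (simp add: c_def powr_add)
    also have "\<dots> \<le> f x"
      unfolding f_def using point[OF x] WK[of x] x K'K \<eta> w p
      by (intro mult_mono powr_mono2) auto
    finally show ?thesis .
  qed
  have intg: "(\<lambda>x. infdist (B *v x) V powr (2 * p)) integrable_on K'"
  proof -
    have "continuous_on K' (\<lambda>x. infdist (B *v x) V powr (2 * p))"
      using p by (intro continuous_on_powr' continuous_on_infdist linear_continuous_on continuous_on_const)
         (auto simp: infdist_nonneg linear_conv_bounded_linear[symmetric])
    from continuous_imp_absolutely_integrable_on[OF cK this subset_refl Km]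
    show ?thesis using absolutely_integrable_on_def by blast
  qed
  have "c / \<bar>det B\<bar> * qerr (2 * p) ((*v) B ` K') k \<le> c / \<bar>det B\<bar> * integral ((*v) B ` K') (\<lambda>x. infdist x V powr (2 * p))"
    using c by (intro mult_left_mono qerr_le[OF V]) auto
  also have "\<dots> = c * integral K' (\<lambda>x. infdist (B *v x) V powr (2 * p))"
    using linear_image_integral_infdist[OF B cK, of "2 * p" V] p d by simp
  also have "\<dots> = integral K' (\<lambda>x. c * infdist (B *v x) V powr (2 * p))"
    by (rule integral_mult_right[symmetric])
  also have "\<dots> \<le> integral K' f"
    using intg pt error_integrable[OF fe K'X Km] absolutely_integrable_on_def
    by (intro integral_le integrable_on_mult_right) auto
  finally show ?thesis unfolding c_def f_def .
qed

lemma approx_lower: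
  assumes "\<epsilon> > 0"
  shows "\<forall>\<^sub>F m in sequentially. \<forall>f\<in>errors m.
    \<delta> / 2 powr p * integral U \<phi> powr (1 + \<theta>) - \<epsilon> \<le> real m powr \<theta> * integral U f"
proof (rule asymptotic_lower_bound[where 'i = "(real^'n) set"])
  have Ul: "U \<in> sets lebesgue" using U_props(5) by (rule fmeasurableD)
  show "\<theta> > 0" by (rule \<theta>_pos)
  have fU: "f integrable_on U" if "f \<in> errors k" for f k
    using error_integrable[OF that U_props(4) Ul] absolutely_integrable_on_def by blast
  show "0 \<le> integral U f" if "f \<in> errors k" for f k
    using error_nonneg[OF that] U_props(4) by (intro integral_nonneg fU[OF that]) blast
  show C0: "0 \<le> integral U \<phi>"
    using \<phi>_integrable \<phi>_pos absolutely_integrable_on_def by (intro integral_nonneg) (auto simp: less_imp_le)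
  show "0 \<le> \<delta> / 2 powr p" using \<delta> by simp
  show "0 < \<epsilon>" by fact
  fix e :: real assume e: "e > 0" "e < \<delta> / 2 powr p"
  define C where "C = integral U \<phi>"
  let ?\<gamma> = "\<lambda>\<eta>. ((1 - \<eta>) powr (1 + p)) powr \<beta> * (1 - \<eta>) ^ CARD('n) / (1 + \<eta>)"
  have "((\<lambda>\<eta>. ?\<gamma> \<eta> * (C - \<eta>)) \<longlongrightarrow> ?\<gamma> 0 * (C - 0)) (at_right 0)"
    by (intro tendsto_intros) auto
  then have "\<forall>\<^sub>F \<eta> in at_right 0. C - e < ?\<gamma> \<eta> * (C - \<eta>)"
    using \<open>e > 0\<close> by (intro order_tendstoD) auto
  then obtain \<eta> where \<eta>: "0 < \<eta>" "\<eta> < 1" and large: "C - e < ?\<gamma> \<eta> * (C - \<eta>)"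
    by (rule eventually_at_right_0_obtain[of _ 1]) auto
  obtain I B w where I: "finite I" and good: "\<forall>K\<in>I. good_cell \<eta> K (B K) (w K)"
    and pw: "pairwise (\<lambda>A B. interior A \<inter> interior B = {}) I"
    and rest: "integral (U - \<Union>I) \<phi> \<le> \<eta>"
    using good_cells[OF \<eta>(1)] by (elim exE conjE) (rule that; assumption)
  have K: "is_cube K" "K \<subseteq> U" "invertible (B K)" "w K > 0"
    "integral K \<phi> \<le> (1 + \<eta>) * cell_const (w K) (B K) K" if "K \<in> I" for K
    using bspec[OF good that] unfolding good_cell_def by blast+
  \<comment> \<open>A loss of \<open>e'\<close> in \<delta> is a loss of \<open>e\<close> in
    \<delta> / 2^p, the constant for which the lower bound is set up.\<close>
  define e' where "e' = e * 2 powr p"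
  have e': "e' > 0" "(\<delta> - e') / 2 powr p = \<delta> / 2 powr p - e" using e by (auto simp: e'_def diff_divide_distrib)
  define P where "P = (\<lambda>K K' (d::real) T (k0::nat). is_cube K' \<and> K' \<subseteq> interior K \<and>
    measure lebesgue K' = (1 - \<eta>) ^ CARD('n) * measure lebesgue K \<and>
    finite T \<and> T \<noteq> {} \<and> (\<forall>x\<in>K'. \<forall>s. s \<notin> interior K \<longrightarrow> d \<le> norm (B K *v (x - s))) \<and>
    (\<forall>x\<in>K'. \<exists>t\<in>T. dist (B K *v x) t < d) \<and>
    (\<forall>k\<ge>k0. (\<delta> - e') * measure lebesgue ((*v) (B K) ` K') powr (1 + \<theta>) \<le> real k powr \<theta> * qerr (2 * p) ((*v) (B K) ` K') k))"
  have "\<forall>K\<in>I. \<exists>K' d T k0. P K K' d T k0"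
  proof
    fix A assume A: "A \<in> I"
    show "\<exists>K' d T k0. P A K' d T k0"
      unfolding P_def by (rule lower_cell_data[OF K(1,3)[OF A]]) (use \<eta> e'(1) in auto)
  qed
  then obtain K' d T k0 where PK: "\<forall>K\<in>I. P K (K' K) (d K) (T K) (k0 K)"
    unfolding bchoice_iff by (elim exE) (rule that)
  note PK' = bspec[OF PK, unfolded P_def]
  have K': "is_cube (K' K)" "K' K \<subseteq> interior K"
    "measure lebesgue (K' K) = (1 - \<eta>) ^ CARD('n) * measure lebesgue K" if "K \<in> I" for K
    using PK'[OF that] by simp_all
  have T: "finite (T K)" "T K \<noteq> {}" if "K \<in> I" for K
    using PK'[OF that] by simp_all
  have d: "s \<notin> interior K \<Longrightarrow> d K \<le> norm (B K *v (x - s))" "\<exists>t\<in>T K. dist (B K *v x) t < d K"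
    if "K \<in> I" "x \<in> K' K" for K x s
    using PK'[OF that(1)] that(2) by simp_all
  have k0: "(\<delta> - e') * measure lebesgue ((*v) (B K) ` K' K) powr (1 + \<theta>) \<le> real k powr \<theta> * qerr (2 * p) ((*v) (B K) ` K' K) k"
    if "K \<in> I" "k \<ge> k0 K" for K k
    using PK'[OF that(1)] that(2) by simp
  define w' where "w' = (\<lambda>K. (1 - \<eta>) powr (1 + p) * w K)"
  define c where "c = (\<lambda>K. cell_const (w' K) (B K) (K' K))"
  have w': "w' K > 0" if "K \<in> I" for K using K(4)[OF that] \<eta> by (simp add: w'_def)
  have cpos: "c K > 0" if "K \<in> I" for K
    unfolding c_def cell_const_def using w'[OF that] K(3)[OF that] is_cube_measure_pos[OF K'(1)[OF that]]
    by (intro mult_pos_pos) (auto simp: invertible_det_nz)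
  have cge: "?\<gamma> \<eta> * integral K \<phi> \<le> c K" if "K \<in> I" for K
  proof -
    have "c K = ((1 - \<eta>) powr (1 + p)) powr \<beta> * cell_const (w K) (B K) (K' K)"
      unfolding c_def w'_def using \<eta> K(4)[OF that] by (intro cell_const_scale) auto
    also have "cell_const (w K) (B K) (K' K) = (1 - \<eta>) ^ CARD('n) * cell_const (w K) (B K) K"
      unfolding cell_const_def K'(3)[OF that] by simp
    finally have cK: "c K = ((1 - \<eta>) powr (1 + p)) powr \<beta> * (1 - \<eta>) ^ CARD('n) * cell_const (w K) (B K) K" by simp
    have "integral K \<phi> / (1 + \<eta>) \<le> cell_const (w K) (B K) K"
      using K(5)[OF that] \<eta> by (simp add: pos_divide_le_eq mult.commute)
    then have "((1 - \<eta>) powr (1 + p)) powr \<beta> * (1 - \<eta>) ^ CARD('n) * (integral K \<phi> / (1 + \<eta>)) \<le> c K"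
      unfolding cK using \<eta> by (intro mult_left_mono) auto
    then show ?thesis by simp
  qed
  have sumc: "C - e \<le> sum c I"
  proof -
    have "C \<le> integral (U - \<Union>I) \<phi> + (\<Sum>K\<in>I. integral K \<phi>)"
      unfolding C_def using I K Ul \<phi>_integrable \<phi>_pos by (intro integral_le_cells_rest) (auto simp: less_imp_le)
    then have "C - \<eta> \<le> (\<Sum>K\<in>I. integral K \<phi>)" using rest by linarith
    then have "?\<gamma> \<eta> * (C - \<eta>) \<le> ?\<gamma> \<eta> * (\<Sum>K\<in>I. integral K \<phi>)"
      using \<eta> by (intro mult_left_mono) auto
    also have "\<dots> \<le> sum c I" unfolding sum_distrib_left using cge by (rule sum_mono)
    finally show ?thesis using large by linarith
  qed
  \<comment> \<open>Besides the net points, \<open>k0 K\<close> is added to the budget of each cell.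
    The Zador bound then applies however few points a cell receives, at the price of a
    constant.\<close>
  define N where "N = (\<Sum>K\<in>I. card (T K) + k0 K)"
  have inj: "inj_on g U" using gradient_strictly_monotone by (intro inj_onI) force
  have low: "\<exists>k. (\<forall>K\<in>I. 1 \<le> k K) \<and> sum k I \<le> m + N \<and>
      (\<delta> / 2 powr p - e) * (\<Sum>K\<in>I. c K powr (1 + \<theta>) * real (k K) powr (- \<theta>)) \<le> integral U f"
    if fm: "f \<in> errors m" for m f
  proof -
    obtain l where l: "l \<in> Pc m X v" and f: "f = (\<lambda>x. (v x - l x) powr p * W x)"
      using fm unfolding errors_def by blast
    obtain A where A: "finite A" "A \<noteq> {}" "card A \<le> m" "l = (\<lambda>x. Max ((\<lambda>ab. affine_fun ab x) ` A))" "\<forall>x\<in>X. l x \<le> v x"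
      using l unfolding Pc_def by blast
    \<comment> \<open>Only slopes are recorded: two affine functions of \<open>l\<close> with the
      same slope share one point, so the total is bounded by the number of slopes and hence by
      \<open>card A\<close>.\<close>
    define S where "S = (\<lambda>K. {s \<in> interior K. g s \<in> fst ` A})"
    have SU: "S K \<subseteq> U" if "K \<in> I" for K
      using K(2)[OF that] interior_subset[of K] unfolding S_def by blast
    have finS: "finite (S K)" if "K \<in> I" for K
    proof (rule finite_imageD)
      show "finite (g ` S K)" using A(1) by (rule_tac finite_subset[of _ "fst ` A"]) (auto simp: S_def)
      show "inj_on g (S K)" using inj SU[OF that] by (rule inj_on_subset)
    qed
    have "(\<Sum>K\<in>I. card (S K)) = card (\<Union>K\<in>I. S K)"
      using I finS pw by (intro card_UN_disjoint[symmetric]) (auto simp: S_def pairwise_def)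
    also have "\<dots> = card (g ` (\<Union>K\<in>I. S K))"
      using SU by (intro card_image[symmetric] inj_on_subset[OF inj]) auto
    also have "\<dots> \<le> card (fst ` A)" using A(1) by (intro card_mono) (auto simp: S_def)
    also have "\<dots> \<le> card A" using A(1) by (rule card_image_le)
    finally have Ssum: "(\<Sum>K\<in>I. card (S K)) \<le> m" using A(3) by linarith
    define k where "k = (\<lambda>K. card (S K) + (card (T K) + k0 K))"
    define V where "V = (\<lambda>K. (*v) (B K) ` S K \<union> T K)"
    have V: "finite (V K)" "V K \<noteq> {}" "card (V K) \<le> k K" if "K \<in> I" for K
    proof -
      show "finite (V K)" "V K \<noteq> {}" unfolding V_def using finS[OF that] T[OF that] by auto
      have "card (V K) \<le> card ((*v) (B K) ` S K) + card (T K)" unfolding V_def by (rule card_Un_le)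
      also have "card ((*v) (B K) ` S K) \<le> card (S K)" using finS[OF that] by (rule card_image_le)
      finally show "card (V K) \<le> k K" by (simp add: k_def)
    qed
    have k1: "1 \<le> k K" if "K \<in> I" for K
      using T[OF that] by (simp add: k_def Suc_le_eq card_gt_0_iff)
    have ksum: "sum k I \<le> m + N"
      using Ssum unfolding k_def N_def sum.distrib[of "\<lambda>K. card (S K)"] by linarith
    have cell: "(\<delta> / 2 powr p - e) * (c A powr (1 + \<theta>) * real (k A) powr (- \<theta>)) \<le> integral (K' A) f"
      if AI: "A \<in> I" for A
    proof -
      let ?J = "(*v) (B A) ` K' A"
      note J = linear_image_cell[OF K'(1)[OF AI] K(3)[OF AI]]
      have dp: "\<bar>det (B A)\<bar> > 0" using K(3)[OF AI] by (simp add: invertible_det_nz)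
      have kpos: "real (k A) > 0" using k1[OF AI] by simp
      have "(\<delta> - e') * measure lebesgue ?J powr (1 + \<theta>) \<le> real (k A) powr \<theta> * qerr (2 * p) ?J (k A)"
        using k0[OF AI, of "k A"] by (simp add: k_def)
      then have q: "(\<delta> - e') * measure lebesgue ?J powr (1 + \<theta>) * real (k A) powr (- \<theta>) \<le> qerr (2 * p) ?J (k A)"
        using kpos by (simp add: powr_minus field_simps)
      have "(\<delta> / 2 powr p - e) * (c A powr (1 + \<theta>) * real (k A) powr (- \<theta>)) =
          w' A / 2 powr p / \<bar>det (B A)\<bar> * ((\<delta> - e') * measure lebesgue ?J powr (1 + \<theta>) * real (k A) powr (- \<theta>))"
        unfolding c_def cell_const_powr[OF w'[OF AI]] J(5) powr_mult e'(2)[symmetric]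
        using dp by (simp add: powr_add field_simps)
      also have "\<dots> \<le> w' A / 2 powr p / \<bar>det (B A)\<bar> * qerr (2 * p) ?J (k A)"
        using q w'[OF AI] dp by (intro mult_left_mono) auto
      also have "\<dots> \<le> integral (K' A) f"
        unfolding w'_def f
      proof (rule cell_lower[OF bspec[OF good AI] \<eta> l K'(1,2)[OF AI] V[OF AI]])
        fix x assume "x \<in> K' A"
        then show "(1 - \<eta>) / 2 * (infdist (B A *v x) (V A))\<^sup>2 \<le> v x - l x"
          using d[OF AI] A
          by (intro cell_lower_pointwise[OF bspec[OF good AI] \<eta> _ _ _ _ K'(2)[OF AI]]) (auto simp: V_def S_def)
      qed
      finally show ?thesis .
    qed
    have "(\<delta> / 2 powr p - e) * (\<Sum>K\<in>I. c K powr (1 + \<theta>) * real (k K) powr (- \<theta>)) \<le> (\<Sum>K\<in>I. integral (K' K) f)"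
      unfolding sum_distrib_left using cell by (rule sum_mono)
    also have "\<dots> \<le> integral U f"
    proof (rule sum_integral_disjoint_le)
      show sub: "K' K \<subseteq> U" if "K \<in> I" for K
        using K'(2)[OF that] K(2)[OF that] interior_subset by blast
      show "K' A \<inter> K' B = {}" if "A \<in> I" "B \<in> I" "A \<noteq> B" for A B
        using K'(2) that pw unfolding pairwise_def by blast
      show "f integrable_on U" by (rule fU[OF fm])
      show "f integrable_on K' K" if "K \<in> I" for K
      proof -
        have "K' K \<subseteq> X" using sub[OF that] U_props(4) by blast
        from error_integrable[OF fm this fmeasurableD[OF is_cube_lmeasurable[OF K'(1)[OF that]]]]
        show ?thesis using absolutely_integrable_on_def by blast
      qed
      show "0 \<le> f x" if "x \<in> U" for x using error_nonneg[OF fm] that U_props(4) by blast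
    qed (rule I)
    finally show ?thesis using k1 ksum by (intro exI[of _ k]) blast
  qed
  show "\<exists>(I :: (real^'n) set set) c N. finite I \<and> (\<forall>K\<in>I. 0 < c K) \<and> integral U \<phi> - e \<le> sum c I \<and>
      (\<forall>m\<ge>1. \<forall>f\<in>errors m. \<exists>k. (\<forall>K\<in>I. 1 \<le> k K) \<and> sum k I \<le> m + N \<and>
        (\<delta> / 2 powr p - e) * (\<Sum>K\<in>I. c K powr (1 + \<theta>) * real (k K) powr (- \<theta>)) \<le> integral U f)"
  proof (intro exI[of _ I] exI[of _ c] exI[of _ N] conjI ballI allI impI)
    show "integral U \<phi> - e \<le> sum c I" using sumc by (simp add: C_def)
    show "\<exists>k. (\<forall>K\<in>I. 1 \<le> k K) \<and> sum k I \<le> m + N \<and>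
        (\<delta> / 2 powr p - e) * (\<Sum>K\<in>I. c K powr (1 + \<theta>) * real (k K) powr (- \<theta>)) \<le> integral U f"
      if "f \<in> errors m" for m f using that by (rule low)
  qed (use I cpos in auto)
qed

text \<open>A convex set has a negligible frontier, so the boundary, where no derivatives of
  \<open>v\<close> are assumed, contributes nothing to either side of the theorem.\<close>

lemma integral_interior_eq: "integral X f = integral U (f :: real^'n \<Rightarrow> real)"
proof (rule integral_spike_set)
  have "negligible (frontier X)" using X(2) by (rule negligible_convex_frontier)
  then show "negligible {x \<in> X - U. f x \<noteq> 0}"
    by (rule negligible_subset) (use closure_subset[of X] in \<open>auto simp: frontier_def\<close>)
  show "negligible {x \<in> U - X. f x \<noteq> 0}"
    using U_props(4) by (auto intro!: negligible_subset[OF negligible_empty])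
qed

lemma approx_limit:
  assumes "U \<noteq> {}"
  shows "(\<lambda>m. real m powr \<theta> * (INF l\<in>Pc m X v. integral X (\<lambda>x. (v x - l x) powr p * W x)))
    \<longlonglongrightarrow> \<delta> / 2 powr p * integral U \<phi> powr (1 + \<theta>)"
proof -
  have "(\<lambda>m. real m powr \<theta> * (INF f\<in>errors m. integral U f)) \<longlonglongrightarrow> \<delta> / 2 powr p * integral U \<phi> powr (1 + \<theta>)"
  proof (rule tendsto_scaled_INF)
    show "0 \<le> integral U f" if "f \<in> errors k" for f k
    proof (rule integral_nonneg)
      show "f integrable_on U"
        using error_integrable[OF that U_props(4) fmeasurableD[OF U_props(5)]] absolutely_integrable_on_def by blast
      show "0 \<le> f x" if "x \<in> U" for x using error_nonneg[OF \<open>f \<in> errors k\<close>] that U_props(4) by blast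
    qed
  qed (rule approx_upper[OF assms] approx_lower; assumption)+
  then show ?thesis unfolding errors_def image_image integral_interior_eq .
qed

end

text \<open>Used when \<open>X\<close> has empty interior: all integrals vanish, and their infimum
  is 0 because the class of minorants is inhabited.\<close>

lemma Pc_nonempty:
  assumes "compact X" "continuous_on X v" "m \<ge> 1"
  shows "Pc m X v \<noteq> {}"
proof -
  have "bounded (v ` X)" using assms by (simp add: compact_continuous_image compact_imp_bounded)
  then obtain b where b: "\<And>x. x \<in> X \<Longrightarrow> \<bar>v x\<bar> \<le> b" unfolding bounded_iff by auto
  have "(\<lambda>x. Max ((\<lambda>ab. affine_fun ab x) ` {(0, - b)})) \<in> Pc m X v"
    unfolding Pc_def mem_Collect_eq
    using assms(3) b by (intro exI[of _ "{(0, - b)}"]) (auto simp: affine_fun_def abs_le_iff minus_le_iff)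
  then show ?thesis by blast
qed

theorem theorem3:
  fixes p :: real
  assumes "p > 0"
  shows "\<exists>\<delta>. zador_constant p TYPE('n::finite) \<delta> \<and>
    (\<forall>(X :: (real^'n) set) (v :: real^'n \<Rightarrow> real) (\<omega> :: real^'n \<Rightarrow> real \<Rightarrow> real).
       compact X \<and> convex X \<and> (\<exists>L. L-lipschitz_on X v) \<and> convex_on X v \<and>
       C2_plus_on (interior X) v \<and>
       continuous_on UNIV (\<lambda>(x, t). \<omega> x t) \<and> (\<forall>x t. \<omega> x t > 0)
       \<longrightarrow>
       ((\<lambda>m. real m powr (2 * p / real CARD('n)) * approx_error p X v \<omega> m)
          \<longlonglongrightarrow> \<delta> / 2 powr p *
              (integral X (\<lambda>x. det (hessian v x) powr (p / (real CARD('n) + 2 * p))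
                               * \<omega> x (v x) powr (real CARD('n) / (real CARD('n) + 2 * p))))
              powr ((real CARD('n) + 2 * p) / real CARD('n))))"
proof -
  define n where "n = real CARD('n)"
  have n: "n > 0" by (simp add: n_def)
  define \<theta> where "\<theta> = 2 * p / n"
  have ex: "(n + 2 * p) / n = 1 + \<theta>" using n by (simp add: \<theta>_def add_divide_distrib)
  \<comment> \<open>The constant is the quantization limit of the unit cube, fixed before
    \<open>X\<close>, \<open>v\<close> and \<omega> are introduced.\<close>
  obtain \<delta> where \<delta>: "\<delta> \<ge> 0" "(\<lambda>k. real k powr \<theta> * qerr (2 * p) (cbox 0 (vec 1) :: (real^'n) set) k) \<longlonglongrightarrow> \<delta>"
    "\<And>k. k \<ge> 1 \<Longrightarrow> \<delta> * real k powr (- \<theta>) \<le> qerr (2 * p) (cbox 0 (vec 1) :: (real^'n) set) k"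
    using qerr_cube_limit[of "2 * p", where 'n = 'n] assms unfolding \<theta>_def n_def by auto
  have q: "2 * p > 0" "\<theta> = 2 * p / real CARD('n)" using assms by (auto simp: \<theta>_def n_def)
  show ?thesis
  proof (intro exI[of _ \<delta>] conjI allI impI; (elim conjE exE)?)
    show "zador_constant p TYPE('n) \<delta>"
      unfolding zador_constant_def jordan_measurable_def n_def[symmetric] ex \<theta>_def[symmetric]
    proof (intro allI impI, elim conjE)
      fix J :: "(real^'n) set"
      assume "compact J" "negligible (frontier J)" "0 < measure lebesgue J"
      then show "(\<lambda>m. real m powr \<theta> * (INF S\<in>{S. S \<subseteq> J \<and> finite S \<and> card S = m}.
          integral J (\<lambda>x. Min ((\<lambda>s. norm (x - s) powr (2 * p)) ` S)))) \<longlonglongrightarrow> \<delta> * measure lebesgue J powr (1 + \<theta>)"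
        by (intro zador_limit[OF q \<delta>])
    qed
  next
    fix X :: "(real^'n) set" and v :: "real^'n \<Rightarrow> real" and \<omega> :: "real^'n \<Rightarrow> real \<Rightarrow> real" and L
    assume X: "compact X" "convex X" and lip: "L-lipschitz_on X v" and conv: "convex_on X v"
      and C2: "C2_plus_on (interior X) v"
      and \<omega>: "continuous_on UNIV (\<lambda>(x, t). \<omega> x t)" "\<forall>x t. 0 < \<omega> x t"
    obtain g H where gH: "\<forall>x\<in>interior X. (v has_derivative (\<lambda>h. g x \<bullet> h)) (at x) \<and>
        (g has_derivative (\<lambda>h. H x *v h)) (at x) \<and> (\<forall>h. h \<noteq> 0 \<longrightarrow> h \<bullet> (H x *v h) > 0)"
      and H: "continuous_on (interior X) H"
      using C2 unfolding C2_plus_on_def by blast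
    have cv: "continuous_on X v" using lip by (rule lipschitz_on_continuous_on)
    have cW: "continuous_on X (\<lambda>x. \<omega> x (v x))"
      using continuous_on_compose2[OF \<omega>(1) continuous_on_Pair[OF continuous_on_id cv]] by simp
    interpret weighted_smooth_convex X v g H L p \<theta> \<delta> "\<lambda>x. \<omega> x (v x)"
    proof
      fix J :: "(real^'n) set"
      assume "compact J" "negligible (frontier J)" "J \<noteq> {}"
      then show "(\<lambda>k. real k powr \<theta> * qerr (2 * p) J k) \<longlonglongrightarrow> \<delta> * measure lebesgue J powr (1 + \<theta>)"
        by (intro qerr_jordan_limit[OF q \<delta>])
    qed (use X lip conv gH H assms q cW \<omega>(2) \<delta>(1) in auto)
    have rhs: "integral X (\<lambda>x. det (hessian v x) powr (p / (n + 2 * p)) * \<omega> x (v x) powr (n / (n + 2 * p))) = integral U \<phi>"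
      unfolding integral_interior_eq
    proof (rule integral_cong)
      fix x assume x: "x \<in> U"
      have exponents: "\<alpha> / 2 = p / (n + 2 * p)" "\<beta> = n / (n + 2 * p)"
        unfolding \<alpha>_def \<beta>_def ex[symmetric] using n assms by (auto simp: \<theta>_def divide_simps)
      show "det (hessian v x) powr (p / (n + 2 * p)) * \<omega> x (v x) powr (n / (n + 2 * p)) = \<phi> x"
        unfolding \<phi>_def hessian_eq[OF x] exponents ..
    qed
    have "(\<lambda>m. real m powr \<theta> * approx_error p X v \<omega> m) \<longlonglongrightarrow> \<delta> / 2 powr p * integral U \<phi> powr (1 + \<theta>)"
    \<comment> \<open>\<open>uniform_approximation\<close> needs an interior point; without one both
      sides of the limit are 0.\<close>
    proof (cases "U = {}")
      case False
      then show ?thesis unfolding approx_error_def by (rule approx_limit)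
    next
      case True
      have "\<forall>\<^sub>F m in sequentially. 0 = real m powr \<theta> * approx_error p X v \<omega> m"
        using eventually_ge_at_top[of 1]
      proof eventually_elim
        case (elim m)
        then show ?case
          using Pc_nonempty[OF X(1) cv elim] unfolding approx_error_def integral_interior_eq True by simp
      qed
      then have "(\<lambda>m. real m powr \<theta> * approx_error p X v \<omega> m) \<longlonglongrightarrow> 0"
        by (rule Lim_transform_eventually[OF tendsto_const])
      then show ?thesis unfolding True by simp
    qed
    then show "(\<lambda>m. real m powr (2 * p / real CARD('n)) * approx_error p X v \<omega> m)
          \<longlonglongrightarrow> \<delta> / 2 powr p *
              (integral X (\<lambda>x. det (hessian v x) powr (p / (real CARD('n) + 2 * p))
                               * \<omega> x (v x) powr (real CARD('n) / (real CARD('n) + 2 * p))))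
              powr ((real CARD('n) + 2 * p) / real CARD('n))"
      unfolding n_def[symmetric] ex rhs \<theta>_def[symmetric] .
  qed
qed

end
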